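(* Let $m\ge2$, let $W$ be $G(m,1,n)$ or $G(m,m,n)$, and let $g\in W$. (i) Suppose either $W=G(m,1,n)$ and $g$ has one cycle of length $\lambda_0$ whose color generates $\mathbb Z/m\mathbb Z$ and $k$ further cycles, of lengths $\lambda_1,\dots,\lambda_k$, of color $0$; or $W=G(m,m,n)$ and $g$ has two cycles whose colors sum to $0$ and generate $\mathbb Z/m\mathbb Z$, of total length $\lambda_0$, and $k$ further cycles, of lengths $\lambda_1,\dots,\lambda_k$, of color $0$. Then \[ \#\mathrm{RGS}(W,g)=m^k\,n^{k-1}\prod_{i=0}^k\lambda_i. \] (ii) If $W=G(m,1,n)$ and $g$ has $k$ cycles, of lengths $\lambda_1,\dots,\lambda_k$, all of color $0$, then \[ \#\mathrm{RGS}(W,g)=\varphi(m)\,m^{k-1}n^{k-1}\prod_{i=1}^k\lambda_i. \] (iii) If $W=G(m,m,n)$ and $g$ has $k$ cycles, of lengths $\lambda_1,\dots,\lambda_k$, all of color $0$, then \[ \#\mathrm{RGS}(W,g)=\frac{\varphi(m)\,m^{k-1}}{2}\Big(n^k-n^{k-1}-\sum_{j=2}^k(j-2)!\,n^{k-j}e_j(\lambda)\Big)\prod_{i=1}^k\lambda_i. \]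
   Context: $G(m,p,n)$ is the group of $n\times n$ monomial matrices whose nonzero entries are $m$th roots of unity with product an $(m/p)$th root of unity; it is a complex reflection group of rank $n$ (for $m\ge2$), well generated when $p\in\{1,m\}$. Elements of $G(m,1,n)$ are encoded $[u;a]$ with $u\in\mathfrak S_n$, $a\in(\mathbb Z/m\mathbb Z)^n$ (entry of column $k$ in row $u(k)$, equal to $e^{2\pi i a_k/m}$); cycles of $g$ are the cycles of $u$ and the color of a cycle $C$ is $\sum_{k\in C}a_k$. Reflections: $[(ij);ke_i-ke_j]$ for $i\neq j$, $k\in\mathbb Z/m\mathbb Z$, and (in $G(m,1,n)$ only) diagonal reflections $[\mathrm{id};ce_i]$, $c\neq0$. $\ell_R$ is reflection length. For $\ell_R(g)=r$, $\mathrm{RGS}(W,g)$ is the set of sets $\{t_1,\dots,t_{n-r}\}$ of reflections for which some reduced reflection factorization $g=t_{n-r+1}\cdots t_n$ has $\{t_1,\dots,t_n\}$ generating $W$. $\varphi$ is Euler's totient function and $e_j(\lambda)$ is the $j$th elementary symmetric polynomial in $\lambda_1,\dots,\lambda_k$. *)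

theory Defs
  imports "HOL-Algebra.Generated_Groups" "HOL-Combinatorics.Permutations"
          "HOL-Number_Theory.Totient" Complex_Main
begin

type_synonym elt = "(nat \<Rightarrow> nat) \<times> (nat \<Rightarrow> nat)"

text \<open>An element [u;a] of G(m,1,n): u a permutation of {0..<n}, a a vector of
  residues in {0..<m} (indices 0..<n; zero outside). The matrix entry of
  column k is exp(2 pi i a_k / m) in row u k.\<close>

definition Gcarrier :: "nat \<Rightarrow> nat \<Rightarrow> nat \<Rightarrow> elt set" where
  "Gcarrier m p n = {(u, a). u permutes {..<n} \<and> (\<forall>k<n. a k < m) \<and>
       (\<forall>k\<ge>n. a k = 0) \<and> p dvd (\<Sum>k<n. a k)}"

text \<open>Matrix product: [u;a][v;b] = [u o v; a o v + b].\<close>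
definition Gmult :: "nat \<Rightarrow> nat \<Rightarrow> elt \<Rightarrow> elt \<Rightarrow> elt" where
  "Gmult m n x y = (fst x \<circ> fst y,
      (\<lambda>k. if k < n then (snd x (fst y k) + snd y k) mod m else 0))"

definition G :: "nat \<Rightarrow> nat \<Rightarrow> nat \<Rightarrow> elt monoid" where
  "G m p n = \<lparr> carrier = Gcarrier m p n, monoid.mult = Gmult m n, one = (id, (\<lambda>_. 0)) \<rparr>"

definition transp :: "nat \<Rightarrow> nat \<Rightarrow> nat \<Rightarrow> nat" where
  "transp i j = (\<lambda>x. if x = i then j else if x = j then i else x)"

definition Refl :: "nat \<Rightarrow> nat \<Rightarrow> nat \<Rightarrow> elt set" where
  "Refl m p n = ({(transp i j, (\<lambda>k. if k = i then c else if k = j then (m - c) mod m else 0))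
                   | i j c. i < n \<and> j < n \<and> i \<noteq> j \<and> c < m}
               \<union> {(id, (\<lambda>k. if k = i then c else 0)) | i c. i < n \<and> 0 < c \<and> c < m})
               \<inter> Gcarrier m p n"

definition listprod :: "'a monoid \<Rightarrow> 'a list \<Rightarrow> 'a" where
  "listprod W xs = foldr (monoid.mult W) xs (one W)"

definition refl_length :: "'a monoid \<Rightarrow> 'a set \<Rightarrow> 'a \<Rightarrow> nat" where
  "refl_length W R g = (LEAST r. \<exists>fs. length fs = r \<and> set fs \<subseteq> R \<and> listprod W fs = g)"

definition RGS :: "'a monoid \<Rightarrow> 'a set \<Rightarrow> nat \<Rightarrow> 'a \<Rightarrow> 'a set set" where
  "RGS W R rk g = {T. \<exists>ts fs. T = set ts \<and> length ts = rk - refl_length W R g \<and>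
       set ts \<subseteq> R \<and> set fs \<subseteq> R \<and> length fs = refl_length W R g \<and>
       listprod W fs = g \<and> generate W (set ts \<union> set fs) = carrier W}"

definition cycle_of :: "(nat \<Rightarrow> nat) \<Rightarrow> nat \<Rightarrow> nat set" where
  "cycle_of u k = {(u ^^ j) k | j. True}"

definition cycles :: "nat \<Rightarrow> (nat \<Rightarrow> nat) \<Rightarrow> nat set set" where
  "cycles n u = cycle_of u ` {..<n}"

definition color :: "nat \<Rightarrow> (nat \<Rightarrow> nat) \<Rightarrow> nat set \<Rightarrow> nat" where
  "color m a C = (\<Sum>k\<in>C. a k) mod m"

definition esym :: "nat \<Rightarrow> nat \<Rightarrow> (nat \<Rightarrow> nat) \<Rightarrow> nat" where
  "esym j k lam = (\<Sum>S\<in>{S. S \<subseteq> {1..k} \<and> card S = j}. \<Prod>i\<in>S. lam i)"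

end

theory Submission
  imports Defs "HOL-Library.Disjoint_Sets" "HOL-Computational_Algebra.Polynomial"
    "HOL-Combinatorics.Orbits"
begin

text \<open>
  Read a reflection \<open>[(i j); c e\<^sub>i - c e\<^sub>j]\<close> as an edge from \<open>i\<close> to \<open>j\<close> with gain \<open>c\<close>. A set of
  reflections generates \<open>G(m,m,n)\<close> (\<open>n \<ge> 2\<close>) iff its gain graph is connected and, for no \<open>q > 1\<close>
  dividing \<open>m\<close>, the gains are differences \<open>\<theta> j - \<theta> i\<close> of a potential modulo \<open>q\<close>; it generates
  \<open>G(m,1,n)\<close> iff it is connected and no \<open>q > 1\<close> dividing \<open>m\<close> divides the total colors of all its
  members. Joining blocks of vertices along edges shows that the components of a reduced
  factorization of \<open>g\<close> are exactly the cycles of \<open>g\<close> (except that for \<open>G(m,m,n)\<close> the two cycles of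
  nonzero color share a component), so membership of \<open>T\<close> in \<open>RGS(W,g)\<close> depends only on how \<open>T\<close>
  joins the cycles: \<open>T\<close> is a spanning tree on these blocks, or a spanning tree together with a
  diagonal reflection of unit color, or a connected unicyclic graph whose cycle has unit gain.

  These sets are counted by induction on the number of blocks. Marking an edge \<open>t\<close> of \<open>T\<close> and
  merging the two blocks that it joins gives \<open>|T| N(P) = \<Sum>\<^sub>t N(merge P t)\<close>, plus a term for the
  edges inside a block in the unicyclic case. Since blocks \<open>B\<close>, \<open>B'\<close> are joined by \<open>m |B| |B'|\<close>
  edges, the closed forms follow from identities between elementary symmetric polynomials.
\<close>

section \<open>Colored permutations as pairs with integer colors\<close>

text \<open>\<open>RGS\<close> quantifies over all reduced factorizations of \<open>g\<close>, so
  their influence on \<open>T\<close> has to be eliminated. A reduced factorization has no edges to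
  spare, which forces its components as a partition; and a potential that balances \<open>g\<close>
  is determined by \<open>g\<close> up to a constant on each cycle. Hence blocks together with a
  potential replace the graphs inside the blocks. This description survives merging along an edge,
  provided that the potential is shifted on one of the two blocks so that the edge becomes balanced.
  Divisors \<open>q > 1\<close> of \<open>m\<close> enter because the gains of closed walks generate
  a subgroup of the integers modulo \<open>m\<close>, which is proper iff it lies in the multiples
  of some such \<open>q\<close>. The factorials in (iii) come from merging: summing over pairs sends
  the coefficient of \<open>e_j\<close> to that of \<open>e_(j+1)\<close> with a new factor
  \<open>j - 1\<close>, so that \<open>(j-2)!\<close> becomes \<open>(j-1)!\<close>. The series
  starts at \<open>e_2\<close> because the edges inside blocks contribute a sum of squares,
  \<open>n^2 - 2 e_2\<close>.\<close>

lemma transp_eq_transpose: "Defs.transp i j = Transposition.transpose i j"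
  by (auto simp: Defs.transp_def Transposition.transpose_def)

locale colored_perms =
  fixes m n :: nat
  assumes m2: "2 \<le> m" and n1: "1 \<le> n"
begin

abbreviation V :: "nat set" where "V \<equiv> {..<n}"

text \<open>Integer representatives of the colors: inverses become negatives, and equality of
  elements becomes congruence modulo \<open>m\<close> at the indices below \<open>n\<close>.\<close>

definition elt_of :: "(nat \<Rightarrow> nat) \<Rightarrow> (nat \<Rightarrow> int) \<Rightarrow> elt" where
  "elt_of u b = (u, \<lambda>k. if k < n then nat (b k mod int m) else 0)"

lemma m_pos: "0 < int m" using m2 by simp

lemma fst_elt_of [simp]: "fst (elt_of u b) = u"
  by (simp add: elt_of_def)

lemma snd_elt_of: "k < n \<Longrightarrow> int (snd (elt_of u b) k) = b k mod int m"
  using m_pos by (simp add: elt_of_def)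

lemma elt_of_eq_iff:
  "elt_of u b = elt_of v c \<longleftrightarrow> u = v \<and> (\<forall>k<n. [b k = c k] (mod int m))"
  using m_pos by (auto simp: elt_of_def fun_eq_iff cong_def eq_nat_nat_iff)

lemma elt_of_cong: "(\<And>k. k < n \<Longrightarrow> [b k = c k] (mod int m)) \<Longrightarrow> elt_of u b = elt_of u c"
  by (simp add: elt_of_eq_iff)

lemma permutes_less: "v permutes V \<Longrightarrow> k < n \<Longrightarrow> v k < n"
  using permutes_in_image[of v V k] by auto

lemma Gmult_elt_of:
  assumes "v permutes V"
  shows "Gmult m n (elt_of u b) (elt_of v c) = elt_of (u \<circ> v) (\<lambda>k. b (v k) + c k)"
proof -
  have "int ((nat x + nat y) mod m) = (x + y) mod int m" if "0 \<le> x" "0 \<le> y" for x y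
    using that by (simp add: zmod_int)
  from this[of "x mod int m" "y mod int m" for x y]
  have "(nat (b (v k) mod int m) + nat (c k mod int m)) mod m = nat ((b (v k) + c k) mod int m)"
    for k
    using m_pos by (metis mod_add_eq nat_int pos_mod_sign)
  then show ?thesis
    using permutes_less[OF assms] by (auto simp: Gmult_def elt_of_def fun_eq_iff)
qed

text \<open>Reducing colors modulo \<open>m\<close> does not change their sum modulo a divisor
  \<open>p\<close> of \<open>m\<close>, so membership can be tested on any representatives.\<close>

lemma elt_of_in_iff:
  assumes "p dvd m"
  shows "elt_of u b \<in> Gcarrier m p n \<longleftrightarrow> u permutes V \<and> int p dvd (\<Sum>k<n. b k)"
proof -
  have "int (\<Sum>k<n. nat (b k mod int m)) = (\<Sum>k<n. b k mod int m)"
    using m_pos by simp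
  moreover have "[(\<Sum>k<n. b k mod int m) = (\<Sum>k<n. b k)] (mod int p)"
    using assms by (intro cong_sum) (simp add: cong_def mod_mod_cancel)
  ultimately have "p dvd (\<Sum>k<n. nat (b k mod int m)) \<longleftrightarrow> int p dvd (\<Sum>k<n. b k)"
    by (metis cong_dvd_iff int_dvd_int_iff)
  then show ?thesis
    using m_pos by (auto simp: Gcarrier_def elt_of_def nat_less_iff)
qed

lemma Gcarrier_elt_of:
  "x \<in> Gcarrier m p n \<Longrightarrow> x = elt_of (fst x) (\<lambda>k. int (snd x k))"
  by (auto simp: Gcarrier_def elt_of_def fun_eq_iff)

lemma Gcarrier_permutes: "x \<in> Gcarrier m p n \<Longrightarrow> fst x permutes V"
  by (auto simp: Gcarrier_def)

lemma Gcarrier_cases: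
  assumes "p dvd m" "x \<in> Gcarrier m p n"
  obtains u b where "x = elt_of u b" "u permutes V" "int p dvd (\<Sum>k<n. b k)"
  using assms Gcarrier_elt_of[OF assms(2)] elt_of_in_iff[OF assms(1)] by metis

lemma G_simps [simp]:
  "carrier (G m p n) = Gcarrier m p n" "monoid.mult (G m p n) = Gmult m n"
  "one (G m p n) = elt_of id (\<lambda>_. 0)"
  by (auto simp: G_def elt_of_def)

lemma sum_permutes_eq: "v permutes V \<Longrightarrow> (\<Sum>k<n. b (v k)) = (\<Sum>k<n. (b k :: int))"
  using sum.permute[of v V b] by (simp add: comp_def)

lemma elt_of_left_inverse:
  assumes "u permutes V"
  shows "Gmult m n (elt_of (Hilbert_Choice.inv u) (\<lambda>k. - b (Hilbert_Choice.inv u k))) (elt_of u b) = elt_of id (\<lambda>_. 0)"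
  using assms permutes_inverses[OF assms]
  by (simp add: Gmult_elt_of permutes_inv_o)

lemma group_G:
  assumes "p dvd m"
  shows "group (G m p n)"
proof (rule groupI; simp)
  note [simp] = elt_of_in_iff[OF assms]
  fix x y assume xy: "x \<in> Gcarrier m p n" "y \<in> Gcarrier m p n"
  then show "Gmult m n x y \<in> Gcarrier m p n"
    by (elim Gcarrier_cases[OF assms])
      (simp add: Gmult_elt_of permutes_compose sum.distrib sum_permutes_eq)
next
  note [simp] = elt_of_in_iff[OF assms]
  show "elt_of id (\<lambda>_. 0) \<in> Gcarrier m p n" by (simp add: permutes_id)
next
  fix x y z assume "x \<in> Gcarrier m p n" "y \<in> Gcarrier m p n" "z \<in> Gcarrier m p n"
  then show "Gmult m n (Gmult m n x y) z = Gmult m n x (Gmult m n y z)"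
    by (elim Gcarrier_cases[OF assms]) (simp add: Gmult_elt_of permutes_compose comp_assoc add.assoc)
next
  fix x assume "x \<in> Gcarrier m p n"
  then show "Gmult m n (elt_of id (\<lambda>_. 0)) x = x"
    by (elim Gcarrier_cases[OF assms]) (simp add: Gmult_elt_of)
next
  note [simp] = elt_of_in_iff[OF assms]
  fix x assume "x \<in> Gcarrier m p n"
  then show "\<exists>y\<in>Gcarrier m p n. Gmult m n y x = elt_of id (\<lambda>_. 0)"
  proof (elim Gcarrier_cases[OF assms])
    fix u b assume *: "x = elt_of u b" "u permutes V" "int p dvd (\<Sum>k<n. b k)"
    have "elt_of (Hilbert_Choice.inv u) (\<lambda>k. - b (Hilbert_Choice.inv u k)) \<in> Gcarrier m p n"
      using * permutes_inv[OF *(2)] by (simp add: sum_negf sum_permutes_eq)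
    then show ?thesis using elt_of_left_inverse[OF *(2)] * by blast
  qed
qed

lemma inv_elt_of:
  assumes "p dvd m" "elt_of u b \<in> Gcarrier m p n"
  shows "m_inv (G m p n) (elt_of u b) = elt_of (Hilbert_Choice.inv u) (\<lambda>k. - b (Hilbert_Choice.inv u k))"
proof -
  have u: "u permutes V" "int p dvd (\<Sum>k<n. b k)" using assms by (auto simp: elt_of_in_iff)
  have "elt_of (Hilbert_Choice.inv u) (\<lambda>k. - b (Hilbert_Choice.inv u k)) \<in> Gcarrier m p n"
    using u permutes_inv[OF u(1)] assms by (simp add: elt_of_in_iff sum_negf sum_permutes_eq)
  then show ?thesis
    using group.inv_equality[OF group_G[OF assms(1)]] elt_of_left_inverse[OF u(1)] assms by simp
qed

lemma finite_Gcarrier: "finite (Gcarrier m p n)"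
proof -
  have "Gcarrier m p n \<subseteq> {u. u permutes V} \<times>
      {a. \<forall>k. (k \<in> V \<longrightarrow> a k \<in> {..<m}) \<and> (k \<notin> V \<longrightarrow> a k = 0)}"
    by (auto simp: Gcarrier_def)
  then show ?thesis
    by (rule finite_subset)
      (intro finite_cartesian_product finite_permutations finite_set_of_finite_funs; simp)
qed

section \<open>Invariants that cut out subgroups\<close>

definition preserves :: "nat set \<Rightarrow> elt \<Rightarrow> bool" where
  "preserves A x \<longleftrightarrow> (\<forall>k. fst x k \<in> A \<longleftrightarrow> k \<in> A)"

text \<open>Conjugation by the diagonal matrix with exponents \<open>\<theta>\<close> turns such an
  \<open>x\<close> into a plain permutation matrix modulo \<open>q\<close>. The balanced elements
  thus form a conjugate of the symmetric group modulo \<open>q\<close>.\<close>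

definition balanced :: "int \<Rightarrow> (nat \<Rightarrow> int) \<Rightarrow> elt \<Rightarrow> bool" where
  "balanced q \<theta> x \<longleftrightarrow> (\<forall>k<n. [int (snd x k) = \<theta> (fst x k) - \<theta> k] (mod q))"

lemma preserves_elt_of [simp]: "preserves A (elt_of u b) \<longleftrightarrow> (\<forall>k. u k \<in> A \<longleftrightarrow> k \<in> A)"
  by (simp add: preserves_def)

lemma mod_m_cong: "q dvd int m \<Longrightarrow> [c mod int m = c] (mod q)"
  by (simp add: cong_def mod_mod_cancel)

lemma balanced_elt_of:
  assumes "q dvd int m"
  shows "balanced q \<theta> (elt_of u b) \<longleftrightarrow> (\<forall>k<n. [b k = \<theta> (u k) - \<theta> k] (mod q))"
  unfolding balanced_def using mod_m_cong[OF assms] by (auto simp: snd_elt_of cong_def)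

lemma colsum_elt_of:
  assumes "q dvd int m" "A \<subseteq> V"
  shows "q dvd (\<Sum>k\<in>A. int (snd (elt_of u b) k)) \<longleftrightarrow> q dvd (\<Sum>k\<in>A. b k)"
proof -
  have "[(\<Sum>k\<in>A. int (snd (elt_of u b) k)) = (\<Sum>k\<in>A. b k)] (mod q)"
    using assms mod_m_cong[OF assms(1)] by (intro cong_sum) (auto simp: snd_elt_of)
  then show ?thesis by (rule cong_dvd_iff)
qed

lemma subgroup_of_invariant:
  assumes p: "p dvd m" and "\<phi> (elt_of id (\<lambda>_. 0))"
    and "\<And>u b v c. u permutes V \<Longrightarrow> v permutes V \<Longrightarrow> \<phi> (elt_of u b) \<Longrightarrow> \<phi> (elt_of v c) \<Longrightarrow>
      \<phi> (elt_of (u \<circ> v) (\<lambda>k. b (v k) + c k))"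
    and "\<And>u b. u permutes V \<Longrightarrow> \<phi> (elt_of u b) \<Longrightarrow> \<phi> (elt_of (Hilbert_Choice.inv u) (\<lambda>k. - b (Hilbert_Choice.inv u k)))"
  shows "subgroup {x \<in> Gcarrier m p n. \<phi> x} (G m p n)"
proof -
  interpret group "G m p n" by (rule group_G[OF p])
  show ?thesis
  proof (rule subgroup.intro)
    show "one (G m p n) \<in> {x \<in> Gcarrier m p n. \<phi> x}" using assms(2) one_closed by simp
  next
    fix x y assume *: "x \<in> {x \<in> Gcarrier m p n. \<phi> x}" "y \<in> {x \<in> Gcarrier m p n. \<phi> x}"
    obtain u b v c where 1: "x = elt_of u b" "y = elt_of v c" "u permutes V" "v permutes V"
      using * by (auto elim!: Gcarrier_cases[OF p])
    then show "monoid.mult (G m p n) x y \<in> {x \<in> Gcarrier m p n. \<phi> x}"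
      using assms(3)[OF 1(3,4)] * Gmult_elt_of[OF 1(4)] m_closed[of x y] by auto
  next
    fix x assume *: "x \<in> {x \<in> Gcarrier m p n. \<phi> x}"
    obtain u b where 1: "x = elt_of u b" "u permutes V"
      using * by (auto elim!: Gcarrier_cases[OF p])
    then show "m_inv (G m p n) x \<in> {x \<in> Gcarrier m p n. \<phi> x}"
      using assms(4)[OF 1(2)] * inv_elt_of[OF p, of u b] inv_closed[of x] by auto
  qed auto
qed

lemma subgroup_preserves:
  assumes "p dvd m" shows "subgroup {x \<in> Gcarrier m p n. preserves A x} (G m p n)"
  by (rule subgroup_of_invariant[OF assms]) (simp_all, metis permutes_inverses(1))

lemma subgroup_balanced:
  assumes p: "p dvd m" and q: "q dvd int m"
  shows "subgroup {x \<in> Gcarrier m p n. balanced q \<theta> x} (G m p n)"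
proof (rule subgroup_of_invariant[OF p]; simp add: balanced_elt_of[OF q])
  fix u b v c
  assume *: "v permutes V" "\<forall>k<n. [b k = \<theta> (u k) - \<theta> k] (mod q)"
    "\<forall>k<n. [c k = \<theta> (v k) - \<theta> k] (mod q)"
  show "\<forall>k<n. [b (v k) + c k = \<theta> (u (v k)) - \<theta> k] (mod q)"
  proof (intro allI impI)
    fix k assume "k < n"
    then have "[b (v k) + c k = (\<theta> (u (v k)) - \<theta> (v k)) + (\<theta> (v k) - \<theta> k)] (mod q)"
      using * permutes_less by (intro cong_add) auto
    then show "[b (v k) + c k = \<theta> (u (v k)) - \<theta> k] (mod q)" by simp
  qed
next
  fix u b assume *: "u permutes V" "\<forall>k<n. [b k = \<theta> (u k) - \<theta> k] (mod q)"
  show "\<forall>k<n. [- b (Hilbert_Choice.inv u k) = \<theta> (Hilbert_Choice.inv u k) - \<theta> k] (mod q)"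
  proof (intro allI impI)
    fix k assume "k < n"
    then have "[b (Hilbert_Choice.inv u k) = \<theta> (u (Hilbert_Choice.inv u k)) - \<theta> (Hilbert_Choice.inv u k)] (mod q)"
      using * permutes_less[OF permutes_inv] by blast
    then show "[- b (Hilbert_Choice.inv u k) = \<theta> (Hilbert_Choice.inv u k) - \<theta> k] (mod q)"
      using cong_minus_minus_iff permutes_inverses(1)[OF *(1)] by (metis minus_diff_eq)
  qed
qed

text \<open>The colors on \<open>A\<close> add up under products only if \<open>A\<close> is
  preserved: then the permutation merely reorders the sum over \<open>A\<close>. For
  \<open>A = V\<close> the sum is the total color.\<close>

lemma subgroup_colsum:
  assumes p: "p dvd m" and q: "q dvd int m" and A: "A \<subseteq> V"
  shows "subgroup {x \<in> Gcarrier m p n. preserves A x \<and> q dvd (\<Sum>k\<in>A. int (snd x k))} (G m p n)"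
proof (rule subgroup_of_invariant[OF p]; simp add: colsum_elt_of[OF q A])
  have reindex: "(\<Sum>k\<in>A. b (v k)) = (\<Sum>k\<in>A. b k)"
    if "v permutes V" "\<forall>k. v k \<in> A \<longleftrightarrow> k \<in> A" for v and b :: "nat \<Rightarrow> int"
  proof (rule sum.reindex_bij_betw)
    show "bij_betw v A A"
      using that permutes_inj[OF that(1)] permutes_inverses(1)[OF that(1)]
      by (auto simp: bij_betw_def inj_on_def image_iff) metis
  qed
  fix u b v c
  show "q dvd (\<Sum>k\<in>A. b (v k) + c k)"
    if "v permutes V" "(\<forall>k. u k \<in> A \<longleftrightarrow> k \<in> A) \<and> q dvd sum b A" "(\<forall>k. v k \<in> A \<longleftrightarrow> k \<in> A) \<and> q dvd sum c A"
    using that by (simp add: sum.distrib reindex)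
  show "(\<forall>k. Hilbert_Choice.inv u k \<in> A \<longleftrightarrow> k \<in> A) \<and> q dvd (\<Sum>k\<in>A. - b (Hilbert_Choice.inv u k))"
    if *: "u permutes V" "(\<forall>k. u k \<in> A \<longleftrightarrow> k \<in> A) \<and> q dvd sum b A"
  proof -
    have "\<forall>k. Hilbert_Choice.inv u k \<in> A \<longleftrightarrow> k \<in> A" using * by (metis permutes_inverses(1))
    then show ?thesis using * permutes_inv[OF *(1)] by (simp add: sum_negf reindex)
  qed
qed

lemma generate_invariant:
  assumes "p dvd m" "subgroup {x \<in> Gcarrier m p n. \<phi> x} (G m p n)"
    "X \<subseteq> Gcarrier m p n" "\<forall>x\<in>X. \<phi> x" "y \<in> generate (G m p n) X"
  shows "\<phi> y"
  using group.generate_subgroup_incl[OF group_G[OF assms(1)] _ assms(2), of X] assms by auto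

lemmas generate_preserves = generate_invariant[OF _ subgroup_preserves]
lemmas generate_balanced = generate_invariant[OF _ subgroup_balanced]
lemmas generate_colsum = generate_invariant[OF _ subgroup_colsum]

end

section \<open>Reflections and generation\<close>

text \<open>A subgroup of the integers is generated by its least positive member; \<open>m\<close>
  guarantees that there is one.\<close>

lemma int_subgroup_generator:
  fixes D :: "int set"
  assumes diff: "\<And>a b. a \<in> D \<Longrightarrow> b \<in> D \<Longrightarrow> a - b \<in> D" and m: "m \<in> D" "0 < m"
  obtains d where "0 < d" "d \<in> D" "\<And>e. e \<in> D \<Longrightarrow> d dvd e"
proof -
  define k where "k = (LEAST k. 0 < k \<and> int k \<in> D)"
  have "0 < nat m \<and> int (nat m) \<in> D" using m by simp
  then have k: "0 < k" "int k \<in> D" unfolding k_def by (metis (mono_tags, lifting) LeastI)+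
  have zero: "0 \<in> D" using diff[OF m(1) m(1)] by simp
  have neg: "- a \<in> D" if "a \<in> D" for a using diff[OF zero that] by simp
  have mult: "int j * int k \<in> D" for j
  proof (induction j)
    case (Suc j)
    have "int j * int k - (- int k) \<in> D" using diff[OF Suc neg[OF k(2)]] .
    then show ?case by (simp add: algebra_simps)
  qed (use zero in simp)
  have mult': "z * int k \<in> D" for z
    using mult[of "nat z"] neg[OF mult[of "nat (- z)"]] by (cases "0 \<le> z") auto
  have "int k dvd e" if "e \<in> D" for e
  proof -
    have "e - (e div int k) * int k \<in> D" using diff[OF that mult'] .
    then have r: "e mod int k \<in> D" by (simp add: minus_div_mult_eq_mod)
    have "\<not> (0 < nat (e mod int k) \<and> int (nat (e mod int k)) \<in> D)"
      using not_less_Least[of "nat (e mod int k)" "\<lambda>k. 0 < k \<and> int k \<in> D"] k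
      unfolding k_def[symmetric] by (simp add: nat_less_iff)
    then have "e mod int k = 0" using r k by (metis int_nat_eq neq0_conv nat_0_iff of_nat_0_less_iff
        pos_mod_sign order.antisym)
    then show ?thesis by auto
  qed
  with k show thesis by (intro that[of "int k"]) auto
qed

context colored_perms
begin

text \<open>As a matrix, \<open>edge i j c\<close> sends \<open>e\<^sub>i\<close> to \<open>\<zeta>\<^sup>c e\<^sub>j\<close> and \<open>e\<^sub>j\<close> to \<open>\<zeta>\<^sup>-\<^sup>c e\<^sub>i\<close>, where \<open>\<zeta> = exp (2 \<pi> \<i> / m)\<close>.\<close>

definition edge :: "nat \<Rightarrow> nat \<Rightarrow> int \<Rightarrow> elt" where
  "edge i j c = elt_of (Transposition.transpose i j)
     (\<lambda>k. if k = i then c else if k = j then - c else 0)"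

definition diag :: "nat \<Rightarrow> int \<Rightarrow> elt" where
  "diag i c = elt_of id (\<lambda>k. if k = i then c else 0)"

definition edges :: "elt set" where
  "edges = {edge i j c | i j c. i < n \<and> j < n \<and> i \<noteq> j}"

definition diags :: "elt set" where
  "diags = {diag i c | i c. i < n \<and> \<not> int m dvd c}"

lemma edge_cong: "[c = d] (mod int m) \<Longrightarrow> edge i j c = edge i j d"
  unfolding edge_def by (rule elt_of_cong) (auto simp: cong_minus_minus_iff)

lemma diag_cong: "[c = d] (mod int m) \<Longrightarrow> diag i c = diag i d"
  unfolding diag_def by (rule elt_of_cong) auto

lemma edge_sym: "i \<noteq> j \<Longrightarrow> edge i j c = edge j i (- c)"
  unfolding edge_def by (auto simp: transpose_commute elt_of_eq_iff)

lemma EdI: "i < n \<Longrightarrow> j < n \<Longrightarrow> i \<noteq> j \<Longrightarrow> edge i j c \<in> edges"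
  by (auto simp: edges_def)

lemma EdE:
  assumes "x \<in> edges"
  obtains i j c where "x = edge i j c" "i < n" "j < n" "i \<noteq> j"
  using assms by (auto simp: edges_def)

lemma transpose_permutes: "i < n \<Longrightarrow> j < n \<Longrightarrow> Transposition.transpose i j permutes V"
  by (simp add: permutes_swap_id)

lemma edge_in: "p dvd m \<Longrightarrow> i < n \<Longrightarrow> j < n \<Longrightarrow> i \<noteq> j \<Longrightarrow> edge i j c \<in> Gcarrier m p n"
  by (simp add: edge_def elt_of_in_iff transpose_permutes sum.If_cases Int_commute
      sum.delta' if_distrib[where f = "\<lambda>x. - x"] sum.remove[of V i] sum.remove[of "V - {i}" j])

lemma edges_subset: "p dvd m \<Longrightarrow> edges \<subseteq> Gcarrier m p n"
  by (auto elim!: EdE simp: edge_in)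

lemma diag_in: "i < n \<Longrightarrow> diag i c \<in> Gcarrier m 1 n"
  by (simp add: diag_def elt_of_in_iff permutes_id)

lemma diags_subset: "diags \<subseteq> Gcarrier m 1 n"
  by (auto simp: diags_def intro: diag_in[simplified])

lemma edge_nat:
  assumes "i < n" "j < n" "i \<noteq> j" "c < m"
  shows "edge i j (int c) =
    (Defs.transp i j, \<lambda>k. if k = i then c else if k = j then (m - c) mod m else 0)"
proof -
  have "nat ((- int c) mod int m) = (m - c) mod m"
    using assms by (cases "c = 0") (auto simp: zmod_zminus1_eq_if nat_diff_distrib)
  then show ?thesis
    using assms by (auto simp: edge_def elt_of_def transp_eq_transpose fun_eq_iff)
qed

lemma diag_nat: "i < n \<Longrightarrow> c < m \<Longrightarrow> diag i (int c) = (id, \<lambda>k. if k = i then c else 0)"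
  by (auto simp: diag_def elt_of_def fun_eq_iff)

lemma residue:
  obtains c' where "c' < m" "[int c' = c] (mod int m)"
  using m_pos that[of "nat (c mod int m)"] by (simp add: cong_def nat_less_iff)

lemma edges_eq:
  "edges = {(Defs.transp i j, (\<lambda>k. if k = i then c else if k = j then (m - c) mod m else 0))
                   | i j c. i < n \<and> j < n \<and> i \<noteq> j \<and> c < m}"
proof -
  have "edges = {edge i j (int c) | i j c. i < n \<and> j < n \<and> i \<noteq> j \<and> c < m}"
  proof (intro equalityI subsetI)
    fix x assume "x \<in> edges"
    then obtain i j c where x: "x = edge i j c" "i < n" "j < n" "i \<noteq> j" by (rule EdE)
    obtain c' where c': "c' < m" "[int c' = c] (mod int m)" by (rule residue)
    then have "x = edge i j (int c')" using x by (auto intro: edge_cong cong_sym)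
    with c' x show "x \<in> {edge i j (int c) | i j c. i < n \<and> j < n \<and> i \<noteq> j \<and> c < m}" by blast
  qed (auto intro: EdI)
  also have "\<dots> = {(Defs.transp i j, (\<lambda>k. if k = i then c else if k = j then (m - c) mod m else 0))
                   | i j c. i < n \<and> j < n \<and> i \<noteq> j \<and> c < m}"
    by (intro Collect_cong ex_cong1) (auto simp: edge_nat)
  finally show ?thesis .
qed

lemma diags_eq: "diags = {(id, (\<lambda>k. if k = i then c else 0)) | i c. i < n \<and> 0 < c \<and> c < m}"
proof -
  have "diags = {diag i (int c) | i c. i < n \<and> 0 < c \<and> c < m}"
  proof (intro equalityI subsetI)
    fix x assume "x \<in> diags"
    then obtain i c where x: "x = diag i c" "i < n" "\<not> int m dvd c" by (auto simp: diags_def)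
    obtain c' where c': "c' < m" "[int c' = c] (mod int m)" by (rule residue)
    then have "x = diag i (int c')" using x by (auto intro: diag_cong cong_sym)
    moreover have "c' \<noteq> 0"
      using c' x by (metis cong_0_iff cong_sym of_nat_0)
    ultimately have "x = diag i (int c')" "c' \<noteq> 0" by auto
    with c' x show "x \<in> {diag i (int c) | i c. i < n \<and> 0 < c \<and> c < m}" by blast
  qed (fastforce simp: diags_def dest: nat_dvd_not_less)
  also have "\<dots> = {(id, (\<lambda>k. if k = i then c else 0)) | i c. i < n \<and> 0 < c \<and> c < m}"
    by (intro Collect_cong ex_cong1) (auto simp: diag_nat)
  finally show ?thesis .
qed

lemma Refl_1: "Refl m 1 n = edges \<union> diags"
  unfolding Refl_def edges_eq[symmetric] diags_eq[symmetric] using edges_subset[of 1] diags_subset by auto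

lemma Refl_m: "Refl m m n = edges"
proof -
  have "x \<notin> Gcarrier m m n" if x: "x \<in> diags" for x
  proof -
    obtain i c where "x = diag i c" "i < n" "\<not> int m dvd c" using x by (auto simp: diags_def)
    then show ?thesis by (simp add: diag_def elt_of_in_iff)
  qed
  then show ?thesis
    unfolding Refl_def edges_eq[symmetric] diags_eq[symmetric] using edges_subset[of m] by auto
qed

lemma preserves_edge [simp]: "preserves A (edge i j c) \<longleftrightarrow> (i \<in> A \<longleftrightarrow> j \<in> A)"
proof
  assume "preserves A (edge i j c)"
  then have "Transposition.transpose i j i \<in> A \<longleftrightarrow> i \<in> A" unfolding edge_def preserves_elt_of by blast
  then show "i \<in> A \<longleftrightarrow> j \<in> A" by simp
qed (auto simp: edge_def Transposition.transpose_def)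

lemma preserves_diag [simp]: "preserves A (diag i c)"
  unfolding diag_def by simp

lemma preserves_diags: "x \<in> diags \<Longrightarrow> preserves A x"
  by (auto simp: diags_def)

lemma balanced_edge:
  assumes "q dvd int m" "i < n" "j < n" "i \<noteq> j"
  shows "balanced q \<theta> (edge i j c) \<longleftrightarrow> [c = \<theta> j - \<theta> i] (mod q)"
proof -
  have "[- c = \<theta> i - \<theta> j] (mod q) \<longleftrightarrow> [c = \<theta> j - \<theta> i] (mod q)"
    by (metis cong_minus_minus_iff minus_diff_eq minus_minus)
  then show ?thesis
    using assms by (auto simp: edge_def balanced_elt_of Transposition.transpose_def)
qed

lemma balanced_dvd: "balanced q \<theta> x \<Longrightarrow> r dvd q \<Longrightarrow> balanced r \<theta> x"
  unfolding balanced_def by (metis cong_dvd_modulus)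

lemma sum_edge:
  assumes "finite A" "i \<noteq> j" "i \<in> A \<longleftrightarrow> j \<in> A"
  shows "(\<Sum>k\<in>A. if k = i then c else if k = j then - c else (0::int)) = 0"
proof (cases "i \<in> A")
  case True
  with assms have "(\<Sum>k\<in>A. if k = i then c else if k = j then - c else (0::int)) =
      (\<Sum>k\<in>A. if k = i then c else 0) + (\<Sum>k\<in>A. if k = j then - c else 0)"
    by (subst sum.distrib[symmetric]) (auto intro!: sum.cong)
  with True assms show ?thesis by simp
qed (use assms in \<open>auto intro!: sum.neutral\<close>)

lemma colsum_edges:
  assumes "x \<in> edges" "preserves A x" "q dvd int m" "A \<subseteq> V"
  shows "q dvd (\<Sum>k\<in>A. int (snd x k))"
proof -
  have "finite A" using assms finite_subset by blast
  moreover obtain i j c where "x = edge i j c" "i < n" "j < n" "i \<noteq> j" by (rule EdE[OF assms(1)])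
  ultimately show ?thesis
    using assms by (simp only: edge_def colsum_elt_of) (simp add: sum_edge flip: edge_def)
qed

lemma colsum_diag:
  assumes "q dvd int m" "A \<subseteq> V" "i \<in> A"
  shows "q dvd (\<Sum>k\<in>A. int (snd (diag i c) k)) \<longleftrightarrow> q dvd c"
proof -
  have "finite A" using assms finite_subset by blast
  with assms show ?thesis unfolding diag_def by (simp add: colsum_elt_of)
qed

section \<open>Products and conjugates of reflections\<close>

lemma edge_edge_edge:
  assumes "i < n" "j < n" "k < n" "i \<noteq> j" "j \<noteq> k" "i \<noteq> k"
  shows "Gmult m n (edge i j c) (Gmult m n (edge j k d) (edge i j c)) = edge i k (c + d)"
  using assms unfolding edge_def
  by (simp add: Gmult_elt_of transpose_permutes permutes_compose elt_of_eq_iff)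
    (auto simp: Transposition.transpose_def fun_eq_iff algebra_simps)

lemma edge_edge_edge_same:
  assumes "i < n" "j < n" "i \<noteq> j"
  shows "Gmult m n (edge i j a) (Gmult m n (edge i j b) (edge i j c)) = edge i j (a - b + c)"
  using assms unfolding edge_def
  by (simp add: Gmult_elt_of transpose_permutes permutes_compose elt_of_eq_iff)
    (auto simp: Transposition.transpose_def fun_eq_iff algebra_simps)

lemma edge_diag_edge:
  assumes "i < n" "j < n" "i \<noteq> j"
  shows "Gmult m n (edge i j c) (Gmult m n (diag j e) (edge i j c)) = diag i e"
  using assms unfolding edge_def diag_def
  by (simp add: Gmult_elt_of transpose_permutes permutes_compose elt_of_eq_iff)
    (auto simp: Transposition.transpose_def fun_eq_iff)

lemma diag_edge_diag:
  assumes "i < n" "j < n" "i \<noteq> j"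
  shows "Gmult m n (diag j e) (Gmult m n (edge i j c) (diag j (- e))) = edge i j (c + e)"
  using assms unfolding edge_def diag_def
  by (simp add: Gmult_elt_of transpose_permutes permutes_id permutes_compose elt_of_eq_iff)
    (auto simp: Transposition.transpose_def fun_eq_iff algebra_simps)

lemma diag_diag:
  assumes "i < n"
  shows "Gmult m n (diag i c) (diag i d) = diag i (c + d)"
  using assms unfolding diag_def
  by (simp add: Gmult_elt_of permutes_id elt_of_eq_iff)

lemma edge_edge_same:
  assumes "i < n" "j < n" "i \<noteq> j"
  shows "Gmult m n (edge i j 0) (edge i j c) = elt_of id (\<lambda>k. if k = i then c else if k = j then - c else 0)"
  using assms unfolding edge_def
  by (simp add: Gmult_elt_of transpose_permutes elt_of_eq_iff)

text \<open>Connectedness of the graph \<open>T\<close> after contracting the blocks of \<open>P\<close>, as absence of proper cuts.\<close>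

definition connects :: "nat set set \<Rightarrow> elt set \<Rightarrow> bool" where
  "connects P T \<longleftrightarrow> (\<forall>A. A \<subseteq> V \<and> A \<noteq> {} \<and> (\<forall>B\<in>P. B \<subseteq> A \<or> B \<inter> A = {}) \<and> (\<forall>t\<in>T. preserves A t) \<longrightarrow> A = V)"

section \<open>Subgroups that contain a connected set of reflections\<close>

lemma subgroup_mult: "subgroup H (G m p n) \<Longrightarrow> x \<in> H \<Longrightarrow> y \<in> H \<Longrightarrow> Gmult m n x y \<in> H"
  using subgroup.m_closed[of H "G m p n" x y] by simp

lemma subgroup_edge_trans:
  assumes "subgroup H (G m p n)" "i < n" "j < n" "k < n" "i \<noteq> j" "j \<noteq> k" "i \<noteq> k"
    "edge i j c \<in> H" "edge j k d \<in> H"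
  shows "edge i k (c + d) \<in> H"
  using assms edge_edge_edge[of i j k c d] subgroup_mult by metis

text \<open>Conjugating one edge by an adjacent one composes them to an edge along the path. The
  vertices joined to 0 by an edge in \<open>H\<close> therefore form no proper cut, and the gains of
  chosen edges from 0 serve as the potential.\<close>

lemma subgroup_connects_edges:
  assumes H: "subgroup H (G m p n)" and X: "X \<subseteq> H" "X \<subseteq> edges \<union> diags" and connects: "connects {} X"
  obtains \<theta> where "\<And>i j. i < n \<Longrightarrow> j < n \<Longrightarrow> i \<noteq> j \<Longrightarrow> edge i j (\<theta> j - \<theta> i) \<in> H"
proof -
  define K where "K = {j. j < n \<and> (j = 0 \<or> (\<exists>c. edge 0 j c \<in> H))}"
  have step: "j \<in> K" if "i \<in> K" "edge i j c \<in> H" "j < n" "i \<noteq> j" for i j c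
  proof (cases "i = 0 \<or> j = 0")
    case False
    with that(1) obtain d where d: "edge 0 i d \<in> H" "i < n" by (auto simp: K_def)
    have "edge 0 j (d + c) \<in> H"
      by (rule subgroup_edge_trans[OF H _ d(2) that(3) _ _ _ d(1) that(2)]) (use False that in auto)
    with that show ?thesis by (auto simp: K_def)
  qed (use that in \<open>auto simp: K_def\<close>)
  have "preserves K t" if t: "t \<in> X" for t
  proof (cases "t \<in> diags")
    case False
    then obtain i j c where *: "t = edge i j c" "i < n" "j < n" "i \<noteq> j" using t X EdE by blast
    moreover have "edge i j c \<in> H" "edge j i (-c) \<in> H" using * t X edge_sym[of i j c] by auto
    ultimately show ?thesis using step[of i j c] step[of j i "-c"] by auto
  qed (simp add: preserves_diags)
  moreover have "K \<subseteq> V" "0 \<in> K" using n1 by (auto simp: K_def)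
  ultimately have "K = V" using connects[unfolded connects_def, THEN spec[of _ K]] by auto
  have "\<forall>j\<in>{0<..<n}. \<exists>c. edge 0 j c \<in> H"
  proof
    fix j assume j: "j \<in> {0<..<n}"
    then have "j \<in> K" using \<open>K = V\<close> by simp
    then show "\<exists>c. edge 0 j c \<in> H" using j by (simp add: K_def)
  qed
  then obtain f where f: "\<And>j. 0 < j \<Longrightarrow> j < n \<Longrightarrow> edge 0 j (f j) \<in> H"
    by (metis greaterThanLessThan_iff)
  define \<theta> where "\<theta> j = (if j = 0 then 0 else f j)" for j
  have "edge i j (\<theta> j - \<theta> i) \<in> H" if *: "i < n" "j < n" "i \<noteq> j" for i j
  proof -
    have e0: "edge 0 j (\<theta> j) \<in> H" if "j < n" "j \<noteq> 0" for j
      using f that by (simp add: \<theta>_def)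
    have 0: "\<theta> 0 = 0" by (simp add: \<theta>_def)
    consider "i = 0" | "j = 0" | "i \<noteq> 0" "j \<noteq> 0" by blast
    then show ?thesis
    proof cases
      \<comment> \<open>Go through vertex 0: the reversed edge from 0 to \<open>i\<close>, then the
        edge from 0 to \<open>j\<close>.\<close>
      case 3
      then have "edge i 0 (- \<theta> i) \<in> H" using e0[of i] * edge_sym[of 0 i "\<theta> i"] by simp
      from subgroup_edge_trans[OF H _ _ _ _ _ _ this e0[of j]] show ?thesis using 3 * n1 by simp
    qed (use * e0[of i] e0[of j] 0 edge_sym[of 0 i "\<theta> i"] in auto)
  qed
  with that show thesis .
qed

text \<open>Relative to the potential, the gains that occur in \<open>H\<close> between two vertices
  form a subgroup of the integers, the same for all pairs. Its generator \<open>d\<close> divides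
  \<open>m\<close> and makes every member of \<open>X\<close> balanced, so it is 1.\<close>

lemma unbalanced_edges_subset:
  assumes H: "subgroup H (G m p n)" and X: "X \<subseteq> H" "X \<subseteq> edges" and connects: "connects {} X"
    and unbalanced: "\<And>q \<theta>. 1 < q \<Longrightarrow> q dvd int m \<Longrightarrow> \<exists>x\<in>X. \<not> balanced q \<theta> x"
  shows "edges \<subseteq> H"
proof
  fix x0 assume "x0 \<in> edges"
  then obtain x y c0 where xy: "x < n" "y < n" "x \<noteq> y" "x0 = edge x y c0" by (rule EdE)
  obtain \<theta> where \<theta>: "\<And>i j. i < n \<Longrightarrow> j < n \<Longrightarrow> i \<noteq> j \<Longrightarrow> edge i j (\<theta> j - \<theta> i) \<in> H"
    using subgroup_connects_edges[OF H X(1) _ connects] X(2) by blast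
  \<comment> \<open>The excess of a gain over the potential difference; triple products of parallel
    edges keep these sets closed under \<open>a - b + c\<close>.\<close>
  define D where "D i j = {e. edge i j (\<theta> j - \<theta> i + e) \<in> H}" for i j
  have D3: "a - b + c \<in> D i j" if "a \<in> D i j" "b \<in> D i j" "c \<in> D i j" "i < n" "j < n" "i \<noteq> j" for a b c i j
  proof -
    let ?t = "\<theta> j - \<theta> i"
    have "Gmult m n (edge i j (?t + a)) (Gmult m n (edge i j (?t + b)) (edge i j (?t + c))) \<in> H"
      using that unfolding D_def by (intro subgroup_mult[OF H]) auto
    then show ?thesis using that by (simp add: edge_edge_edge_same D_def algebra_simps)
  qed
  have D0: "0 \<in> D i j" if "i < n" "j < n" "i \<noteq> j" for i j
    using \<theta>[OF that] by (simp add: D_def)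
  have Dneg: "- a \<in> D i j" if "a \<in> D i j" "i < n" "j < n" "i \<noteq> j" for a i j
    using D3[OF D0 that(1) D0] that by simp
  have Dsym: "a \<in> D j i" if "a \<in> D i j" "i < n" "j < n" "i \<noteq> j" for a i j
    using Dneg[OF that] edge_sym[OF that(4)] by (simp add: D_def algebra_simps)
  have Dright: "a \<in> D i k" if "a \<in> D i j" "i < n" "j < n" "k < n" "i \<noteq> j" "i \<noteq> k" for a i j k
  proof (cases "j = k")
    case False
    then have "edge i k (\<theta> j - \<theta> i + a + (\<theta> k - \<theta> j)) \<in> H"
      using that \<theta>[of j k] by (intro subgroup_edge_trans[OF H that(2-4)]) (auto simp: D_def)
    then show ?thesis by (simp add: D_def algebra_simps)
  qed (use that in simp)
  have Dmove: "a \<in> D i j" if "a \<in> D i' j'" "i < n" "j < n" "i \<noteq> j" "i' < n" "j' < n" "i' \<noteq> j'"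
    for a i j i' j'
  \<comment> \<open>The endpoints change one at a time through pairs of distinct vertices; the route
    over \<open>i'\<close> and \<open>j\<close> breaks down when these coincide.\<close>
  proof (cases "j = i'")
    case True
    then show ?thesis using that Dsym Dright by metis
  next
    case False
    then show ?thesis using that Dsym Dright by metis
  qed
  have "int m \<in> D x y"
    using \<theta>[OF xy(1-3)] edge_cong[of "\<theta> y - \<theta> x + int m" "\<theta> y - \<theta> x"] by (simp add: D_def cong_def)
  moreover have "a - b \<in> D x y" if "a \<in> D x y" "b \<in> D x y" for a b
    using D3[OF that D0] xy by simp
  ultimately obtain d where d: "0 < d" "d \<in> D x y" "\<And>e. e \<in> D x y \<Longrightarrow> d dvd e"
    using int_subgroup_generator[of "D x y" "int m"] m_pos by blast
  have dm: "d dvd int m" using d \<open>int m \<in> D x y\<close> by blast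
  have "balanced d \<theta> t" if tX: "t \<in> X" for t
  proof -
    obtain i j c where t: "t = edge i j c" "i < n" "j < n" "i \<noteq> j" using tX X EdE by blast
    then have "c - (\<theta> j - \<theta> i) \<in> D i j" using tX X by (auto simp: D_def)
    then have "d dvd c - (\<theta> j - \<theta> i)" using Dmove t xy d by blast
    then show ?thesis using t dm by (simp add: balanced_edge cong_iff_dvd_diff)
  qed
  with unbalanced[of d \<theta>] dm d have "d = 1" by fastforce
  have add: "a + b \<in> D x y" if "a \<in> D x y" "b \<in> D x y" for a b
    using D3[OF that(1) D0 that(2)] xy by simp
  have "int k \<in> D x y" for k
  proof (induction k)
    case (Suc k)
    show ?case using add[OF Suc d(2)] \<open>d = 1\<close> by (simp add: add.commute)
  qed (use D0 xy in simp)
  then have all: "z \<in> D x y" for z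
    using Dneg \<open>\<And>k. int k \<in> D x y\<close> xy by (cases z rule: int_cases2) auto
  show "x0 \<in> H" using all[of "c0 - (\<theta> y - \<theta> x)"] xy by (simp add: D_def)
qed

text \<open>Conjugation by edges moves diagonals between vertices, so one subgroup \<open>D\<close>
  of colors serves all of them. Edges have total color 0 modulo \<open>m\<close>, hence the
  generator of \<open>D\<close> divides all total colors in \<open>X\<close> and is 1. Conjugation
  by diagonals then gives an edge any gain.\<close>

lemma colored_Refl_subset:
  assumes H: "subgroup H (G m 1 n)" and X: "X \<subseteq> H" "X \<subseteq> edges \<union> diags" and connects: "connects {} X"
    and unbalanced: "\<And>q. 1 < q \<Longrightarrow> q dvd int m \<Longrightarrow> \<exists>x\<in>X. \<not> q dvd (\<Sum>k<n. int (snd x k))"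
  shows "edges \<union> diags \<subseteq> H"
proof -
  obtain \<theta> where \<theta>: "\<And>i j. i < n \<Longrightarrow> j < n \<Longrightarrow> i \<noteq> j \<Longrightarrow> edge i j (\<theta> j - \<theta> i) \<in> H"
    using subgroup_connects_edges[OF H X connects] by blast
  define D where "D = {e. diag 0 e \<in> H}"
  have move: "diag i e \<in> H" if "diag j e \<in> H" "i < n" "j < n" for i j e
  proof (cases "i = j")
    case False
    then have "Gmult m n (edge i j (\<theta> j - \<theta> i)) (Gmult m n (diag j e) (edge i j (\<theta> j - \<theta> i))) \<in> H"
      using that \<theta> by (intro subgroup_mult[OF H]) auto
    then show ?thesis using that False by (simp add: edge_diag_edge)
  qed (use that in simp)
  have one: "elt_of id (\<lambda>_. 0) \<in> H" using subgroup.one_closed[OF H] by simp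
  have "int m \<in> D"
  proof -
    have "diag 0 (int m) = elt_of id (\<lambda>_. 0)"
      unfolding diag_def by (rule elt_of_cong) (auto simp: cong_def)
    then show ?thesis using one by (simp add: D_def)
  qed
  have neg: "- b \<in> D" if "b \<in> D" for b
  proof -
    have "m_inv (G m 1 n) (diag 0 b) = elt_of (Hilbert_Choice.inv id) (\<lambda>k. - (if Hilbert_Choice.inv id k = 0 then b else 0))"
      using inv_elt_of[of 1 id "\<lambda>k. if k = 0 then b else 0"] diag_in[of 0 b] n1
      by (simp add: diag_def)
    also have "\<dots> = diag 0 (- b)" unfolding diag_def inv_id by (rule elt_of_cong) simp
    finally show ?thesis using subgroup.m_inv_closed[OF H, of "diag 0 b"] that by (simp add: D_def)
  qed
  have add: "a + b \<in> D" if "a \<in> D" "b \<in> D" for a b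
    using subgroup_mult[OF H, of "diag 0 a" "diag 0 b"] that n1 diag_diag[of 0 a b] by (simp add: D_def)
  obtain d where d: "0 < d" "d \<in> D" "\<And>e. e \<in> D \<Longrightarrow> d dvd e"
    using int_subgroup_generator[of D "int m"] m_pos \<open>int m \<in> D\<close> add neg
    by (metis (no_types, opaque_lifting) diff_conv_add_uminus)
  have dm: "d dvd int m" using d \<open>int m \<in> D\<close> by blast
  have "d dvd (\<Sum>k<n. int (snd t k))" if "t \<in> X" for t
  proof (cases "t \<in> diags")
    case True
    then obtain i c where t: "t = diag i c" "i < n" by (auto simp: diags_def)
    then have "c \<in> D" using move[of i c 0] X that n1 by (auto simp: D_def)
    then show ?thesis using t d colsum_diag[OF dm, of V i c] by auto
  next
    case False
    then have t: "t \<in> edges" using that X by blast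
    then show ?thesis using colsum_edges[OF t _ dm, of V] by (auto elim!: EdE)
  qed
  with unbalanced[of d] dm d have "d = 1" by fastforce
  have "int k \<in> D" for k
  proof (induction k)
    case 0
    show ?case using add[OF d(2) neg[OF d(2)]] by simp
  next
    case (Suc k)
    show ?case using add[OF Suc d(2)] \<open>d = 1\<close> by (simp add: add.commute)
  qed
  then have all: "z \<in> D" for z
    using neg[of "int (nat (- z))"] \<open>\<And>k. int k \<in> D\<close> by (cases z rule: int_cases2) auto
  then have diags: "diag i c \<in> H" if "i < n" for i c
    using move[of 0 c i] n1 that by (auto simp: D_def)
  have "edge i j c \<in> H" if "i < n" "j < n" "i \<noteq> j" for i j c
  proof -
    let ?e = "c - (\<theta> j - \<theta> i)"
    have "Gmult m n (diag j ?e) (Gmult m n (edge i j (\<theta> j - \<theta> i)) (diag j (- ?e))) \<in> H"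
      using that \<theta> diags by (intro subgroup_mult[OF H]) auto
    then have "edge i j (\<theta> j - \<theta> i + ?e) \<in> H" by (simp only: diag_edge_diag[OF that])
    then show ?thesis by simp
  qed
  then show ?thesis using diags by (auto simp: diags_def elim!: EdE)
qed

end

section \<open>Cycles and factorizations into edges\<close>

lemma cycle_of_self [simp]: "x \<in> cycle_of u x"
  unfolding cycle_of_def by (rule CollectI, rule exI[of _ 0]) simp

lemma cycle_of_step: "y \<in> cycle_of u x \<Longrightarrow> u y \<in> cycle_of u x"
  unfolding cycle_of_def by (auto, metis comp_apply funpow.simps(2))

lemma cycle_of_subset:
  assumes "x \<in> S" "\<And>z. z \<in> S \<Longrightarrow> u z \<in> S"
  shows "cycle_of u x \<subseteq> S"
proof -
  have "(u ^^ j) x \<in> S" for j by (induction j) (use assms in auto)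
  then show ?thesis by (auto simp: cycle_of_def)
qed

lemma cycle_of_eq:
  assumes "permutation u" "y \<in> cycle_of u x"
  shows "cycle_of u y = cycle_of u x"
proof -
  have orb: "cycle_of u z = orbit u z" for z
    using orbit_altdef_permutation[OF assms(1), of z] by (simp add: cycle_of_def)
  have "x \<in> orbit u y"
    using assms orbit_swap permutation_self_in_orbit unfolding orb by metis
  then show ?thesis using assms(2) unfolding orb by (auto intro: orbit_trans)
qed

lemma partition_on_cycles:
  assumes "finite A" "u permutes A"
  shows "partition_on A (cycle_of u ` A)"
proof (rule partition_onI)
  have sub: "cycle_of u x \<subseteq> A" if "x \<in> A" for x
    by (rule cycle_of_subset) (use that permutes_in_image[OF assms(2)] in auto)
  then show "\<Union> (cycle_of u ` A) = A" by auto
  show "{} \<notin> cycle_of u ` A" by (metis cycle_of_self empty_iff imageE)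
  have perm: "permutation u" using assms permutation_permutes by blast
  fix p q assume "p \<in> cycle_of u ` A" "q \<in> cycle_of u ` A" "p \<noteq> q"
  then show "disjnt p q" using cycle_of_eq[OF perm] by (auto simp: disjnt_def) blast+
qed

lemma cycle_of_remove_point:
  assumes "inj u" "u x \<noteq> x" "w \<noteq> x"
  shows "cycle_of (Transposition.transpose x (u x) \<circ> u) w = cycle_of u w - {x}"
    (is "cycle_of ?u' w = _")
proof
  have u': "?u' z = (if u z = x then u x else u z)" if "z \<noteq> x" for z
    using that assms(1) by (auto simp: Transposition.transpose_def dest: injD)
  show sub: "cycle_of ?u' w \<subseteq> cycle_of u w - {x}"
  proof (rule cycle_of_subset)
    fix z assume z: "z \<in> cycle_of u w - {x}"
    have "u z \<in> cycle_of u w" "u (u z) \<in> cycle_of u w" using z by (auto intro!: cycle_of_step)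
    then show "?u' z \<in> cycle_of u w - {x}" using u'[of z] z assms by auto
  qed (use assms in simp)
  \<comment> \<open>The point \<open>x\<close> was bypassed just before \<open>u x\<close>, so it
    returns exactly when \<open>u x\<close> lies on the new cycle; with it the set is closed under
    \<open>u\<close>.\<close>
  define S where "S = cycle_of ?u' w \<union> (if u x \<in> cycle_of ?u' w then {x} else {})"
  have "cycle_of u w \<subseteq> S"
  proof (rule cycle_of_subset)
    fix z assume z: "z \<in> S"
    show "u z \<in> S"
    proof (cases "z = x")
      case True
      then show ?thesis using z sub by (auto simp: S_def split: if_splits)
    next
      case False
      then have "z \<in> cycle_of ?u' w" using z by (auto simp: S_def split: if_splits)
      then have "?u' z \<in> cycle_of ?u' w" by (rule cycle_of_step)
      then show ?thesis unfolding u'[OF False] by (auto simp: S_def split: if_splits)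
    qed
  qed (simp add: S_def)
  then show "cycle_of u w - {x} \<subseteq> cycle_of ?u' w" by (auto simp: S_def split: if_splits)
qed

context colored_perms
begin

definition prod_elts :: "elt list \<Rightarrow> elt" where
  "prod_elts fs = foldr (Gmult m n) fs (elt_of id (\<lambda>_. 0))"

lemma prod_elts_simps [simp]: "prod_elts [] = elt_of id (\<lambda>_. 0)" "prod_elts (f # fs) = Gmult m n f (prod_elts fs)"
  by (simp_all add: prod_elts_def)

lemma listprod_G: "listprod (G m p n) fs = prod_elts fs"
  by (simp add: listprod_def prod_elts_def)

lemma prod_elts_in_subgroup:
  assumes "subgroup H (G m p n)" "set fs \<subseteq> H"
  shows "prod_elts fs \<in> H"
  using assms(2)
proof (induction fs)
  case Nil
  then show ?case using subgroup.one_closed[OF assms(1)] by simp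
qed (use subgroup_mult[OF assms(1)] in auto)

lemma elt_of_in_1: "u permutes V \<Longrightarrow> elt_of u b \<in> Gcarrier m 1 n"
  by (simp add: elt_of_in_iff)

lemma Gmult_assoc:
  assumes "x \<in> Gcarrier m 1 n" "y \<in> Gcarrier m 1 n" "z \<in> Gcarrier m 1 n"
  shows "Gmult m n (Gmult m n x y) z = Gmult m n x (Gmult m n y z)"
  using monoid.m_assoc[OF group.is_monoid[OF group_G[of 1]], of x y z] assms by simp

lemma carrier_subgroup: "p dvd m \<Longrightarrow> subgroup (Gcarrier m p n) (G m p n)"
  using group.subgroup_self[OF group_G, of p] by simp

lemma prod_elts_in: "set fs \<subseteq> Gcarrier m 1 n \<Longrightarrow> prod_elts fs \<in> Gcarrier m 1 n"
  using prod_elts_in_subgroup[OF carrier_subgroup[of 1]] by simp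

lemma prod_elts_append:
  assumes "set fs \<subseteq> Gcarrier m 1 n" "set gs \<subseteq> Gcarrier m 1 n"
  shows "prod_elts (fs @ gs) = Gmult m n (prod_elts fs) (prod_elts gs)"
  using assms(1)
proof (induction fs)
  case Nil
  then show ?case
    using monoid.l_one[OF group.is_monoid[OF group_G[of 1]], of "prod_elts gs"] prod_elts_in[OF assms(2)] by simp
next
  case (Cons f fs)
  then show ?case using Gmult_assoc[of f "prod_elts fs" "prod_elts gs"] prod_elts_in[OF assms(2)] prod_elts_in[of fs]
    by simp
qed

text \<open>Multiplying \<open>u\<close> by the transposition of \<open>x\<close> and \<open>u x\<close> makes \<open>x\<close> a fixed point, removes it from
  its cycle, and lets us move its colour to the preceding point of the cycle.\<close>

lemma edge_factorization:
  assumes "finite A" "A \<subseteq> V" "u permutes A"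
  shows "\<exists>fs r d. set fs \<subseteq> edges \<and> length fs + card (cycle_of u ` A) = card A \<and>
     elt_of u b = Gmult m n (prod_elts fs) (elt_of id d) \<and> (\<forall>k. k \<notin> A \<longrightarrow> d k = b k) \<and>
     (\<forall>C\<in>cycle_of u ` A. r C \<in> C \<and> d (r C) = (\<Sum>k\<in>C. b k) \<and> (\<forall>k\<in>C. k \<noteq> r C \<longrightarrow> d k = 0))"
  using assms
proof (induction A arbitrary: u b rule: finite_induct)
  case empty
  then have "u = id" by simp
  have "elt_of id b = Gmult m n (prod_elts []) (elt_of id b)"
    by (simp add: Gmult_elt_of[OF permutes_id, of id])
  with \<open>u = id\<close> show ?case
    by (intro exI[of _ "[]"] exI[of _ b] exI[of _ "\<lambda>_. undefined"]) (auto simp: id_def)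
next
  case (insert x A)
  have AV: "A \<subseteq> V" using insert.prems by simp
  show ?case
  proof (cases "u x = x")
    case True
    have uA: "u permutes A"
      by (rule permutes_superset[OF insert.prems(2)]) (use True in auto)
    obtain fs r d where fs: "set fs \<subseteq> edges" "length fs + card (cycle_of u ` A) = card A"
        "elt_of u b = Gmult m n (prod_elts fs) (elt_of id d)" "\<forall>k. k \<notin> A \<longrightarrow> d k = b k"
        "\<forall>C\<in>cycle_of u ` A. r C \<in> C \<and> d (r C) = (\<Sum>k\<in>C. b k) \<and> (\<forall>k\<in>C. k \<noteq> r C \<longrightarrow> d k = 0)"
      using insert.IH[OF AV uA, of b] by (elim exE conjE) (rule that)
    have cx: "cycle_of u x = {x}" using cycle_of_subset[of x "{x}" u] True by auto
    have nin: "{x} \<notin> cycle_of u ` A"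
      using partition_onD1[OF partition_on_cycles[OF insert.hyps(1) uA]] insert.hyps(2) by blast
    then show ?thesis
      using fs insert.hyps cx
      by (intro exI[of _ fs] exI[of _ "r({x} := x)"] exI[of _ d]) (auto simp: id_def)
  next
    case False
    define y where "y = u x"
    define z where "z = Hilbert_Choice.inv u x"
    define u' where "u' = Transposition.transpose x y \<circ> u"
    define b' where "b' = b(x := 0, z := b z + b x)"
    have inj: "inj u" using insert.prems permutes_inj by blast
    have uz: "u z = x" using permutes_inverses(1)[OF insert.prems(2)] by (simp add: z_def)
    have zx: "z \<noteq> x" using uz False by metis
    have yA: "y \<in> A" using permutes_in_image[OF insert.prems(2), of x] False by (auto simp: y_def)
    have u'A: "u' permutes A" unfolding u'_def y_def by (rule permutes_insert_lemma[OF insert.prems(2)])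
    have perm: "permutation u" using insert.prems insert.hyps permutation_permutes by (metis finite_insert)
    obtain fs r d where fs: "set fs \<subseteq> edges" "length fs + card (cycle_of u' ` A) = card A"
        "elt_of u' b' = Gmult m n (prod_elts fs) (elt_of id d)" "\<forall>k. k \<notin> A \<longrightarrow> d k = b' k"
        "\<forall>C\<in>cycle_of u' ` A. r C \<in> C \<and> d (r C) = (\<Sum>k\<in>C. b' k) \<and> (\<forall>k\<in>C. k \<noteq> r C \<longrightarrow> d k = 0)"
      using insert.IH[OF AV u'A, of b'] by (elim exE conjE) (rule that)
    have cyc': "cycle_of u' w = cycle_of u w - {x}" if "w \<in> A" for w
      using cycle_of_remove_point[OF inj False, of w] that insert.hyps(2) by (auto simp: u'_def y_def)
    have cycx: "cycle_of u x = cycle_of u y"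
      using cycle_of_eq[OF perm, of y x] cycle_of_step[of x u x] by (simp add: y_def)
    then have img: "cycle_of u ` insert x A = cycle_of u ` A" using yA by auto
    have img': "cycle_of u' ` A = (\<lambda>C. C - {x}) ` cycle_of u ` A"
      using cyc' by (auto simp: image_image)
    \<comment> \<open>No cycle is lost: each of them contains a point of \<open>A\<close>, which
      survives the removal of \<open>x\<close>.\<close>
    have "inj_on (\<lambda>C. C - {x}) (cycle_of u ` A)"
    proof (rule inj_onI; clarify)
      fix w w' assume *: "w \<in> A" "w' \<in> A" "cycle_of u w - {x} = cycle_of u w' - {x}"
      then have "w \<in> cycle_of u w'" using insert.hyps(2) cycle_of_self[of w u] by blast
      then show "cycle_of u w = cycle_of u w'" by (rule cycle_of_eq[OF perm])
    qed
    then have cards: "card (cycle_of u' ` A) = card (cycle_of u ` insert x A)"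
      unfolding img img' by (rule card_image)
    have sums: "(\<Sum>k\<in>C - {x}. b' k) = (\<Sum>k\<in>C. b k)" if C: "C \<in> cycle_of u ` insert x A" for C
    proof -
      have zC: "z \<in> C \<longleftrightarrow> x \<in> C"
      proof
        show "z \<in> C \<Longrightarrow> x \<in> C" using C cycle_of_step uz by fastforce
        assume "x \<in> C"
        then have "C = cycle_of u x" using C cycle_of_eq[OF perm] by auto
        moreover have "cycle_of u z = cycle_of u x"
          using cycle_of_eq[OF perm, of x z] cycle_of_step[of z u z] uz by simp
        ultimately show "z \<in> C" by (metis cycle_of_self)
      qed
      have "finite C"
        using partition_onD1[OF partition_on_cycles[OF _ insert.prems(2)]] insert.hyps(1) C
        by (metis Union_upper finite_insert finite_subset)
      show ?thesis
      proof (cases "x \<in> C")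
        case True
        have "(\<Sum>k\<in>C - {x}. b' k) = b' z + (\<Sum>k\<in>C - {x} - {z}. b' k)"
          by (rule sum.remove) (use True zC zx \<open>finite C\<close> in auto)
        also have "(\<Sum>k\<in>C - {x} - {z}. b' k) = (\<Sum>k\<in>C - {x} - {z}. b k)"
          by (rule sum.cong) (auto simp: b'_def)
        also have "b' z + \<dots> = b x + (b z + (\<Sum>k\<in>C - {x} - {z}. b k))" by (simp add: b'_def)
        also have "b z + (\<Sum>k\<in>C - {x} - {z}. b k) = (\<Sum>k\<in>C - {x}. b k)"
          by (rule sum.remove[symmetric]) (use True zC zx \<open>finite C\<close> in auto)
        also have "b x + \<dots> = (\<Sum>k\<in>C. b k)"
          by (rule sum.remove[symmetric]) (use True \<open>finite C\<close> in auto)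
        finally show ?thesis .
      next
        case False
        then show ?thesis using zC by (intro sum.cong) (auto simp: b'_def)
      qed
    qed
    have xy: "x < n" "y < n" "x \<noteq> y" using insert.prems(1) yA False by (auto simp: y_def)
    have u'V: "u' permutes V" using permutes_subset[OF u'A] insert.prems(1) by auto
    have uu': "Transposition.transpose x y \<circ> u' = u" by (simp add: u'_def flip: comp_assoc)
    have "Gmult m n (edge x y (b x)) (elt_of u' b') =
        elt_of u (\<lambda>k. (if u' k = x then b x else if u' k = y then - b x else 0) + b' k)"
      unfolding edge_def Gmult_elt_of[OF u'V] uu' ..
    also have "\<dots> = elt_of u b"
    proof (rule elt_of_cong)
      fix k
      \<comment> \<open>The edge adds \<open>b x\<close> at \<open>x\<close>, the only point that
        \<open>u'\<close> sends to \<open>x\<close>, and \<open>- b x\<close> at \<open>z\<close>,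
        the only point sent to \<open>y\<close>; this undoes the transfer of color in
        \<open>b'\<close>.\<close>
      have "u' k = x \<longleftrightarrow> k = x" "u' k = y \<longleftrightarrow> k = z"
        using xy uz inj by (auto simp: u'_def y_def Transposition.transpose_def dest: injD split: if_splits)
      then show "[(if u' k = x then b x else if u' k = y then - b x else 0) + b' k = b k] (mod int m)"
        using zx by (auto simp: b'_def)
    qed
    finally have e: "elt_of u b = Gmult m n (edge x y (b x)) (elt_of u' b')" ..
    have "prod_elts fs \<in> Gcarrier m 1 n" using prod_elts_in fs(1) edges_subset[of 1] by auto
    then have e': "elt_of u b = Gmult m n (prod_elts (edge x y (b x) # fs)) (elt_of id d)"
      unfolding e fs(3) using xy edge_in[of 1 x y "b x"] elt_of_in_1[of id d]
      by (simp add: Gmult_assoc permutes_id)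
    have dx: "d x = 0" using fs(4) insert.hyps(2) zx by (simp add: b'_def)
    have off: "d k = b k" if "k \<notin> insert x A" for k
    proof -
      have "k \<noteq> z" using that uz permutes_not_in[OF insert.prems(2), of k] by auto
      then show ?thesis using that fs(4) by (simp add: b'_def)
    qed
    have cyc: "r (C - {x}) \<in> C \<and> d (r (C - {x})) = (\<Sum>k\<in>C. b k) \<and> (\<forall>k\<in>C. k \<noteq> r (C - {x}) \<longrightarrow> d k = 0)"
      if C: "C \<in> cycle_of u ` insert x A" for C
    proof -
      have "C \<in> cycle_of u ` A" using C by (simp only: img)
      then have "C - {x} \<in> cycle_of u' ` A" unfolding img' by (rule imageI)
      from bspec[OF fs(5) this]
      have *: "r (C - {x}) \<in> C - {x}" "d (r (C - {x})) = (\<Sum>k\<in>C - {x}. b' k)"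
        "\<forall>k\<in>C - {x}. k \<noteq> r (C - {x}) \<longrightarrow> d k = 0" by simp_all
      then have "d k = 0" if "k \<in> C" "k \<noteq> r (C - {x})" for k
        using that dx by (cases "k = x") auto
      with * sums[OF C] show ?thesis by auto
    qed
    show ?thesis
      by (intro exI[of _ "edge x y (b x) # fs"] exI[of _ "\<lambda>C. r (C - {x})"] exI[of _ d])
        (use fs(1,2) cards e' off cyc xy insert.hyps in \<open>auto simp: EdI id_def\<close>)
  qed
qed

text \<open>After splitting off edges only the colors of the cycles survive, each at one
  representative \<open>r C\<close>; a cycle of color 0 leaves nothing modulo
  \<open>m\<close>.\<close>

lemma cycles_factorization:
  assumes u: "u permutes V"
  obtains fs r d where "set fs \<subseteq> edges" "length fs + card (cycles n u) = n"
    "elt_of u b = Gmult m n (prod_elts fs) (elt_of id d)"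
    "\<And>C. C \<in> cycles n u \<Longrightarrow> r C \<in> C" "\<And>C. C \<in> cycles n u \<Longrightarrow> d (r C) = (\<Sum>k\<in>C. b k)"
    "\<And>k. k < n \<Longrightarrow> k \<notin> r ` cycles n u \<Longrightarrow> d k = 0"
proof -
  obtain fs r d where fs: "set fs \<subseteq> edges" "length fs + card (cycle_of u ` V) = card V"
     "elt_of u b = Gmult m n (prod_elts fs) (elt_of id d)"
     "\<forall>C\<in>cycle_of u ` V. r C \<in> C \<and> d (r C) = (\<Sum>k\<in>C. b k) \<and> (\<forall>k\<in>C. k \<noteq> r C \<longrightarrow> d k = 0)"
    using edge_factorization[OF finite_lessThan subset_refl u, of b] by (elim exE conjE) (rule that)
  show thesis
  proof (rule that)
    fix k assume k: "k < n" "k \<notin> r ` cycles n u"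
    then have "cycle_of u k \<in> cycle_of u ` V" "k \<noteq> r (cycle_of u k)" by (auto simp: cycles_def)
    with fs(4) show "d k = 0" by (metis cycle_of_self)
  qed (use fs in \<open>auto simp: cycles_def\<close>)
qed

lemma partition_cycles: "u permutes V \<Longrightarrow> partition_on V (cycles n u)"
  unfolding cycles_def by (rule partition_on_cycles) auto

lemma preserves_union_of_cycles:
  assumes "preserves A (elt_of u b)" "C \<in> cycles n u"
  shows "C \<subseteq> A \<or> C \<inter> A = {}"
proof -
  obtain x where C: "C = cycle_of u x" using assms by (auto simp: cycles_def)
  have "cycle_of u x \<subseteq> A" if "x \<in> A" by (rule cycle_of_subset) (use that assms in auto)
  moreover have "cycle_of u x \<subseteq> - A" if "x \<notin> A" by (rule cycle_of_subset) (use that assms in auto)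
  ultimately show ?thesis unfolding C by blast
qed

end

section \<open>Merging blocks\<close>

definition merge :: "'a set set \<Rightarrow> 'a set \<Rightarrow> 'a set \<Rightarrow> 'a set set" where
  "merge P B1 B2 = insert (B1 \<union> B2) (P - {B1, B2})"

lemma partition_on_disjoint:
  "partition_on A P \<Longrightarrow> B \<in> P \<Longrightarrow> C \<in> P \<Longrightarrow> x \<in> B \<Longrightarrow> x \<in> C \<Longrightarrow> B = C"
  by (auto simp: partition_on_def dest: pairwiseD disjointD)

lemma partition_on_block:
  assumes "partition_on A P" "x \<in> A"
  obtains B where "B \<in> P" "x \<in> B"
  using assms partition_onD1 by fastforce

text \<open>Merging removes two blocks and inserts one that is really new; cardinalities and
  products over the blocks depend on this.\<close>

lemma merge_notin:
  assumes "partition_on A P" "B1 \<in> P" "B2 \<in> P" "B1 \<noteq> B2"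
  shows "B1 \<union> B2 \<notin> P - {B1, B2}"
proof
  assume *: "B1 \<union> B2 \<in> P - {B1, B2}"
  obtain x where "x \<in> B1" using assms partition_onD3 by (metis ex_in_conv)
  then have "B1 \<union> B2 = B1" using partition_on_disjoint[OF assms(1), of "B1 \<union> B2" B1 x] * assms by auto
  with * show False by auto
qed

lemma partition_on_merge:
  assumes "partition_on A P" "B1 \<in> P" "B2 \<in> P" "B1 \<noteq> B2"
  shows "partition_on A (merge P B1 B2)"
proof (rule partition_onI)
  show "\<Union> (merge P B1 B2) = A" using assms partition_onD1 by (fastforce simp: merge_def)
  show "{} \<notin> merge P B1 B2" using assms partition_onD3 by (fastforce simp: merge_def)
  fix p q assume "p \<in> merge P B1 B2" "q \<in> merge P B1 B2" "p \<noteq> q"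
  then show "disjnt p q"
    using partition_on_disjoint[OF assms(1)] assms(2,3) by (auto simp: merge_def disjnt_iff)
qed

lemma card_merge:
  assumes "partition_on A P" "finite P" "B1 \<in> P" "B2 \<in> P" "B1 \<noteq> B2"
  shows "Suc (card (merge P B1 B2)) = card P"
proof -
  have "card (P - {B1, B2}) = card P - 2" using assms by (subst card_Diff_subset) auto
  moreover have "2 \<le> card P" using card_mono[OF assms(2), of "{B1, B2}"] assms by auto
  ultimately show ?thesis
    using merge_notin[OF assms(1,3-5)] assms(2) by (simp add: merge_def)
qed

context colored_perms
begin

text \<open>Equivalently, \<open>\<theta>' - \<theta>\<close> is constant on each block modulo
  \<open>q\<close>. Values on different blocks are not compared.\<close>

definition same_gain :: "int \<Rightarrow> nat set set \<Rightarrow> (nat \<Rightarrow> int) \<Rightarrow> (nat \<Rightarrow> int) \<Rightarrow> bool" where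
  "same_gain q P \<theta> \<theta>' \<longleftrightarrow> (\<forall>B\<in>P. \<forall>i\<in>B. \<forall>j\<in>B. [\<theta>' j - \<theta>' i = \<theta> j - \<theta> i] (mod q))"

text \<open>The constant added on \<open>B\<close> is the one for which an edge from
  \<open>i\<close> outside \<open>B\<close> to \<open>j\<close> in \<open>B\<close> gets gain
  \<open>c\<close>.\<close>

definition shift :: "nat set \<Rightarrow> nat \<Rightarrow> nat \<Rightarrow> int \<Rightarrow> (nat \<Rightarrow> int) \<Rightarrow> nat \<Rightarrow> int" where
  "shift B i j c \<theta> = (\<lambda>k. if k \<in> B then \<theta> k + (c - \<theta> j + \<theta> i) else \<theta> k)"

lemma finite_partition: "partition_on V P \<Longrightarrow> finite P"
  by (rule finite_elements) auto

text \<open>A merged block records the edge that joined it: to prescribe the gains of the shifted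
  potential on \<open>B1 \<union> B2\<close> is to prescribe those on both blocks and the difference
  across the edge.\<close>

lemma same_gain_shift:
  assumes P: "partition_on V P" and B: "B1 \<in> P" "B2 \<in> P" "B1 \<noteq> B2" "i \<in> B1" "j \<in> B2"
    and q: "q dvd int m"
  shows "same_gain q (merge P B1 B2) (shift B2 i j c \<theta>) \<theta>' \<longleftrightarrow>
    same_gain q P \<theta> \<theta>' \<and> [c = \<theta>' j - \<theta>' i] (mod q)" (is "?L \<longleftrightarrow> ?R")
proof -
  let ?s = "shift B2 i j c \<theta>"
  have out: "?s k = \<theta> k" if "k \<in> B" "B \<in> P" "B \<noteq> B2" for k B
    using partition_on_disjoint[OF P that(2) B(2) that(1)] that by (auto simp: shift_def)
  have ins: "?s k = \<theta> k + (c - \<theta> j + \<theta> i)" if "k \<in> B2" for k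
    using that by (simp add: shift_def)
  have diff: "?s l - ?s k = \<theta> l - \<theta> k" if "k \<in> B" "l \<in> B" "B \<in> P" for k l B
    using out[of k B] out[of l B] ins that by (cases "B = B2") auto
  have ij: "?s j - ?s i = c" using out[OF B(4,1,3)] ins[OF B(5)] by simp
  show ?thesis
  proof
    assume L: ?L
    have "[\<theta>' l - \<theta>' k = \<theta> l - \<theta> k] (mod q)" if "k \<in> B" "l \<in> B" "B \<in> P" for k l B
    proof -
      have "\<exists>B'\<in>merge P B1 B2. k \<in> B' \<and> l \<in> B'"
        using that by (cases "B = B1 \<or> B = B2") (auto simp: merge_def)
      then show ?thesis using L diff[OF that] unfolding same_gain_def by metis
    qed
    moreover have "[\<theta>' j - \<theta>' i = c] (mod q)"
      using L B ij unfolding same_gain_def merge_def by (metis UnI1 UnI2 insertI1)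
    ultimately show ?R by (auto simp: same_gain_def intro: cong_sym)
  next
    assume R: ?R
    have same: "[\<theta>' l - \<theta>' k = ?s l - ?s k] (mod q)" if "k \<in> B" "l \<in> B" "B \<in> P" for k l B
      using R that diff[OF that] by (simp add: same_gain_def)
    have cross: "[\<theta>' l - \<theta>' k = ?s l - ?s k] (mod q)" if "k \<in> B1" "l \<in> B2" for k l
    proof -
      have "[(\<theta>' l - \<theta>' j) + (\<theta>' j - \<theta>' i) + (\<theta>' i - \<theta>' k) =
          (?s l - ?s j) + (?s j - ?s i) + (?s i - ?s k)] (mod q)"
        using same[OF B(5) that(2) B(2)] same[OF that(1) B(4) B(1)] R ij
        by (intro cong_add) (auto intro: cong_sym)
      then show ?thesis by simp
    qed
    have cross': "[\<theta>' l - \<theta>' k = ?s l - ?s k] (mod q)" if "k \<in> B2" "l \<in> B1" for k l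
      using cross[OF that(2,1)] by (metis cong_minus_minus_iff minus_diff_eq)
    show ?L
      unfolding same_gain_def merge_def
    proof (intro ballI)
      fix B k l assume *: "B \<in> insert (B1 \<union> B2) (P - {B1, B2})" "k \<in> B" "l \<in> B"
      show "[\<theta>' l - \<theta>' k = ?s l - ?s k] (mod q)"
      proof (cases "B = B1 \<union> B2")
        case True
        with * have "k \<in> B1 \<or> k \<in> B2" "l \<in> B1 \<or> l \<in> B2" by auto
        then show ?thesis using same[of k _ l] cross[of k l] cross'[of k l] B by metis
      next
        case False
        with * have "B \<in> P" by simp
        then show ?thesis by (rule same[OF *(2,3)])
      qed
    qed
  qed
qed

lemma same_gain_refl: "same_gain q P \<theta> \<theta>"
  by (simp add: same_gain_def)

lemma same_gain_trans: "same_gain q P \<theta> \<theta>' \<Longrightarrow> same_gain q P \<theta>' \<theta>'' \<Longrightarrow> same_gain q P \<theta> \<theta>''"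
  unfolding same_gain_def by (metis cong_trans)

lemma same_gain_dvd: "same_gain q P \<theta> \<theta>' \<Longrightarrow> r dvd q \<Longrightarrow> same_gain r P \<theta> \<theta>'"
  unfolding same_gain_def by (metis cong_dvd_modulus)

text \<open>A reflection inside the blocks respects every cut that splits no block.\<close>

lemma connects_insert_preserves:
  assumes "\<And>B. B \<in> P \<Longrightarrow> preserves B t" "partition_on V P" "t \<in> edges \<union> diags"
  shows "connects P (insert t T) \<longleftrightarrow> connects P T"
proof -
  have "preserves A t" if A: "A \<subseteq> V" "\<forall>B\<in>P. B \<subseteq> A \<or> B \<inter> A = {}" for A
  proof (cases "t \<in> diags")
    case False
    then obtain i j c where t: "t = edge i j c" "i < n" "j < n" "i \<noteq> j" using assms(3) EdE by blast
    obtain B where B: "B \<in> P" "i \<in> B" using partition_on_block[OF assms(2)] t by blast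
    then have "j \<in> B" using assms(1) t by auto
    then show ?thesis using A B t by auto
  qed (simp add: preserves_diags)
  then show ?thesis by (auto simp: connects_def)
qed

lemma connects_insert_merge:
  assumes P: "partition_on V P" and B: "B1 \<in> P" "B2 \<in> P" "B1 \<noteq> B2" "i \<in> B1" "j \<in> B2"
  shows "connects P (insert (edge i j c) T) \<longleftrightarrow> connects (merge P B1 B2) T"
proof -
  have key: "(\<forall>B\<in>P. B \<subseteq> A \<or> B \<inter> A = {}) \<and> (i \<in> A \<longleftrightarrow> j \<in> A) \<longleftrightarrow>
      (\<forall>B\<in>merge P B1 B2. B \<subseteq> A \<or> B \<inter> A = {})" for A
  proof -
    define sep where "sep B \<longleftrightarrow> B \<subseteq> A \<or> B \<inter> A = {}" for B
    have "(\<forall>B\<in>P. sep B) \<longleftrightarrow> sep B1 \<and> sep B2 \<and> (\<forall>B\<in>P - {B1, B2}. sep B)" using B by blast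
    moreover have "sep B1 \<and> sep B2 \<and> (i \<in> A \<longleftrightarrow> j \<in> A) \<longleftrightarrow> sep (B1 \<union> B2)"
      using B(4,5) unfolding sep_def by blast
    ultimately show ?thesis by (auto simp: merge_def simp flip: sep_def)
  qed
  have "(\<forall>t\<in>insert (edge i j c) T. preserves A t) \<longleftrightarrow> (i \<in> A \<longleftrightarrow> j \<in> A) \<and> (\<forall>t\<in>T. preserves A t)" for A
    by simp
  then show ?thesis unfolding connects_def by (simp only: key[symmetric] conj_assoc)
qed

text \<open>Inserting the edges one by one joins at most one pair of blocks per edge; as long as every
  edge joins two blocks, the potential can be adjusted to balance all of them.\<close>

lemma components:
  assumes "finite T" "T \<subseteq> edges" "partition_on V P"
  shows "\<exists>Q. partition_on V Q \<and> (\<forall>t\<in>T. \<forall>B\<in>Q. preserves B t) \<and> (\<forall>B\<in>P. \<exists>B'\<in>Q. B \<subseteq> B') \<and>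
     card P \<le> card Q + card T \<and>
     (card P = card Q + card T \<longrightarrow> (\<exists>\<theta>'. same_gain (int m) P \<theta> \<theta>' \<and> (\<forall>t\<in>T. balanced (int m) \<theta>' t)))"
  using assms
proof (induction T arbitrary: P \<theta> rule: finite_induct)
  case empty
  then show ?case by (intro exI[of _ P]) (auto intro: same_gain_refl)
next
  case (insert t T)
  have TE: "T \<subseteq> edges" using insert.prems by simp
  obtain i j c where t: "t = edge i j c" "i < n" "j < n" "i \<noteq> j" using insert.prems EdE by blast
  obtain B1 where B1: "B1 \<in> P" "i \<in> B1" using partition_on_block[OF insert.prems(2)] t by blast
  obtain B2 where B2: "B2 \<in> P" "j \<in> B2" using partition_on_block[OF insert.prems(2)] t by blast
  show ?case
  proof (cases "B1 = B2")
    case True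
    \<comment> \<open>The edge lies inside a block, so the inequality becomes strict and the clause
      about equality is vacuous.\<close>
    obtain Q where Q: "partition_on V Q" "\<forall>t\<in>T. \<forall>B\<in>Q. preserves B t" "\<forall>B\<in>P. \<exists>B'\<in>Q. B \<subseteq> B'"
        "card P \<le> card Q + card T"
      using insert.IH[OF TE insert.prems(2), of \<theta>] by (elim exE conjE) (rule that)
    obtain B' where B': "B' \<in> Q" "B1 \<subseteq> B'" using Q(3) B1 by blast
    have "preserves B t" if "B \<in> Q" for B
      using partition_on_disjoint[OF Q(1) that B'(1)] B' B1 B2 True t by auto
    then show ?thesis using Q insert.hyps by (intro exI[of _ Q]) auto
  next
    case False
    let ?P = "merge P B1 B2" and ?\<theta> = "shift B2 i j c \<theta>"
    have P': "partition_on V ?P" by (rule partition_on_merge) (use insert.prems B1 B2 False in auto)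
    have c: "Suc (card ?P) = card P"
      by (rule card_merge) (use insert.prems finite_partition B1 B2 False in auto)
    obtain Q where Q: "partition_on V Q" "\<forall>t\<in>T. \<forall>B\<in>Q. preserves B t" "\<forall>B\<in>?P. \<exists>B'\<in>Q. B \<subseteq> B'"
        "card ?P \<le> card Q + card T"
        "card ?P = card Q + card T \<longrightarrow> (\<exists>\<theta>'. same_gain (int m) ?P ?\<theta> \<theta>' \<and> (\<forall>t\<in>T. balanced (int m) \<theta>' t))"
      using insert.IH[OF TE P', of ?\<theta>] by (elim exE conjE) (rule that)
    obtain B' where B': "B' \<in> Q" "B1 \<union> B2 \<subseteq> B'" using Q(3) by (auto simp: merge_def)
    have "preserves B t" if "B \<in> Q" for B
      using partition_on_disjoint[OF Q(1) that B'(1), of i]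
        partition_on_disjoint[OF Q(1) that B'(1), of j] B' B1 B2 t by auto
    moreover have "\<forall>B\<in>P. \<exists>B'\<in>Q. B \<subseteq> B'"
    proof
      fix B assume "B \<in> P"
      show "\<exists>B'\<in>Q. B \<subseteq> B'"
      proof (cases "B = B1 \<or> B = B2")
        case False
        then have "B \<in> ?P" using \<open>B \<in> P\<close> by (auto simp: merge_def)
        then show ?thesis using Q(3) by blast
      qed (use B' in auto)
    qed
    moreover have "\<exists>\<theta>'. same_gain (int m) P \<theta> \<theta>' \<and> (\<forall>t\<in>insert t T. balanced (int m) \<theta>' t)"
      if "card P = card Q + card (insert t T)"
    proof -
      have "card ?P = card Q + card T" using that c insert.hyps by simp
      then obtain \<theta>' where \<theta>': "same_gain (int m) ?P ?\<theta> \<theta>'" "\<forall>t\<in>T. balanced (int m) \<theta>' t" using Q(5) by blast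
      have "same_gain (int m) P \<theta> \<theta>' \<and> [c = \<theta>' j - \<theta>' i] (mod int m)"
        using same_gain_shift[OF insert.prems(2) B1(1) B2(1) False B1(2) B2(2)] \<theta>'(1) by simp
      then show ?thesis using \<theta>'(2) t by (intro exI[of _ \<theta>']) (simp add: balanced_edge)
    qed
    ultimately show ?thesis using Q c insert.hyps by (intro exI[of _ Q]) auto
  qed
qed

text \<open>A block of the partition \<open>Q\<close> from \<open>components\<close> is preserved by
  \<open>T\<close> and splits no block of \<open>P\<close>; connectedness leaves only
  \<open>Q = {V}\<close>.\<close>

lemma connects_card_le:
  assumes "finite T" "T \<subseteq> edges" "partition_on V P" "connects P T"
  shows "card P \<le> Suc (card T)"
    and "card P = Suc (card T) \<Longrightarrow> \<exists>\<theta>'. same_gain (int m) P \<theta> \<theta>' \<and> (\<forall>t\<in>T. balanced (int m) \<theta>' t)"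
proof -
  obtain Q where Q: "partition_on V Q" "\<forall>t\<in>T. \<forall>B\<in>Q. preserves B t" "\<forall>B\<in>P. \<exists>B'\<in>Q. B \<subseteq> B'"
      "card P \<le> card Q + card T"
      "card P = card Q + card T \<longrightarrow> (\<exists>\<theta>'. same_gain (int m) P \<theta> \<theta>' \<and> (\<forall>t\<in>T. balanced (int m) \<theta>' t))"
    using components[OF assms(1-3), of \<theta>] by (elim exE conjE) (rule that)
  have "B = V" if B: "B \<in> Q" for B
  proof -
    have "C \<subseteq> B \<or> C \<inter> B = {}" if C: "C \<in> P" for C
    proof -
      obtain C' where C': "C' \<in> Q" "C \<subseteq> C'" using Q(3) C by auto
      have "C \<subseteq> B" if "x \<in> C" "x \<in> B" for x
        using partition_on_disjoint[OF Q(1) B C'(1) that(2)] C'(2) that(1) by auto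
      then show ?thesis by auto
    qed
    moreover have "B \<subseteq> V" "B \<noteq> {}"
      using partition_onD1[OF Q(1)] partition_onD3[OF Q(1)] B by auto
    ultimately show ?thesis using assms(4)[unfolded connects_def, THEN spec[of _ B]] Q(2) B by simp
  qed
  moreover have "0 \<in> \<Union>Q" using partition_onD1[OF Q(1)] n1 by (metis lessThan_iff less_le_trans zero_less_one)
  then have "Q \<noteq> {}" by auto
  ultimately have "Q = {V}" by blast
  then show "card P \<le> Suc (card T)"
    "card P = Suc (card T) \<Longrightarrow> \<exists>\<theta>'. same_gain (int m) P \<theta> \<theta>' \<and> (\<forall>t\<in>T. balanced (int m) \<theta>' t)"
    using Q(4,5) by auto
qed

text \<open>The blocks of \<open>P\<close> stand for connected graphs whose gains are differences of \<open>\<theta>\<close>; \<open>unbalanced P \<theta> T\<close>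
  says that adding the edges \<open>T\<close> makes them into a graph that is connected and, modulo every
  divisor \<open>q > 1\<close> of \<open>m\<close>, has a cycle with nonzero gain.\<close>

definition unbalanced :: "nat set set \<Rightarrow> (nat \<Rightarrow> int) \<Rightarrow> elt set \<Rightarrow> bool" where
  "unbalanced P \<theta> T \<longleftrightarrow> connects P T \<and>
     (\<forall>q \<theta>'. 1 < q \<longrightarrow> q dvd int m \<longrightarrow> same_gain q P \<theta> \<theta>' \<longrightarrow> (\<exists>t\<in>T. \<not> balanced q \<theta>' t))"

text \<open>With one edge fewer, \<open>T\<close> would be a spanning tree on the blocks, and a tree
  can be balanced modulo \<open>m\<close> itself.\<close>

lemma unbalanced_card_le:
  assumes "finite T" "T \<subseteq> edges" "partition_on V P" "unbalanced P \<theta> T"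
  shows "card P \<le> card T"
proof (rule ccontr)
  assume "\<not> card P \<le> card T"
  then have "card P = Suc (card T)" using connects_card_le(1)[of T P] assms by (simp add: unbalanced_def)
  then obtain \<theta>' where "same_gain (int m) P \<theta> \<theta>'" "\<forall>t\<in>T. balanced (int m) \<theta>' t"
    using connects_card_le(2)[where \<theta> = \<theta>, of T P] assms by (auto simp: unbalanced_def)
  moreover have "1 < int m" using m2 by simp
  ultimately have "\<exists>t\<in>T. \<not> balanced (int m) \<theta>' t"
    using assms(4)[unfolded unbalanced_def, THEN conjunct2, rule_format, of "int m" \<theta>'] by simp
  with \<open>\<forall>t\<in>T. balanced (int m) \<theta>' t\<close> show False by simp
qed

lemma unbalanced_insert_merge:
  assumes P: "partition_on V P" and B: "B1 \<in> P" "B2 \<in> P" "B1 \<noteq> B2" "i \<in> B1" "j \<in> B2" and ij: "i < n" "j < n"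
  shows "unbalanced P \<theta> (insert (edge i j c) T) \<longleftrightarrow> unbalanced (merge P B1 B2) (shift B2 i j c \<theta>) T"
proof -
  have "i \<noteq> j" using partition_on_disjoint[OF P B(1,2,4)] B by auto
  then show ?thesis
    unfolding unbalanced_def connects_insert_merge[OF P B] using same_gain_shift[OF P B] ij
    by (auto simp: balanced_edge)
qed

text \<open>\<open>T\<close> has the size of a spanning tree; once it connects the blocks, some
  potential balances it modulo \<open>m\<close>, and the new edge deviates from that potential by
  exactly \<open>e\<close>. So the divisors of \<open>m\<close> modulo which everything can be
  balanced are the common divisors of \<open>e\<close> and \<open>m\<close>.\<close>

lemma unbalanced_insert_same:
  assumes P: "partition_on V P" and B: "B \<in> P" "i \<in> B" "j \<in> B" "i \<noteq> j" and ij: "i < n" "j < n"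
    and T: "finite T" "T \<subseteq> edges" "card P = Suc (card T)"
  shows "unbalanced P \<theta> (insert (edge i j (\<theta> j - \<theta> i + e)) T) \<longleftrightarrow> coprime e (int m) \<and> connects P T" (is "?L \<longleftrightarrow> ?R")
proof -
  let ?t = "edge i j (\<theta> j - \<theta> i + e)"
  have connects: "connects P (insert ?t T) \<longleftrightarrow> connects P T"
  proof (rule connects_insert_preserves[OF _ P])
    show "preserves C ?t" if "C \<in> P" for C
      using partition_on_disjoint[OF P that B(1)] B by auto
  qed (use EdI ij B in auto)
  have balanced: "balanced q \<theta>' ?t \<longleftrightarrow> q dvd e" if "same_gain q P \<theta> \<theta>'" "q dvd int m" for q \<theta>'
  proof -
    have *: "[\<theta>' j - \<theta>' i = \<theta> j - \<theta> i] (mod q)" using that B by (auto simp: same_gain_def)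
    have "balanced q \<theta>' ?t \<longleftrightarrow> [\<theta> j - \<theta> i + e = \<theta>' j - \<theta>' i] (mod q)"
      using that ij B by (simp add: balanced_edge)
    also have "\<dots> \<longleftrightarrow> [\<theta> j - \<theta> i + e = \<theta> j - \<theta> i] (mod q)"
      using * cong_trans cong_sym by metis
    also have "\<dots> \<longleftrightarrow> q dvd e" by (simp add: cong_iff_dvd_diff)
    finally show ?thesis .
  qed
  show ?thesis
  proof
    assume L: ?L
    then have cT: "connects P T" using connects by (simp add: unbalanced_def)
    obtain \<theta>' where \<theta>': "same_gain (int m) P \<theta> \<theta>'" "\<forall>t\<in>T. balanced (int m) \<theta>' t"
      using connects_card_le(2)[OF T(1,2) P cT T(3)] by blast
    have "gcd e (int m) = 1"
    proof (rule ccontr)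
      assume "gcd e (int m) \<noteq> 1"
      moreover have "0 < gcd e (int m)" using m_pos by simp
      ultimately have g: "1 < gcd e (int m)" by linarith
      have c': "same_gain (gcd e (int m)) P \<theta> \<theta>'" using same_gain_dvd[OF \<theta>'(1)] by simp
      then obtain t where "t \<in> insert ?t T" "\<not> balanced (gcd e (int m)) \<theta>' t"
        using L g unfolding unbalanced_def by (meson gcd_dvd2)
      then show False using balanced[OF c'] balanced_dvd[of "int m" \<theta>' t] \<theta>'(2) by auto
    qed
    with cT show ?R by (simp add: coprime_iff_gcd_eq_1)
  next
    assume R: ?R
    show ?L unfolding unbalanced_def
    proof (intro conjI allI impI)
      fix q \<theta>' assume q: "1 < q" "q dvd int m" "same_gain q P \<theta> \<theta>'"
      have "\<not> q dvd e"
        using R q(1,2) by (metis coprime_common_divisor zdvd1_eq abs_of_pos less_irrefl not_less_iff_gr_or_eq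
            order_less_trans zero_less_one)
      then show "\<exists>t\<in>insert ?t T. \<not> balanced q \<theta>' t" using balanced[OF q(3,2)] by blast
    qed (use R connects in auto)
  qed
qed

end

section \<open>Elementary symmetric polynomials under merging\<close>

text \<open>The generating polynomial of the elementary symmetric polynomials in the
  \<open>x i\<close>.\<close>

definition epoly :: "('a \<Rightarrow> real) \<Rightarrow> 'a set \<Rightarrow> real poly" where
  "epoly x I = (\<Prod>i\<in>I. [:1, x i:])"

lemma epoly_remove: "finite I \<Longrightarrow> i \<in> I \<Longrightarrow> epoly x I = [:1, x i:] * epoly x (I - {i})"
  unfolding epoly_def by (rule prod.remove)

lemma coeff_epoly:
  assumes "finite I"
  shows "coeff (epoly x I) j = (\<Sum>S | S \<subseteq> I \<and> card S = j. \<Prod>i\<in>S. x i)"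
  using assms
proof (induction I arbitrary: j rule: finite_induct)
  case empty
  have *: "{S. S \<subseteq> {} \<and> card S = j} = (if j = 0 then {{}} else {})" by auto
  show ?case unfolding * by (simp add: epoly_def)
next
  case (insert a I)
  have step: "epoly x (insert a I) = epoly x I + smult (x a) (pCons 0 (epoly x I))"
    using insert.hyps by (simp add: epoly_def)
  show ?case
  proof (cases j)
    case 0
    have *: "{S. S \<subseteq> J \<and> card S = 0} = {{}}" if "finite J" for J :: "'a set"
      using that finite_subset card_0_eq by fastforce
    have "coeff (epoly x (insert a I)) 0 = coeff (epoly x I) 0" by (simp add: step)
    then show ?thesis using insert.IH[of 0] insert.hyps * 0 by simp
  next
    case (Suc i)
    let ?F = "\<lambda>J j. {S. S \<subseteq> J \<and> card S = j}"
    have fin: "finite (?F I j)" for j using insert.hyps by simp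
    have split: "?F (insert a I) (Suc i) = ?F I (Suc i) \<union> insert a ` ?F I i"
    proof (intro equalityI subsetI)
      fix S assume S: "S \<in> ?F (insert a I) (Suc i)"
      then have "finite S" using insert.hyps finite_subset by fastforce
      show "S \<in> ?F I (Suc i) \<union> insert a ` ?F I i"
      proof (cases "a \<in> S")
        case True
        then have "S - {a} \<in> ?F I i" "S = insert a (S - {a})" using S \<open>finite S\<close> by auto
        then show ?thesis by blast
      qed (use S in auto)
    next
      fix S assume S: "S \<in> ?F I (Suc i) \<union> insert a ` ?F I i"
      then show "S \<in> ?F (insert a I) (Suc i)"
      proof
        assume "S \<in> insert a ` ?F I i"
        then obtain S' where S': "S = insert a S'" "S' \<subseteq> I" "card S' = i" by auto
        then have "finite S'" "a \<notin> S'" using insert.hyps finite_subset by auto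
        with S' show ?thesis by auto
      qed auto
    qed
    have "inj_on (insert a) (?F I i)"
      using insert.hyps(2) by (intro inj_onI) (metis (mono_tags, lifting) Diff_insert_absorb mem_Collect_eq subset_iff)
    then have "(\<Sum>S\<in>insert a ` ?F I i. \<Prod>i\<in>S. x i) = (\<Sum>S\<in>?F I i. \<Prod>i\<in>insert a S. x i)"
      by (simp add: sum.reindex)
    also have "\<dots> = (\<Sum>S\<in>?F I i. x a * (\<Prod>i\<in>S. x i))"
    proof (rule sum.cong)
      fix S assume "S \<in> ?F I i"
      then have "finite S" "a \<notin> S" using insert.hyps finite_subset by auto
      then show "(\<Prod>i\<in>insert a S. x i) = x a * (\<Prod>i\<in>S. x i)" by simp
    qed simp
    finally have "(\<Sum>S\<in>?F (insert a I) (Suc i). \<Prod>i\<in>S. x i) =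
        coeff (epoly x I) (Suc i) + x a * coeff (epoly x I) i"
      unfolding split insert.IH using fin insert.hyps
      by (subst sum.union_disjoint) (auto simp: sum_distrib_left)
    then show ?thesis using Suc by (simp add: step)
  qed
qed

lemma sum_pairs_left:
  fixes x :: "'a \<Rightarrow> real"
  assumes "finite I"
  shows "(\<Sum>i\<in>I. \<Sum>j\<in>I - {i}. x i * c) = (real (card I) - 1) * sum x I * c"
proof -
  have "(\<Sum>j\<in>I - {i}. x i * c) = (real (card I) - 1) * x i * c" if "i \<in> I" for i
  proof -
    have "0 < card I" using that assms card_gt_0_iff by blast
    then show ?thesis using that by (simp add: card_Diff_singleton of_nat_diff)
  qed
  then have "(\<Sum>i\<in>I. \<Sum>j\<in>I - {i}. x i * c) = (\<Sum>i\<in>I. (real (card I) - 1) * x i * c)"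
    by (rule sum.cong[OF refl])
  then show ?thesis by (simp add: sum_distrib_left sum_distrib_right)
qed

lemma sum_pairs_swap:
  fixes f :: "'a \<Rightarrow> 'a \<Rightarrow> 'b::comm_monoid_add"
  assumes "finite I"
  shows "(\<Sum>i\<in>I. \<Sum>j\<in>I - {i}. f i j) = (\<Sum>i\<in>I. \<Sum>j\<in>I - {i}. f j i)"
proof -
  have inner: "(\<Sum>j\<in>I - {i}. f i j) = (\<Sum>j\<in>I. if i = j then 0 else f i j)" for i and f :: "'a \<Rightarrow> 'a \<Rightarrow> 'b"
    by (rule sum.mono_neutral_cong_left) (use assms in auto)
  have "(\<Sum>i\<in>I. \<Sum>j\<in>I - {i}. f i j) = (\<Sum>j\<in>I. \<Sum>i\<in>I. if i = j then 0 else f i j)"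
    unfolding inner[where f = f] by (rule sum.swap)
  also have "\<dots> = (\<Sum>i\<in>I. \<Sum>j\<in>I - {i}. f j i)"
    unfolding inner[where f = "\<lambda>i j. f j i"] by (intro sum.cong refl) (simp add: eq_commute)
  finally show ?thesis .
qed

lemma pderiv_sum: "pderiv (sum f I) = (\<Sum>i\<in>I. pderiv (f i))"
  by (induction I rule: infinite_finite_induct) (simp_all add: pderiv_add)

lemma smult_sum_right: "smult c (sum f I) = (\<Sum>i\<in>I. smult c (f i))"
  by (induction I rule: infinite_finite_induct) (simp_all add: smult_add_right)

text \<open>Joining \<open>i\<close> and \<open>j\<close> replaces \<open>(1 + x\<^sub>i t) (1 + x\<^sub>j t)\<close> by \<open>1 + (x\<^sub>i + x\<^sub>j) t\<close>, i.e. subtracts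
  \<open>x\<^sub>i x\<^sub>j t\<^sup>2\<close> times the product over the remaining indices. The resulting double sums are
  derivatives: with \<open>E = epoly x I\<close> and \<open>Z = \<Sum>\<^sub>i x\<^sub>i\<^sup>2 E\<^sub>i\<close>, where \<open>E\<^sub>i\<close> omits \<open>i\<close>, we have
  \<open>t Z = N E - E'\<close>.\<close>

lemma sum_coeff_epoly_merge:
  fixes x :: "'a \<Rightarrow> real"
  assumes "finite I" and N: "N = sum x I"
  defines "M \<equiv> \<lambda>i j. [:1, x i + x j:] * epoly x (I - {i, j})"
  shows "(\<Sum>i\<in>I. \<Sum>j\<in>I - {i}. (x i + x j) * coeff (M i j) (l + 2)) =
    2 * ((real (card I) - real (l + 2)) * N * coeff (epoly x I) (l + 2)
      + real (l + 1) * real (l + 3) * coeff (epoly x I) (l + 3))"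
proof -
  let ?E = "epoly x I"
  define Z where "Z = (\<Sum>i\<in>I. smult ((x i)\<^sup>2) (epoly x (I - {i})))"
  have dE: "pderiv (epoly x J) = (\<Sum>i\<in>J. smult (x i) (epoly x (J - {i})))" for J
    unfolding epoly_def by (subst pderiv_prod) (simp add: pderiv_pCons)
  have rem: "smult (x i) (pCons 0 (epoly x (I - {i}))) = ?E - epoly x (I - {i})" if "i \<in> I" for i
    using epoly_remove[OF assms(1) that, of x] by (simp add: algebra_simps)
  have "pCons 0 Z = (\<Sum>i\<in>I. smult (x i) (smult (x i) (pCons 0 (epoly x (I - {i})))))"
  proof -
    have "pCons 0 Z = [:0, 1:] * Z" by simp
    also have "\<dots> = (\<Sum>i\<in>I. smult (x i) (smult (x i) (pCons 0 (epoly x (I - {i})))))"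
      unfolding Z_def sum_distrib_left by (intro sum.cong) (simp_all add: power2_eq_square)
    finally show ?thesis .
  qed
  also have "\<dots> = (\<Sum>i\<in>I. smult (x i) ?E - smult (x i) (epoly x (I - {i})))"
    using rem by (simp add: smult_diff_right)
  also have "\<dots> = smult N ?E - pderiv ?E"
    unfolding dE N by (simp add: sum_subtractf smult_sum)
  finally have tZ: "coeff Z j = N * coeff ?E (Suc j) - real (j + 2) * coeff ?E (j + 2)" for j
    by (metis (no_types, lifting) coeff_pCons_Suc coeff_diff coeff_smult coeff_pderiv add_2_eq_Suc' )
  \<comment> \<open>Differentiating \<open>epoly x (I - {i})\<close> takes out a second index; the
    derivative of \<open>Z\<close> becomes the double sum that merging subtracts, weighted by
    \<open>x i\<close>.\<close>
  have dZ: "pderiv Z = (\<Sum>i\<in>I. \<Sum>j\<in>I - {i}. smult ((x i)\<^sup>2 * x j) (epoly x (I - {i, j})))"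
  proof -
    have "pderiv Z = (\<Sum>i\<in>I. smult ((x i)\<^sup>2) (pderiv (epoly x (I - {i}))))"
      by (simp add: Z_def pderiv_sum pderiv_smult)
    also have "\<dots> = (\<Sum>i\<in>I. \<Sum>j\<in>I - {i}. smult ((x i)\<^sup>2 * x j) (epoly x (I - {i, j})))"
      unfolding dE by (simp add: smult_sum_right insert_commute flip: Diff_insert)
    finally show ?thesis .
  qed
  have M: "coeff (M i j) (l + 2) = coeff ?E (l + 2) - x i * x j * coeff (epoly x (I - {i, j})) l"
    if "i \<in> I" "j \<in> I - {i}" for i j
  proof -
    have "?E = [:1, x i:] * ([:1, x j:] * epoly x (I - {i, j}))"
      using epoly_remove[OF assms(1) that(1), of x] epoly_remove[of "I - {i}" j x] that assms(1)
      by (simp add: Diff_insert2[symmetric] insert_commute flip: Diff_insert)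
    then have "?E = M i j + smult (x i * x j) (pCons 0 (pCons 0 (epoly x (I - {i, j}))))"
      by (simp add: M_def algebra_simps smult_add_left smult_add_right)
    then show ?thesis by simp
  qed
  have "(\<Sum>i\<in>I. \<Sum>j\<in>I - {i}. (x i + x j) * coeff (M i j) (l + 2)) =
      (\<Sum>i\<in>I. \<Sum>j\<in>I - {i}. x i * coeff (M i j) (l + 2)) + (\<Sum>i\<in>I. \<Sum>j\<in>I - {i}. x j * coeff (M i j) (l + 2))"
    by (simp add: sum.distrib distrib_right)
  \<comment> \<open>\<open>M\<close> is symmetric in \<open>i\<close> and \<open>j\<close>, so both
    halves of the weight contribute equally; this is the factor 2 of the claim.\<close>
  also have "(\<Sum>i\<in>I. \<Sum>j\<in>I - {i}. x j * coeff (M i j) (l + 2)) = (\<Sum>i\<in>I. \<Sum>j\<in>I - {i}. x i * coeff (M i j) (l + 2))"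
    by (subst sum_pairs_swap[OF assms(1)]) (simp add: M_def add.commute insert_commute)
  also have "(\<Sum>i\<in>I. \<Sum>j\<in>I - {i}. x i * coeff (M i j) (l + 2)) =
      (\<Sum>i\<in>I. \<Sum>j\<in>I - {i}. x i * coeff ?E (l + 2) - (x i)\<^sup>2 * x j * coeff (epoly x (I - {i, j})) l)"
    by (intro sum.cong refl) (subst M; simp add: power2_eq_square algebra_simps)
  also have "\<dots> = (real (card I) - 1) * N * coeff ?E (l + 2) - coeff (pderiv Z) l"
    unfolding dZ sum_subtractf sum_pairs_left[OF assms(1)] by (simp add: coeff_sum N)
  also have "coeff (pderiv Z) l = real (l + 1) * (N * coeff ?E (l + 2) - real (l + 3) * coeff ?E (l + 3))"
    by (simp add: coeff_pderiv tZ numeral_3_eq_3)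
  finally show ?thesis by (simp add: algebra_simps)
qed

text \<open>The parenthesis of (iii) as a function of the polynomial that carries the
  \<open>e_j\<close>, so that it can be evaluated at merged families as well.\<close>

definition bracket :: "nat \<Rightarrow> real \<Rightarrow> real poly \<Rightarrow> real" where
  "bracket k N E = N ^ k - N ^ (k - 1) - (\<Sum>j=2..k. fact (j - 2) * N ^ (k - j) * coeff E j)"

text \<open>Newton's identity for the second power sum. The parts share one induction, since each
  uses the next.\<close>

lemma sum_power2_epoly:
  assumes "finite I"
  shows "(\<Sum>i\<in>I. (x i)\<^sup>2) = (sum x I)\<^sup>2 - 2 * coeff (epoly x I) 2"
    and "coeff (epoly x I) 1 = sum x I" and "coeff (epoly x I) 0 = 1"
  using assms
proof (induction I rule: finite_induct)
  case (insert a I)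
  have step: "epoly x (insert a I) = epoly x I + smult (x a) (pCons 0 (epoly x I))"
    using insert.hyps by (simp add: epoly_def)
  { case 1 show ?case using insert by (simp add: step numeral_2_eq_2 power2_eq_square algebra_simps) }
  { case 2 show ?case using insert by (simp add: step) }
  { case 3 show ?case using insert by (simp add: step) }
qed (simp_all add: epoly_def)

text \<open>This is the edge-marking recurrence for unicyclic sets without the common factors.
  Merging turns the term with \<open>e_(l+2)\<close> into terms with \<open>e_(l+2)\<close> and
  \<open>e_(l+3)\<close>, whose weights add up to \<open>k\<close> after a shift of index. The only
  remainder, a multiple of \<open>e_2\<close>, cancels against the sum of squares that comes from
  the edges inside blocks.\<close>

lemma bracket_recurrence:
  fixes x :: "'a \<Rightarrow> real"
  assumes I: "finite I" "I \<noteq> {}" and N: "N = sum x I" "N \<noteq> 0"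
  shows "real (card I) * N * bracket (card I) N (epoly x I) =
    N * (\<Sum>i\<in>I. \<Sum>j\<in>I - {i}. (x i + x j) / 2 *
       bracket (card I - 1) N ([:1, x i + x j:] * epoly x (I - {i, j})))
    + N ^ (card I - 1) * ((\<Sum>i\<in>I. (x i)\<^sup>2) - N)"
proof -
  define k where "k = card I"
  have k: "1 \<le> k" using I by (simp add: k_def Suc_leI card_gt_0_iff)
  show ?thesis
  proof (cases "k = 1")
    case True
    then obtain i where "I = {i}" by (auto simp: k_def card_1_singleton_iff)
    then show ?thesis using N by (simp add: bracket_def power2_eq_square algebra_simps)
  next
    case False
    with k obtain p where p: "k = p + 2" by (metis One_nat_def add_2_eq_Suc' le_antisym le_SucE nat_le_iff_add not_less_eq_eq Suc_le_D)
    define e where "e j = coeff (epoly x I) j" for j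
    define M where "M i j = [:1, x i + x j:] * epoly x (I - {i, j})" for i j
    \<comment> \<open>The summands of \<open>bracket\<close>, indexed from 0 by
      \<open>l = j - 2\<close>.\<close>
    define a where "a l = fact l * N ^ (p - l) * e (l + 2)" for l
    have br: "bracket (q + 1) N E = N ^ (q + 1) - N ^ q - (\<Sum>l<q. fact l * N ^ (q - 1 - l) * coeff E (l + 2))" for q E
    proof -
      have "(\<Sum>j=2..q + 1. fact (j - 2) * N ^ (q + 1 - j) * coeff E j) =
          (\<Sum>l<q. fact l * N ^ (q - 1 - l) * coeff E (l + 2))"
        by (rule sum.reindex_bij_witness[of _ "\<lambda>l. l + 2" "\<lambda>j. j - 2"]) (auto dest!: le_Suc_ex)
      then show ?thesis by (simp add: bracket_def)
    qed
    have lin: "(\<Sum>i\<in>I. \<Sum>j\<in>I - {i}. (x i + x j) / 2) = real (p + 1) * N"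
    proof -
      have "(\<Sum>i\<in>I. \<Sum>j\<in>I - {i}. x j / 2) = (\<Sum>i\<in>I. \<Sum>j\<in>I - {i}. x i / 2)"
        by (rule sum_pairs_swap[OF I(1)])
      then have "(\<Sum>i\<in>I. \<Sum>j\<in>I - {i}. (x i + x j) / 2) = (\<Sum>i\<in>I. \<Sum>j\<in>I - {i}. x i * (1 / 2)) * 2"
        by (simp add: add_divide_distrib sum.distrib)
      then show ?thesis unfolding sum_pairs_left[OF I(1)] using p N by (simp flip: k_def)
    qed
    have "(\<Sum>i\<in>I. \<Sum>j\<in>I - {i}. (x i + x j) / 2 * bracket (p + 1) N (M i j)) =
        (\<Sum>i\<in>I. \<Sum>j\<in>I - {i}. (x i + x j) / 2) * (N ^ (p + 1) - N ^ p) -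
        (\<Sum>i\<in>I. \<Sum>j\<in>I - {i}. \<Sum>l<p. fact l * N ^ (p - 1 - l) / 2 * ((x i + x j) * coeff (M i j) (l + 2)))"
      unfolding br by (simp add: right_diff_distrib sum_subtractf sum_distrib_left sum_distrib_right ac_simps)
    also have "(\<Sum>i\<in>I. \<Sum>j\<in>I - {i}. \<Sum>l<p. fact l * N ^ (p - 1 - l) / 2 * ((x i + x j) * coeff (M i j) (l + 2))) =
        (\<Sum>i\<in>I. \<Sum>l<p. \<Sum>j\<in>I - {i}. fact l * N ^ (p - 1 - l) / 2 * ((x i + x j) * coeff (M i j) (l + 2)))"
      by (intro sum.cong refl sum.swap)
    also have "\<dots> = (\<Sum>l<p. \<Sum>i\<in>I. \<Sum>j\<in>I - {i}. fact l * N ^ (p - 1 - l) / 2 * ((x i + x j) * coeff (M i j) (l + 2)))"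
      by (rule sum.swap)
    also have "\<dots> = (\<Sum>l<p. fact l * N ^ (p - 1 - l) / 2 *
        (\<Sum>i\<in>I. \<Sum>j\<in>I - {i}. (x i + x j) * coeff (M i j) (l + 2)))"
      by (simp add: sum_distrib_left)
    also have "\<dots> = (\<Sum>l<p. real (p - l) * a l + real (l + 3) * a (l + 1))"
    proof (intro sum.cong refl)
      fix l assume "l \<in> {..<p}"
      then obtain r where r: "p = l + r + 1" by (metis add.assoc add.commute lessThan_iff less_iff_Suc_add plus_1_eq_Suc)
      \<comment> \<open>\<open>card I - (l + 2)\<close> is \<open>p - l\<close>, and the factor
        \<open>l + 1\<close> extends \<open>fact l\<close> to \<open>fact (l + 1)\<close>, as
        \<open>a (l + 1)\<close> demands.\<close>
      show "fact l * N ^ (p - 1 - l) / 2 * (\<Sum>i\<in>I. \<Sum>j\<in>I - {i}. (x i + x j) * coeff (M i j) (l + 2)) =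
          real (p - l) * a l + real (l + 3) * a (l + 1)"
        unfolding M_def sum_coeff_epoly_merge[OF I(1) N(1)] k_def[symmetric] p e_def[symmetric] a_def r
        by (simp add: algebra_simps numeral_3_eq_3)
    qed
    also have "\<dots> = real k * (\<Sum>l<p + 1. a l) - 2 * a 0"
    proof -
      \<comment> \<open>Shifted by one, the second weight is \<open>l + 2\<close>, which complements
        \<open>p - l\<close> to \<open>k\<close>; the term at 0 has to be taken off.\<close>
      have "(\<Sum>l<p. real (l + 3) * a (l + 1)) = (\<Sum>l<p + 1. real (l + 2) * a l) - 2 * a 0"
        using sum.lessThan_Suc_shift[of "\<lambda>l. real (l + 2) * a l" p] by (simp add: algebra_simps)
      moreover have "(\<Sum>l<p. real (p - l) * a l) = (\<Sum>l<p + 1. real (p - l) * a l)" by simp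
      moreover have "(\<Sum>l<p + 1. real (p - l) * a l) + (\<Sum>l<p + 1. real (l + 2) * a l) = real k * (\<Sum>l<p + 1. a l)"
        unfolding sum.distrib[symmetric] sum_distrib_left p
        by (intro sum.cong) (auto simp: of_nat_diff algebra_simps)
      ultimately show ?thesis by (simp add: sum.distrib)
    qed
    finally have main: "(\<Sum>i\<in>I. \<Sum>j\<in>I - {i}. (x i + x j) / 2 * bracket (p + 1) N (M i j)) =
        real (p + 1) * N * (N ^ (p + 1) - N ^ p) - real k * (\<Sum>l<p + 1. a l) + 2 * a 0"
      unfolding lin by simp
    have B: "bracket k N (epoly x I) = N ^ (p + 2) - N ^ (p + 1) - (\<Sum>l<p + 1. a l)"
      using br[of "p + 1" "epoly x I"] by (simp add: p a_def e_def)
    have sq: "(\<Sum>i\<in>I. (x i)\<^sup>2) = N\<^sup>2 - 2 * e 2" using sum_power2_epoly(1)[OF I(1)] N by (simp add: e_def)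
    have a0: "a 0 = N ^ p * e 2" by (simp add: a_def numeral_2_eq_2)
    have k1: "k - 1 = p + 1" using p by simp
    have alg: "real k * N * (N ^ (p + 2) - N ^ (p + 1) - s) =
        N * (real (p + 1) * N * (N ^ (p + 1) - N ^ p) - real k * s + 2 * (N ^ p * e 2)) +
        N ^ (p + 1) * (N\<^sup>2 - 2 * e 2 - N)" for s
      unfolding p by (simp add: algebra_simps power2_eq_square)
    show ?thesis
      unfolding k_def[symmetric] k1 M_def[symmetric] main B sq a0 by (rule alg)
  qed
qed

section \<open>Counting by marking an edge\<close>

text \<open>Double counting of the pairs of a member \<open>T\<close> and an element
  \<open>t\<close> of it.\<close>

lemma card_times_card_family:
  assumes "finite R" "\<And>T. T \<in> K \<Longrightarrow> T \<subseteq> R \<and> card T = k"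
  shows "real k * real (card K) = (\<Sum>t\<in>R. real (card {T \<in> K. t \<in> T}))"
proof -
  have K: "finite K" by (rule finite_subset[of _ "Pow R"]) (use assms in auto)
  have "k * card K = (\<Sum>T\<in>K. card {t \<in> R. t \<in> T})"
  proof -
    have "card {t \<in> R. t \<in> T} = k" if "T \<in> K" for T
    proof -
      have "{t \<in> R. t \<in> T} = T" using assms(2)[OF that] by auto
      then show ?thesis using assms(2)[OF that] by simp
    qed
    then show ?thesis by simp
  qed
  also have "\<dots> = (\<Sum>T\<in>K. \<Sum>t\<in>R. if t \<in> T then 1 else 0)"
    using assms(1) by (simp add: sum.If_cases Int_def)
  also have "\<dots> = (\<Sum>t\<in>R. \<Sum>T\<in>K. if t \<in> T then 1 else 0)" by (rule sum.swap)
  also have "\<dots> = (\<Sum>t\<in>R. card {T \<in> K. t \<in> T})"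
    using K by (simp add: sum.If_cases Int_def)
  finally have "real (k * card K) = real (\<Sum>t\<in>R. card {T \<in> K. t \<in> T})" by simp
  then show ?thesis by (simp only: of_nat_mult of_nat_sum)
qed

lemma card_members_containing: "card {T \<in> K. t \<in> T} = card {T. t \<notin> T \<and> insert t T \<in> K}"
proof (rule bij_betw_same_card[of "\<lambda>T. T - {t}"])
  show "bij_betw (\<lambda>T. T - {t}) {T \<in> K. t \<in> T} {T. t \<notin> T \<and> insert t T \<in> K}"
    by (rule bij_betwI[where g = "insert t"]) (auto simp: insert_absorb)
qed

lemma sum_partition:
  fixes g :: "'a \<Rightarrow> 'b::comm_monoid_add"
  assumes "finite A" "partition_on A P"
  shows "sum g A = (\<Sum>B\<in>P. sum g B)"
proof -
  have "sum g (\<Union>P) = (\<Sum>B\<in>P. sum g B)"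
    using assms partition_on_disjoint[OF assms(2)]
    by (subst sum.Union_disjoint) (auto simp: partition_on_def intro: finite_subset[OF Union_upper])
  then show ?thesis using partition_onD1[OF assms(2)] by simp
qed

lemma sum_partition_pairs:
  fixes g :: "'a \<Rightarrow> 'a \<Rightarrow> 'b::comm_monoid_add"
  assumes A: "finite A" and P: "partition_on A P"
  shows "(\<Sum>i\<in>A. \<Sum>j\<in>A - {i}. g i j) =
    (\<Sum>B\<in>P. \<Sum>i\<in>B. \<Sum>j\<in>B - {i}. g i j) + (\<Sum>B\<in>P. \<Sum>B'\<in>P - {B}. \<Sum>i\<in>B. \<Sum>j\<in>B'. g i j)"
proof -
  have sub: "B \<subseteq> A" if "B \<in> P" for B using partition_onD1[OF P] that by auto
  have fin: "finite P" using A P by (rule finite_elements)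
  have split: "(\<Sum>j\<in>A - {i}. g i j) = (\<Sum>j\<in>B - {i}. g i j) + (\<Sum>B'\<in>P - {B}. \<Sum>j\<in>B'. g i j)"
    if B: "B \<in> P" "i \<in> B" for B i
  proof -
    have "partition_on (A - B) (P - {B})"
      using partition_on_insert[of B "P - {B}" A] P B partition_on_disjoint[OF P]
      by (auto simp: insert_absorb disjnt_iff)
    moreover have "A - {i} = (B - {i}) \<union> (A - B)" using B sub by auto
    moreover have "finite B" using sub[OF B(1)] A finite_subset by blast
    ultimately show ?thesis
      using A sum_partition[of "A - B" "P - {B}" "g i"] sum.union_disjoint[of "B - {i}" "A - B" "g i"] by auto
  qed
  have "(\<Sum>i\<in>A. \<Sum>j\<in>A - {i}. g i j) = (\<Sum>B\<in>P. \<Sum>i\<in>B. \<Sum>j\<in>A - {i}. g i j)"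
    by (rule sum_partition[OF A P])
  also have "\<dots> = (\<Sum>B\<in>P. \<Sum>i\<in>B. (\<Sum>j\<in>B - {i}. g i j) + (\<Sum>B'\<in>P - {B}. \<Sum>j\<in>B'. g i j))"
    by (intro sum.cong refl split)
  also have "\<dots> = (\<Sum>B\<in>P. \<Sum>i\<in>B. \<Sum>j\<in>B - {i}. g i j) + (\<Sum>B\<in>P. \<Sum>i\<in>B. \<Sum>B'\<in>P - {B}. \<Sum>j\<in>B'. g i j)"
    by (simp add: sum.distrib)
  also have "(\<Sum>B\<in>P. \<Sum>i\<in>B. \<Sum>B'\<in>P - {B}. \<Sum>j\<in>B'. g i j) = (\<Sum>B\<in>P. \<Sum>B'\<in>P - {B}. \<Sum>i\<in>B. \<Sum>j\<in>B'. g i j)"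
    by (intro sum.cong refl sum.swap)
  finally show ?thesis .
qed

lemma prod_merge:
  fixes f :: "'a set \<Rightarrow> 'b::comm_monoid_mult"
  assumes "partition_on A P" "finite P" "B1 \<in> P" "B2 \<in> P" "B1 \<noteq> B2"
  shows "prod f (merge P B1 B2) = f (B1 \<union> B2) * prod f (P - {B1, B2})"
  unfolding merge_def using merge_notin[OF assms(1,3-5)] assms(2) by (subst prod.insert) auto

lemma prod_remove2:
  fixes f :: "'a \<Rightarrow> 'b::comm_monoid_mult"
  assumes "finite P" "B1 \<in> P" "B2 \<in> P" "B1 \<noteq> B2"
  shows "prod f P = f B1 * f B2 * prod f (P - {B1, B2})"
proof -
  have "prod f P = f B1 * (f B2 * prod f (P - {B1} - {B2}))"
    using assms by (subst prod.remove[of P B1], simp, simp, subst prod.remove[of "P - {B1}" B2]) auto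
  moreover have "P - {B1} - {B2} = P - {B1, B2}" by auto
  ultimately show ?thesis by (simp add: mult.assoc)
qed

context colored_perms
begin

lemma finite_edges: "finite edges"
  using edges_subset[of 1] finite_Gcarrier finite_subset by auto

text \<open>An injective map on residues permutes them, so a sum over all gains may be shifted or
  negated.\<close>

lemma sum_residues:
  fixes h :: "int \<Rightarrow> 'b::comm_monoid_add"
  assumes h: "\<And>a b. [a = b] (mod int m) \<Longrightarrow> h a = h b"
    and inj: "\<And>c d. c < m \<Longrightarrow> d < m \<Longrightarrow> [\<phi> c = \<phi> d] (mod int m) \<Longrightarrow> c = d"
  shows "(\<Sum>c<m. h (\<phi> c)) = (\<Sum>c<m. h (int c))"
proof -
  let ?g = "\<lambda>c. nat (\<phi> c mod int m)"
  have g: "int (?g c) = \<phi> c mod int m" for c using m_pos by simp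
  have "inj_on ?g {..<m}"
  proof (rule inj_onI)
    fix c d assume *: "c \<in> {..<m}" "d \<in> {..<m}" "?g c = ?g d"
    then have "int (?g c) = int (?g d)" by simp
    then show "c = d" using inj[of c d] * unfolding g by (simp add: cong_def)
  qed
  moreover have "?g ` {..<m} \<subseteq> {..<m}" using m_pos by (auto simp: nat_less_iff)
  ultimately have bij: "bij_betw ?g {..<m} {..<m}"
    by (simp add: bij_betw_def endo_inj_surj)
  have "(\<Sum>c<m. h (\<phi> c)) = (\<Sum>c<m. h (int (?g c)))"
    unfolding g by (intro sum.cong refl h) (simp add: cong_def)
  also have "\<dots> = (\<Sum>c<m. h (int c))"
    by (rule sum.reindex_bij_betw[OF bij, of "\<lambda>c. h (int c)"])
  finally show ?thesis .
qed

lemma nat_cong_less: "c < m \<Longrightarrow> d < m \<Longrightarrow> [int c = int d] (mod int m) \<Longrightarrow> c = d"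
  by (simp add: cong_def)

text \<open>Each edge arises from both its orientations, hence the factor 2. The offset
  \<open>s\<close> is free because all gains are summed; for unicyclic sets it will be the potential
  difference.\<close>

lemma sum_edges:
  fixes f :: "elt \<Rightarrow> real"
  shows "2 * (\<Sum>t\<in>edges. f t) = (\<Sum>i<n. \<Sum>j\<in>V - {i}. \<Sum>c<m. f (edge i j (s i j + int c)))"
proof -
  define g where "g i j = (\<Sum>c<m. f (edge i j (int c)))" for i j
  have per: "f (edge i j a) = f (edge i j b)" if "[a = b] (mod int m)" for i j a b
    using edge_cong[OF that] by simp
  have gs: "(\<Sum>c<m. f (edge i j (s i j + int c))) = g i j" for i j
    unfolding g_def by (rule sum_residues) (auto intro: per nat_cong_less simp: cong_add_lcancel)
  have sym: "g j i = g i j" if "i \<noteq> j" for i j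
  proof -
    have "g j i = (\<Sum>c<m. f (edge i j (- int c)))" unfolding g_def using edge_sym[of j i] that by simp
    also have "\<dots> = g i j" unfolding g_def
      by (rule sum_residues) (auto intro: per nat_cong_less simp: cong_minus_minus_iff)
    finally show ?thesis .
  qed
  define L where "L = {(i, j). i < j \<and> j < n}"
  have finL: "finite L" by (rule finite_subset[of _ "V \<times> V"]) (auto simp: L_def)
  have edge_inj: "i = i' \<and> j = j' \<and> c = c'"
    if *: "edge i j (int c) = edge i' j' (int c')" "i < j" "i' < j'" "j < n" "j' < n" "c < m" "c' < m" for i j c i' j' c'
  proof -
    have tr: "Transposition.transpose i j = Transposition.transpose i' j'"
      using *(1) by (auto simp: edge_def elt_of_eq_iff)
    have "Transposition.transpose i' j' i = j" "Transposition.transpose i' j' j = i" unfolding tr[symmetric] by auto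
    then have ij: "i = i'" "j = j'" using *(2,3) by (auto simp: Transposition.transpose_def split: if_splits)
    then have "[int c = int c'] (mod int m)"
      using *(1,2,4) by (auto simp: edge_def elt_of_eq_iff dest: spec[of _ i])
    then show ?thesis using ij nat_cong_less * by auto
  qed
  have "bij_betw (\<lambda>((i, j), c). edge i j (int c)) (L \<times> {..<m}) edges"
  proof (rule bij_betw_imageI)
    show "inj_on (\<lambda>((i, j), c). edge i j (int c)) (L \<times> {..<m})"
      by (rule inj_onI) (auto simp: L_def dest: edge_inj)
    show "(\<lambda>((i, j), c). edge i j (int c)) ` (L \<times> {..<m}) = edges"
    proof (intro equalityI subsetI)
      fix x assume "x \<in> edges"
      then obtain i j c where x: "x = edge i j c" "i < n" "j < n" "i \<noteq> j" by (rule EdE)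
      have "\<exists>i j c. x = edge i j c \<and> i < j \<and> j < n"
        using x edge_sym[of i j c] by (cases "i < j") (metis, metis linorder_neqE_nat)
      then obtain i j c where x: "x = edge i j c" "i < j" "j < n" by blast
      obtain c' where c': "c' < m" "[int c' = c] (mod int m)" by (rule residue)
      then have "x = edge i j (int c')" using x by (auto intro: edge_cong cong_sym)
      then show "x \<in> (\<lambda>((i, j), c). edge i j (int c)) ` (L \<times> {..<m})"
        using x c' by (intro image_eqI[of _ _ "((i, j), c')"]) (auto simp: L_def)
    qed (auto simp: L_def intro!: EdI)
  qed
  then have "(\<Sum>t\<in>edges. f t) = (\<Sum>x\<in>L \<times> {..<m}. f ((\<lambda>((i, j), c). edge i j (int c)) x))"
    by (rule sum.reindex_bij_betw[symmetric])
  also have "\<dots> = (\<Sum>x\<in>L. \<Sum>c<m. f ((\<lambda>((i, j), c). edge i j (int c)) (x, c)))"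
    by (subst sum.cartesian_product) (simp add: split_beta)
  also have "\<dots> = (\<Sum>x\<in>L. g (fst x) (snd x))" unfolding g_def by (intro sum.cong refl) (simp add: split_beta)
  finally have 1: "(\<Sum>t\<in>edges. f t) = (\<Sum>x\<in>L. g (fst x) (snd x))" .
  have "(\<Sum>x\<in>prod.swap ` L. g (fst x) (snd x)) = (\<Sum>x\<in>L. g (snd x) (fst x))"
    by (subst sum.reindex) auto
  also have "\<dots> = (\<Sum>x\<in>L. g (fst x) (snd x))"
    by (rule sum.cong) (auto simp: L_def intro!: sym)
  finally have 2: "(\<Sum>x\<in>prod.swap ` L. g (fst x) (snd x)) = (\<Sum>x\<in>L. g (fst x) (snd x))" .
  have "(SIGMA i:V. V - {i}) = L \<union> prod.swap ` L"
    by (auto simp: L_def image_iff)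
  then have "(\<Sum>i<n. \<Sum>j\<in>V - {i}. g i j) = (\<Sum>x\<in>L \<union> prod.swap ` L. g (fst x) (snd x))"
    by (subst sum.Sigma) (auto simp: split_beta)
  also have "\<dots> = 2 * (\<Sum>x\<in>L. g (fst x) (snd x))"
    using 2 finL by (subst sum.union_disjoint) (auto simp: L_def)
  finally show ?thesis unfolding gs 1 by simp
qed

text \<open>The two kinds of edges in the marking argument: inside a block the contribution depends
  only on the gain relative to \<open>s\<close>, and between two given blocks it is
  constant.\<close>

lemma sum_edges_blocks:
  fixes f :: "elt \<Rightarrow> real"
  assumes P: "partition_on V P"
    and cross: "\<And>B B' i j c. B \<in> P \<Longrightarrow> B' \<in> P \<Longrightarrow> B \<noteq> B' \<Longrightarrow> i \<in> B \<Longrightarrow> j \<in> B' \<Longrightarrow> f (edge i j c) = F B B'"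
    and same: "\<And>B i j c. B \<in> P \<Longrightarrow> i \<in> B \<Longrightarrow> j \<in> B \<Longrightarrow> i \<noteq> j \<Longrightarrow> f (edge i j (s i j + int c)) = h c"
  shows "2 * (\<Sum>t\<in>edges. f t) =
    (\<Sum>B\<in>P. real (card B) * (real (card B) - 1)) * (\<Sum>c<m. h c) +
    (\<Sum>B\<in>P. \<Sum>B'\<in>P - {B}. real (card B) * real (card B') * real m * F B B')"
proof -
  have finB: "finite B" if "B \<in> P" for B
    using partition_onD1[OF P] that by (metis Union_upper finite_lessThan finite_subset)
  have "(\<Sum>B\<in>P. \<Sum>i\<in>B. \<Sum>j\<in>B - {i}. \<Sum>c<m. f (edge i j (s i j + int c))) =
      (\<Sum>B\<in>P. real (card B) * (real (card B) - 1) * (\<Sum>c<m. h c))"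
  proof (rule sum.cong[OF refl])
    fix B assume B: "B \<in> P"
    have "(\<Sum>i\<in>B. \<Sum>j\<in>B - {i}. \<Sum>c<m. f (edge i j (s i j + int c))) = (\<Sum>i\<in>B. \<Sum>j\<in>B - {i}. \<Sum>c<m. h c)"
      by (intro sum.cong refl same[OF B]) auto
    also have "\<dots> = (\<Sum>i\<in>B. (real (card B) - 1) * (\<Sum>c<m. h c))"
    proof (rule sum.cong[OF refl])
      fix i assume i: "i \<in> B"
      then have "0 < card B" using finB[OF B] card_gt_0_iff by blast
      then show "(\<Sum>j\<in>B - {i}. \<Sum>c<m. h c) = (real (card B) - 1) * (\<Sum>c<m. h c)"
        using i by (simp add: card_Diff_singleton of_nat_diff)
    qed
    finally show "(\<Sum>i\<in>B. \<Sum>j\<in>B - {i}. \<Sum>c<m. f (edge i j (s i j + int c))) =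
        real (card B) * (real (card B) - 1) * (\<Sum>c<m. h c)" by simp
  qed
  moreover have "(\<Sum>B\<in>P. \<Sum>B'\<in>P - {B}. \<Sum>i\<in>B. \<Sum>j\<in>B'. \<Sum>c<m. f (edge i j (s i j + int c))) =
      (\<Sum>B\<in>P. \<Sum>B'\<in>P - {B}. \<Sum>i\<in>B. \<Sum>j\<in>B'. \<Sum>c<m. F B B')"
    by (intro sum.cong refl cross) auto
  ultimately show ?thesis
    unfolding sum_edges[of f s] sum_partition_pairs[OF finite_lessThan P]
    by (simp add: sum_distrib_right mult.assoc)
qed

section \<open>Spanning trees and unicyclic graphs on the blocks\<close>

definition spanning_trees :: "nat set set \<Rightarrow> elt set set" where
  "spanning_trees P = {T. T \<subseteq> edges \<and> Suc (card T) = card P \<and> connects P T}"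

definition unicyclic_sets :: "nat set set \<Rightarrow> (nat \<Rightarrow> int) \<Rightarrow> elt set set" where
  "unicyclic_sets P \<theta> = {T. T \<subseteq> edges \<and> card T = card P \<and> unbalanced P \<theta> T}"

lemma finite_edges_subset: "T \<subseteq> edges \<Longrightarrow> finite T"
  using finite_edges finite_subset by blast

lemma connects_remove_preserves:
  assumes P: "partition_on V P" and T: "T \<subseteq> edges" "connects P T" "t \<in> T" "\<And>B. B \<in> P \<Longrightarrow> preserves B t"
  shows "card P \<le> card T"
proof -
  have "connects P (T - {t})"
    using connects_insert_preserves[OF T(4) P, of "T - {t}"] T by (auto simp: insert_absorb)
  moreover have "T - {t} \<subseteq> edges" using T(1) by auto
  ultimately have "card P \<le> Suc (card (T - {t}))"
    using connects_card_le(1)[OF finite_edges_subset _ P, of "T - {t}"] by simp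
  then show ?thesis using T finite_edges_subset[OF T(1)] by (metis card_Suc_Diff1)
qed

text \<open>An edge inside a block adds nothing to connectedness, and a tree has no edge to
  spare.\<close>

lemma spanning_trees_avoid_preserves:
  assumes "partition_on V P" "T \<in> spanning_trees P" "\<And>B. B \<in> P \<Longrightarrow> preserves B t"
  shows "t \<notin> T"
proof
  assume "t \<in> T"
  moreover have "T \<subseteq> edges" "connects P T" "Suc (card T) = card P" using assms(2) by (simp_all add: spanning_trees_def)
  ultimately show False using connects_remove_preserves[OF assms(1) _ _ _ assms(3), of T] by simp
qed

lemma partition_nonempty: "partition_on V P \<Longrightarrow> P \<noteq> {}"
  using partition_onD1[of V P] n1 by (auto simp: lessThan_empty_iff)

lemma preserves_block_edge:
  assumes P: "partition_on V P" and B: "B \<in> P" "i \<in> B" "j \<in> B" "C \<in> P"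
  shows "preserves C (edge i j c)"
  using partition_on_disjoint[OF P B(1,4), of i] partition_on_disjoint[OF P B(1,4), of j] B by auto

lemma card_spanning_trees_containing_same:
  assumes P: "partition_on V P" and B: "B \<in> P" "i \<in> B" "j \<in> B"
  shows "card {T \<in> spanning_trees P. edge i j c \<in> T} = 0"
proof -
  have "{T \<in> spanning_trees P. edge i j c \<in> T} = {}"
    using spanning_trees_avoid_preserves[OF P _ preserves_block_edge[OF P B]] by blast
  then show ?thesis by (simp only: card.empty)
qed

lemma block_less: "partition_on V P \<Longrightarrow> B \<in> P \<Longrightarrow> i \<in> B \<Longrightarrow> i < n"
  using partition_onD1 by fastforce

lemma merge_preserves_edge:
  assumes P: "partition_on V P" and B: "B1 \<in> P" "B2 \<in> P" "B1 \<noteq> B2" "i \<in> B1" "j \<in> B2" and C: "C \<in> merge P B1 B2"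
  shows "preserves C (edge i j c)"
  by (rule preserves_block_edge[OF partition_on_merge[OF P B(1-3)] _ _ _ C, of "B1 \<union> B2"])
    (use B in \<open>auto simp: merge_def\<close>)

lemma card_spanning_trees_containing_merge:
  assumes P: "partition_on V P" and B: "B1 \<in> P" "B2 \<in> P" "B1 \<noteq> B2" "i \<in> B1" "j \<in> B2"
  shows "card {T \<in> spanning_trees P. edge i j c \<in> T} = card (spanning_trees (merge P B1 B2))"
proof -
  let ?t = "edge i j c" and ?P = "merge P B1 B2"
  have P': "partition_on V ?P" by (rule partition_on_merge[OF P B(1-3)])
  have c: "Suc (card ?P) = card P" by (rule card_merge[OF P finite_partition[OF P] B(1-3)])
  have ij: "i < n" "j < n" "i \<noteq> j"
    using block_less[OF P] B partition_on_disjoint[OF P B(1,2,4)] by auto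
  have "insert ?t T \<in> spanning_trees P \<longleftrightarrow> T \<in> spanning_trees ?P" if "?t \<notin> T" for T
    using that c connects_insert_merge[OF P B, of c T] EdI[OF ij] finite_edges_subset[of T]
    by (auto simp: spanning_trees_def)
  moreover have "?t \<notin> T" if T: "T \<in> spanning_trees ?P" for T
    by (rule spanning_trees_avoid_preserves[OF P' T merge_preserves_edge[OF P B]])
  ultimately have "{T. ?t \<notin> T \<and> insert ?t T \<in> spanning_trees P} = spanning_trees ?P" by blast
  then show ?thesis unfolding card_members_containing by simp
qed

lemma sum_card_blocks: "partition_on V P \<Longrightarrow> (\<Sum>B\<in>P. real (card B)) = real n"
  using sum_partition[of V P "\<lambda>_. 1 :: real"] by simp

lemma card_Un_blocks:
  assumes P: "partition_on V P" and B: "B1 \<in> P" "B2 \<in> P" "B1 \<noteq> B2"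
  shows "real (card (B1 \<union> B2)) = real (card B1) + real (card B2)"
proof -
  have "finite B" if "B \<in> P" for B
    using block_less[OF P that] by (intro finite_subset[of B V]) auto
  then show ?thesis
    using partition_on_disjoint[OF P B(1,2)] B by (subst card_Un_disjoint) auto
qed

lemma card_singleton_partition:
  assumes "partition_on V P" "card P = 1"
  shows "P = {V}"
proof -
  obtain B where "P = {B}" using assms(2) by (auto simp: card_1_singleton_iff)
  then show ?thesis using partition_onD1[OF assms(1)] by simp
qed

text \<open>Weighted form of Cayley's formula, with blocks as contracted vertices and
  \<open>m\<close> parallel edges between any two points. The factor \<open>n\<close> on the left
  avoids the exponent -1 of \<open>n\<close> in the case of a single block.\<close>

theorem card_spanning_trees:
  assumes "partition_on V P"
  shows "real n * real (card (spanning_trees P)) = (real m * real n) ^ (card P - 1) * (\<Prod>B\<in>P. real (card B))"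
proof -
  have "0 < card P"
    using finite_partition[OF assms] partition_nonempty[OF assms] card_gt_0_iff by blast
  then obtain k where "card P = Suc k" using gr0_implies_Suc by blast
  with assms show ?thesis
  proof (induction k arbitrary: P)
    case 0
    then have P: "P = {V}" using card_singleton_partition by simp
    have "connects {V} {}" by (auto simp: connects_def)
    then have "spanning_trees P = {{}}"
      using finite_edges_subset by (auto simp: spanning_trees_def P)
    then show ?case by (simp add: P)
  next
    case (Suc k)
    note P = Suc.prems(1)
    let ?X = "\<Prod>B\<in>P. real (card B)"
    have fin: "finite P" by (rule finite_partition[OF P])
    define F where "F B B' = real (card (spanning_trees (merge P B B')))" for B B'
    have "real (Suc k) * real (card (spanning_trees P)) = (\<Sum>t\<in>edges. real (card {T \<in> spanning_trees P. t \<in> T}))"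
      by (rule card_times_card_family[OF finite_edges]) (use Suc.prems(2) in \<open>auto simp: spanning_trees_def\<close>)
    then have "2 * (real (Suc k) * real (card (spanning_trees P))) =
        (\<Sum>B\<in>P. \<Sum>B'\<in>P - {B}. real (card B) * real (card B') * real m * F B B')"
      using sum_edges_blocks[OF P, of "\<lambda>t. real (card {T \<in> spanning_trees P. t \<in> T})" F "\<lambda>_ _. 0" "\<lambda>_. 0"]
        card_spanning_trees_containing_same[OF P] card_spanning_trees_containing_merge[OF P] by (simp add: F_def)
    then have "real n * (2 * (real (Suc k) * real (card (spanning_trees P)))) =
        (\<Sum>B\<in>P. \<Sum>B'\<in>P - {B}. real (card B) * real (card B') * real m * (real n * F B B'))"
      by (simp add: sum_distrib_left ac_simps)
    \<comment> \<open>Merging replaces the factor \<open>card B * card B'\<close> of the product by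
      \<open>card B + card B'\<close>. The weight of the pair restores the lost factors, so the sum
      over pairs becomes linear in the sizes.\<close>
    also have "\<dots> = (\<Sum>B\<in>P. \<Sum>B'\<in>P - {B}. (real (card B) + real (card B')) * (real m * (real m * real n) ^ k * ?X))"
    proof (intro sum.cong refl)
      fix B B' assume B: "B \<in> P" "B' \<in> P - {B}"
      then have B': "B' \<in> P" "B \<noteq> B'" by auto
      have c: "Suc (card (merge P B B')) = card P" by (rule card_merge[OF P fin B(1) B'])
      then have "real n * F B B' = (real m * real n) ^ k * (\<Prod>B\<in>merge P B B'. real (card B))"
        unfolding F_def using Suc.IH[OF partition_on_merge[OF P B(1) B']] Suc.prems(2) by simp
      then show "real (card B) * real (card B') * real m * (real n * F B B') =
          (real (card B) + real (card B')) * (real m * (real m * real n) ^ k * ?X)"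
        unfolding prod_merge[OF P fin B(1) B'] card_Un_blocks[OF P B(1) B']
          prod_remove2[OF fin B(1) B', of "\<lambda>B. real (card B)"] by simp
    qed
    also have "\<dots> = 2 * (real (Suc k) * real n * (real m * (real m * real n) ^ k * ?X))"
      using sum_pairs_left[OF fin, of "\<lambda>B. real (card B)" "real m * (real m * real n) ^ k * ?X"]
        sum_pairs_swap[OF fin, of "\<lambda>B B'. real (card B') * (real m * (real m * real n) ^ k * ?X)"]
        sum_card_blocks[OF P] Suc.prems(2)
      by (simp add: distrib_right sum.distrib)
    finally have "real (Suc k) * (real n * real (card (spanning_trees P))) =
        real (Suc k) * ((real m * real n) ^ Suc k * ?X)"
      by (simp add: ac_simps)
    then show ?case using Suc.prems(2) by simp
  qed
qed

lemma card_unicyclic_sets_containing_merge: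
  assumes P: "partition_on V P" and B: "B1 \<in> P" "B2 \<in> P" "B1 \<noteq> B2" "i \<in> B1" "j \<in> B2"
  shows "card {T \<in> unicyclic_sets P \<theta>. edge i j c \<in> T} = card (unicyclic_sets (merge P B1 B2) (shift B2 i j c \<theta>))"
proof -
  let ?t = "edge i j c" and ?P = "merge P B1 B2" and ?\<theta> = "shift B2 i j c \<theta>"
  have P': "partition_on V ?P" by (rule partition_on_merge[OF P B(1-3)])
  have c: "Suc (card ?P) = card P" by (rule card_merge[OF P finite_partition[OF P] B(1-3)])
  have ij: "i < n" "j < n" "i \<noteq> j"
    using block_less[OF P] B partition_on_disjoint[OF P B(1,2,4)] by auto
  have "insert ?t T \<in> unicyclic_sets P \<theta> \<longleftrightarrow> T \<in> unicyclic_sets ?P ?\<theta>" if "?t \<notin> T" for T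
    using that c unbalanced_insert_merge[OF P B ij(1,2), of \<theta> c T] EdI[OF ij] finite_edges_subset[of T]
    by (auto simp: unicyclic_sets_def)
  moreover have "?t \<notin> T" if T: "T \<in> unicyclic_sets ?P ?\<theta>" for T
  proof
    assume t: "?t \<in> T"
    have T': "T \<subseteq> edges" "card T = card ?P" "unbalanced ?P ?\<theta> T" using T by (auto simp: unicyclic_sets_def)
    \<comment> \<open>The shifted potential balances \<open>?t\<close>, so without this edge
      \<open>T\<close> would still be unbalanced, although it would have fewer edges than there are
      blocks.\<close>
    have "balanced q \<theta>' ?t" if "q dvd int m" "same_gain q ?P ?\<theta> \<theta>'" for q \<theta>'
      using same_gain_shift[OF P B that(1), of c \<theta> \<theta>'] that ij by (simp add: balanced_edge)
    then have "unbalanced ?P ?\<theta> (T - {?t})"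
      using T'(3) connects_insert_preserves[OF merge_preserves_edge[OF P B] P', of c "T - {?t}"] t EdI[OF ij]
      unfolding unbalanced_def by (simp add: insert_absorb) blast
    then have "card ?P \<le> card (T - {?t})"
      using unbalanced_card_le[OF _ _ P'] T'(1) finite_edges_subset[OF T'(1)] by auto
    then show False using T'(2) t finite_edges_subset[OF T'(1)] by (metis card_Suc_Diff1 not_less_eq_eq order_refl)
  qed
  ultimately have "{T. ?t \<notin> T \<and> insert ?t T \<in> unicyclic_sets P \<theta>} = unicyclic_sets ?P ?\<theta>" by blast
  then show ?thesis unfolding card_members_containing by simp
qed

text \<open>Removing the edge leaves a spanning tree, and the excess of its gain over the potential
  has to be a unit.\<close>

lemma card_unicyclic_sets_containing_same:
  assumes P: "partition_on V P" and B: "B \<in> P" "i \<in> B" "j \<in> B" "i \<noteq> j"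
  shows "card {T \<in> unicyclic_sets P \<theta>. edge i j (\<theta> j - \<theta> i + e) \<in> T} =
    (if coprime e (int m) then card (spanning_trees P) else 0)"
proof -
  let ?t = "edge i j (\<theta> j - \<theta> i + e)"
  have ij: "i < n" "j < n" using block_less[OF P] B by auto
  have "insert ?t T \<in> unicyclic_sets P \<theta> \<longleftrightarrow> coprime e (int m) \<and> T \<in> spanning_trees P" if "?t \<notin> T" for T
  proof (cases "T \<subseteq> edges \<and> card P = Suc (card T)")
    case True
    then show ?thesis
      using that unbalanced_insert_same[OF P B ij, of T \<theta> e] EdI[OF ij B(4)] finite_edges_subset[of T]
      by (auto simp: unicyclic_sets_def spanning_trees_def)
  next
    case False
    then show ?thesis using that finite_edges_subset[of T] by (auto simp: unicyclic_sets_def spanning_trees_def)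
  qed
  moreover have "?t \<notin> T" if T: "T \<in> spanning_trees P" for T
    by (rule spanning_trees_avoid_preserves[OF P T preserves_block_edge[OF P B(1-3)]])
  ultimately have "{T. ?t \<notin> T \<and> insert ?t T \<in> unicyclic_sets P \<theta>} = (if coprime e (int m) then spanning_trees P else {})" by auto
  then show ?thesis unfolding card_members_containing by simp
qed

text \<open>\<open>totatives m\<close> ranges over 1 to \<open>m\<close>, the residues over 0 to
  \<open>m - 1\<close>; as \<open>m\<close> is at least 2, neither 0 nor \<open>m\<close> is coprime
  to \<open>m\<close>.\<close>

lemma card_coprime_residues: "card {c. c < m \<and> coprime (int c) (int m)} = totient m"
proof -
  have "{c. c < m \<and> coprime (int c) (int m)} = totatives m"
  proof (intro equalityI subsetI)
    fix c assume c: "c \<in> {c. c < m \<and> coprime (int c) (int m)}"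
    then have "c \<noteq> 0" using m2 by (intro notI) simp
    with c show "c \<in> totatives m" by (auto simp: totatives_def)
  next
    fix c assume c: "c \<in> totatives m"
    then have "c \<noteq> m" using m2 by (intro notI) (simp add: totatives_def)
    with c show "c \<in> {c. c < m \<and> coprime (int c) (int m)}" by (auto simp: totatives_def)
  qed
  then show ?thesis by (simp add: totient_def)
qed

text \<open>The count is the same for all \<open>\<theta>\<close>, but merging replaces
  \<open>\<theta>\<close> by a shift that varies with the marked edge, so the induction has to cover
  all potentials at once.\<close>

theorem card_unicyclic_sets:
  assumes "partition_on V P"
  shows "2 * real (card (unicyclic_sets P \<theta>)) = real (totient m) * real m ^ (card P - 1) *
    bracket (card P) (real n) (epoly (\<lambda>B. real (card B)) P) * (\<Prod>B\<in>P. real (card B))"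
  using assms
proof (induction "card P" arbitrary: P \<theta> rule: less_induct)
  case less
  note P = less.prems
  let ?X = "\<lambda>P. \<Prod>B\<in>P. real (card B)" and ?x = "\<lambda>B. real (card B)"
  define k where "k = card P"
  have fin: "finite P" by (rule finite_partition[OF P])
  have ne: "P \<noteq> {}" by (rule partition_nonempty[OF P])
  then have k: "0 < k" using fin by (simp add: k_def card_gt_0_iff)
  define M where "M B B' = [:1, ?x B + ?x B':] * epoly ?x (P - {B, B'})" for B B'
  \<comment> \<open>The value that the induction hypothesis gives for the merged blocks, the same
    for every edge between \<open>B\<close> and \<open>B'\<close>.\<close>
  define F where "F B B' = real (totient m) * real m ^ (k - 2) * bracket (k - 1) (real n) (M B B') * ?X (merge P B B') / 2" for B B'
  have merge: "real (card {T \<in> unicyclic_sets P \<theta>. edge i j c \<in> T}) = F B B'"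
    if B: "B \<in> P" "B' \<in> P" "B \<noteq> B'" "i \<in> B" "j \<in> B'" for B B' i j c
  proof -
    have c: "Suc (card (merge P B B')) = card P" by (rule card_merge[OF P fin B(1-3)])
    have "epoly ?x (merge P B B') = M B B'"
      unfolding epoly_def M_def prod_merge[OF P fin B(1-3)] card_Un_blocks[OF P B(1-3)] ..
    note M = this
    have cm: "card (merge P B B') = k - 1" "card (merge P B B') < card P" using c by (auto simp: k_def)
    have "2 * real (card (unicyclic_sets (merge P B B') (shift B' i j c \<theta>))) = 2 * F B B'"
      using less.hyps[OF cm(2) partition_on_merge[OF P B(1-3)], of "shift B' i j c \<theta>"]
      unfolding M cm(1) F_def by (simp add: numeral_2_eq_2)
    then show ?thesis unfolding card_unicyclic_sets_containing_merge[OF P B] by simp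
  qed
  define h where "h c = (if coprime (int c) (int m) then real (card (spanning_trees P)) else 0)" for c
  \<comment> \<open>Gains inside a block are measured from the potential; then only the excess
    \<open>c\<close> decides.\<close>
  have same: "real (card {T \<in> unicyclic_sets P \<theta>. edge i j (\<theta> j - \<theta> i + int c) \<in> T}) = h c"
    if "B \<in> P" "i \<in> B" "j \<in> B" "i \<noteq> j" for B i j c
    unfolding card_unicyclic_sets_containing_same[OF P that] h_def by simp
  have sum_h: "(\<Sum>c<m. h c) = real (totient m) * real (card (spanning_trees P))"
    unfolding h_def card_coprime_residues[symmetric]
    by (simp add: sum.If_cases Int_def lessThan_def conj_commute)
  have "real k * real (card (unicyclic_sets P \<theta>)) = (\<Sum>t\<in>edges. real (card {T \<in> unicyclic_sets P \<theta>. t \<in> T}))"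
    by (rule card_times_card_family[OF finite_edges]) (auto simp: unicyclic_sets_def k_def)
  then have 1: "2 * (real k * real (card (unicyclic_sets P \<theta>))) =
      (\<Sum>B\<in>P. ?x B * (?x B - 1)) * (real (totient m) * real (card (spanning_trees P))) +
      (\<Sum>B\<in>P. \<Sum>B'\<in>P - {B}. ?x B * ?x B' * real m * F B B')"
    using sum_edges_blocks[OF P, of "\<lambda>t. real (card {T \<in> unicyclic_sets P \<theta>. t \<in> T})" F "\<lambda>i j. \<theta> j - \<theta> i" h]
      merge same sum_h by simp
  have 2: "(\<Sum>B\<in>P. \<Sum>B'\<in>P - {B}. ?x B * ?x B' * real m * F B B') =
      real (totient m) * real m ^ (k - 1) * ?X P *
      (\<Sum>B\<in>P. \<Sum>B'\<in>P - {B}. (?x B + ?x B') / 2 * bracket (k - 1) (real n) (M B B'))"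
    unfolding sum_distrib_left
  proof (intro sum.cong refl)
    fix B B' assume B: "B \<in> P" "B' \<in> P - {B}"
    then have B': "B' \<in> P" "B \<noteq> B'" by auto
    have "2 \<le> k" unfolding k_def using card_mono[OF fin, of "{B, B'}"] B' B by auto
    then have "k - 1 = Suc (k - 2)" by simp
    then have mm: "real m ^ (k - 1) = real m * real m ^ (k - 2)" by simp
    show "?x B * ?x B' * real m * F B B' = real (totient m) * real m ^ (k - 1) * ?X P *
        ((?x B + ?x B') / 2 * bracket (k - 1) (real n) (M B B'))"
      unfolding F_def prod_merge[OF P fin B(1) B'] card_Un_blocks[OF P B(1) B']
        prod_remove2[OF fin B(1) B', of ?x] mm by simp
  qed
  have 3: "(\<Sum>B\<in>P. ?x B * (?x B - 1)) = (\<Sum>B\<in>P. (?x B)\<^sup>2) - real n"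
    using sum_card_blocks[OF P] by (simp add: right_diff_distrib sum_subtractf power2_eq_square)
  have 4: "real n * real (card (spanning_trees P)) = real m ^ (k - 1) * real n ^ (k - 1) * ?X P"
    using card_spanning_trees[OF P] by (simp add: k_def power_mult_distrib)
  have 5: "real k * real n * bracket k (real n) (epoly ?x P) =
      real n * (\<Sum>B\<in>P. \<Sum>B'\<in>P - {B}. (?x B + ?x B') / 2 * bracket (k - 1) (real n) (M B B'))
      + real n ^ (k - 1) * ((\<Sum>B\<in>P. (?x B)\<^sup>2) - real n)"
    using bracket_recurrence[OF fin ne sum_card_blocks[OF P, symmetric]] n1
    unfolding k_def M_def by simp
  have "real k * real n * (2 * real (card (unicyclic_sets P \<theta>))) =
      real n * (2 * (real k * real (card (unicyclic_sets P \<theta>))))" by simp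
  also have "\<dots> = real (totient m) * real m ^ (k - 1) * ?X P *
      (real k * real n * bracket k (real n) (epoly ?x P))"
  proof -
    \<comment> \<open>\<open>4\<close> evaluates the number of spanning trees; what remains is the
      recurrence \<open>5\<close> times the common factors, checked over abstract reals.\<close>
    have alg: "N * ((a - N) * (p * q) + p * r * x * y) = p * r * x * (N * y + z * (a - N))"
      if "N * q = r * z * x" for N a p q r x y z :: real
    proof -
      have "N * ((a - N) * (p * q) + p * r * x * y) = p * (a - N) * (N * q) + p * r * x * (N * y)"
        by (simp add: algebra_simps)
      then show ?thesis unfolding that by (simp add: algebra_simps)
    qed
    show ?thesis unfolding 1 2 3 5 by (rule alg[OF 4])
  qed
  finally have "real k * real n * (2 * real (card (unicyclic_sets P \<theta>))) = real k * real n *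
      (real (totient m) * real m ^ (k - 1) * bracket k (real n) (epoly ?x P) * ?X P)"
    by (simp add: ac_simps)
  then show ?case using k n1 by (simp flip: k_def)
qed

end

section \<open>Reduced factorizations\<close>

text \<open>Sending a block of \<open>P\<close> to the block of \<open>Q\<close> around it is onto.
  Equal cardinalities make it injective, and then no block of \<open>Q\<close> contains two blocks
  of \<open>P\<close>.\<close>

lemma coarser_partition:
  assumes P: "partition_on A P" "finite P" and Q: "partition_on A Q"
    and coarse: "\<And>C. C \<in> P \<Longrightarrow> \<exists>B\<in>Q. C \<subseteq> B"
  shows "card Q \<le> card P" and "card Q = card P \<Longrightarrow> Q = P"
proof -
  obtain f where f: "\<And>C. C \<in> P \<Longrightarrow> f C \<in> Q \<and> C \<subseteq> f C" using coarse by metis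
  have block: "\<exists>C\<in>P. x \<in> C \<and> f C = B" if "B \<in> Q" "x \<in> B" for x B
  proof -
    have "x \<in> A" using that partition_onD1[OF Q] by auto
    then obtain C where C: "C \<in> P" "x \<in> C" by (rule partition_on_block[OF P(1)])
    then have "f C = B" using partition_on_disjoint[OF Q, of "f C" B x] f[OF C(1)] that by auto
    with C show ?thesis by blast
  qed
  have img: "f ` P = Q"
  proof (intro equalityI subsetI)
    fix B assume B: "B \<in> Q"
    then obtain x where "x \<in> B" using partition_onD3[OF Q] by (metis ex_in_conv)
    then show "B \<in> f ` P" using block[OF B] by blast
  qed (use f in auto)
  then show "card Q \<le> card P" using P(2) card_image_le by blast
  show "Q = P" if "card Q = card P"
  proof -
    have inj: "inj_on f P" using that img P(2) eq_card_imp_inj_on by metis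
    have "f C = C" if C: "C \<in> P" for C
    proof (intro equalityI subsetI)
      fix x assume "x \<in> f C"
      then obtain C' where "C' \<in> P" "x \<in> C'" "f C' = f C" using block f[OF C] by blast
      then show "x \<in> C" using inj C by (metis inj_onD)
    qed (use f[OF C] in auto)
    then show ?thesis using img by force
  qed
qed

context colored_perms
begin

section \<open>The groups generated by all edges and diagonals\<close>

lemma generate_subgroup: "p dvd m \<Longrightarrow> X \<subseteq> Gcarrier m p n \<Longrightarrow> subgroup (generate (G m p n) X) (G m p n)"
  using group.generate_is_subgroup[OF group_G, of p X] by simp

text \<open>Two parallel edges multiply to a diagonal matrix with opposite colors at
  \<open>a\<close> and 0. Such products push all color to vertex 0, where nothing remains because
  the sum is divisible by \<open>m\<close>.\<close>

lemma diag_subgroup_m: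
  assumes H: "subgroup H (G m m n)" and edges: "edges \<subseteq> H"
    and A: "finite A" "A \<subseteq> {0<..<n}" "\<And>k. k < n \<Longrightarrow> k \<notin> insert 0 A \<Longrightarrow> d k = 0" and d: "int m dvd (\<Sum>k<n. d k)"
  shows "elt_of id d \<in> H"
  using A d
proof (induction A arbitrary: d rule: finite_induct)
  case empty
  have "(\<Sum>k<n. d k) = d 0"
    using empty.prems(2) n1 by (subst sum.mono_neutral_right[of _ "{0}"]) auto
  then have "int m dvd d k" if "k < n" for k
    using empty.prems that by (cases "k = 0") auto
  then have "elt_of id d = elt_of id (\<lambda>_. 0)"
    by (intro elt_of_cong) (auto simp: cong_0_iff)
  then show ?case using subgroup.one_closed[OF H] by (simp add: id_def)
next
  case (insert a A)
  define d' where "d' = d(a := 0, 0 := d 0 + d a)"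
  have a: "0 < a" "a < n" using insert.prems(1) by auto
  let ?e = "\<lambda>k. if k = a then d a else if k = 0 then - d a else 0"
  have "(\<Sum>k<n. ?e k) = 0" by (rule sum_edge) (use a in auto)
  moreover have split: "d k = ?e k + d' k" for k using a by (auto simp: d'_def)
  have "(\<Sum>k<n. d k) = (\<Sum>k<n. ?e k + d' k)" by (rule sum.cong[OF refl split])
  then have "(\<Sum>k<n. d k) = (\<Sum>k<n. ?e k) + (\<Sum>k<n. d' k)" unfolding sum.distrib .
  ultimately have "int m dvd (\<Sum>k<n. d' k)" using insert.prems(3) by simp
  then have "elt_of id d' \<in> H"
    using insert.prems insert.hyps by (intro insert.IH) (auto simp: d'_def)
  moreover have "Gmult m n (edge a 0 0) (edge a 0 (d a)) \<in> H"
    using a edges EdI[of a 0] by (intro subgroup_mult[OF H]) auto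
  ultimately have "Gmult m n (elt_of id ?e) (elt_of id d') \<in> H"
    using a by (intro subgroup_mult[OF H]) (simp_all add: edge_edge_same)
  also have "Gmult m n (elt_of id ?e) (elt_of id d') = elt_of (id \<circ> id) (\<lambda>k. ?e (id k) + d' k)"
    by (rule Gmult_elt_of[OF permutes_id])
  also have "(\<lambda>k. ?e (id k) + d' k) = d" unfolding id_apply by (rule ext) (rule split[symmetric])
  finally show ?case by (simp add: id_def)
qed

lemma diag_subgroup_1:
  assumes H: "subgroup H (G m 1 n)" and diags: "diags \<subseteq> H"
    and A: "finite A" "A \<subseteq> V" "\<And>k. k < n \<Longrightarrow> k \<notin> A \<Longrightarrow> d k = 0"
  shows "elt_of id d \<in> H"
  using A
proof (induction A arbitrary: d rule: finite_induct)
  case empty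
  then have "elt_of id d = elt_of id (\<lambda>_. 0)" by (intro elt_of_cong) auto
  then show ?case using subgroup.one_closed[OF H] by (simp add: id_def)
next
  case (insert a A)
  define d' where "d' = d(a := 0)"
  have a: "a < n" using insert.prems(1) by auto
  have one: "elt_of id (\<lambda>_. 0) \<in> H" using subgroup.one_closed[OF H] by simp
  have "diag a (d a) \<in> H"
  \<comment> \<open>\<open>diags\<close> omits the identity, so a trivial color at \<open>a\<close>
    is treated apart.\<close>
  proof (cases "int m dvd d a")
    case True
    then have "diag a (d a) = elt_of id (\<lambda>_. 0)"
      unfolding diag_def by (intro elt_of_cong) (auto simp: cong_0_iff)
    then show ?thesis using one by simp
  next
    case False
    then show ?thesis using diags a by (auto simp: diags_def)
  qed
  moreover have "elt_of id d' \<in> H"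
    using insert.prems insert.hyps by (intro insert.IH) (auto simp: d'_def)
  ultimately have "Gmult m n (diag a (d a)) (elt_of id d') \<in> H" by (rule subgroup_mult[OF H])
  also have "Gmult m n (diag a (d a)) (elt_of id d') = elt_of (id \<circ> id) d"
    unfolding diag_def Gmult_elt_of[OF permutes_id] by (rule elt_of_cong) (simp add: d'_def)
  finally show ?case by (simp add: id_def comp_def)
qed

text \<open>Both \<open>g\<close> and the product of edges lie in \<open>G(m,m,n)\<close>, so the
  diagonal remainder has color sum 0 modulo \<open>m\<close>.\<close>

lemma edges_generates:
  assumes H: "subgroup H (G m m n)" and edges: "edges \<subseteq> H"
  shows "Gcarrier m m n \<subseteq> H"
proof
  fix g assume g: "g \<in> Gcarrier m m n"
  then obtain u b where ub: "g = elt_of u b" "u permutes V" "int m dvd (\<Sum>k<n. b k)"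
    by (rule Gcarrier_cases[OF dvd_refl])
  obtain fs d where fs: "set fs \<subseteq> edges" "g = Gmult m n (prod_elts fs) (elt_of id d)"
    using cycles_factorization[OF ub(2), of b] ub(1) by metis
  have pH: "prod_elts fs \<in> H" using prod_elts_in_subgroup[OF H] fs edges by auto
  have "prod_elts fs \<in> Gcarrier m m n" using subgroup.subset[OF H] pH by auto
  then obtain v c where vc: "prod_elts fs = elt_of v c" "v permutes V" "int m dvd (\<Sum>k<n. c k)"
    by (rule Gcarrier_cases[OF dvd_refl])
  have "g = elt_of (v \<circ> id) (\<lambda>k. c (id k) + d k)"
    unfolding fs(2) vc(1) by (rule Gmult_elt_of[OF permutes_id])
  then have "int m dvd (\<Sum>k<n. c (id k) + d k)" using g elt_of_in_iff[OF dvd_refl] by metis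
  then have "int m dvd (\<Sum>k<n. d k)" using vc(3) by (simp add: sum.distrib dvd_add_right_iff)
  then have "elt_of id d \<in> H"
    by (intro diag_subgroup_m[OF H edges, of "{0<..<n}"]) auto
  then show "g \<in> H" unfolding fs(2) by (rule subgroup_mult[OF H pH])
qed

lemma edges_diags_generates:
  assumes H: "subgroup H (G m 1 n)" and R: "edges \<union> diags \<subseteq> H"
  shows "Gcarrier m 1 n \<subseteq> H"
proof
  fix g assume g: "g \<in> Gcarrier m 1 n"
  then obtain u b where ub: "g = elt_of u b" "u permutes V"
    by (rule Gcarrier_cases[OF one_dvd])
  obtain fs d where fs: "set fs \<subseteq> edges" "g = Gmult m n (prod_elts fs) (elt_of id d)"
    using cycles_factorization[OF ub(2), of b] ub(1) by metis
  have pH: "prod_elts fs \<in> H" using prod_elts_in_subgroup[OF H] fs R by auto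
  have "elt_of id d \<in> H" by (rule diag_subgroup_1[OF H _ finite_lessThan subset_refl]) (use R in auto)
  then show "g \<in> H" unfolding fs(2) by (rule subgroup_mult[OF H pH])
qed

lemma generate_edges_eq:
  assumes "X \<subseteq> edges" "connects {} X"
    and "\<And>q \<theta>. 1 < q \<Longrightarrow> q dvd int m \<Longrightarrow> \<exists>x\<in>X. \<not> balanced q \<theta> x"
  shows "generate (G m m n) X = Gcarrier m m n"
proof -
  have X: "X \<subseteq> Gcarrier m m n" using assms(1) edges_subset[of m] by auto
  note H = generate_subgroup[OF dvd_refl X]
  have "X \<subseteq> generate (G m m n) X" by (auto intro: generate.incl)
  then have "edges \<subseteq> generate (G m m n) X"
    by (rule unbalanced_edges_subset[OF H _ assms])
  then show ?thesis using edges_generates[OF H] subgroup.subset[OF H] by auto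
qed

lemma generate_edges_diags_eq:
  assumes "X \<subseteq> edges \<union> diags" "connects {} X"
    and "\<And>q. 1 < q \<Longrightarrow> q dvd int m \<Longrightarrow> \<exists>x\<in>X. \<not> q dvd (\<Sum>k<n. int (snd x k))"
  shows "generate (G m 1 n) X = Gcarrier m 1 n"
proof -
  have X: "X \<subseteq> Gcarrier m 1 n" using assms(1) edges_subset[of 1] diags_subset by auto
  note H = generate_subgroup[OF one_dvd X]
  have "X \<subseteq> generate (G m 1 n) X" by (auto intro: generate.incl)
  then have "edges \<union> diags \<subseteq> generate (G m 1 n) X"
    by (rule colored_Refl_subset[OF H _ assms])
  then show ?thesis using edges_diags_generates[OF H] subgroup.subset[OF H] by auto
qed

section \<open>Necessary conditions for generation\<close>

lemma generate_imp_connects: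
  assumes p: "p dvd m" and X: "X \<subseteq> Gcarrier m p n" and gen: "generate (G m p n) X = Gcarrier m p n"
  shows "connects {} X"
  unfolding connects_def
proof (intro allI impI)
  fix A assume A: "A \<subseteq> V \<and> A \<noteq> {} \<and> (\<forall>B\<in>{}. B \<subseteq> A \<or> B \<inter> A = {}) \<and> (\<forall>t\<in>X. preserves A t)"
  then obtain i where i: "i \<in> A" "i < n" by auto
  have "j \<in> A" if j: "j < n" for j
  proof (cases "i = j")
    case False
    then have "edge i j 0 \<in> generate (G m p n) X" unfolding gen using i j p by (intro edge_in) auto
    then have "preserves A (edge i j 0)" using generate_preserves[OF p p X] A by blast
    then show ?thesis using i by simp
  qed (use i in simp)
  then show "A = V" using A by auto
qed

text \<open>Balance passes from \<open>X\<close> to the whole group, which contains an edge whose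
  gain misses the potential difference by 1. Such an edge requires two vertices.\<close>

lemma generate_imp_unbalanced:
  assumes X: "X \<subseteq> Gcarrier m m n" and gen: "generate (G m m n) X = Gcarrier m m n"
    and n: "2 \<le> n" and q: "1 < q" "q dvd int m"
  shows "\<exists>x\<in>X. \<not> balanced q \<theta> x"
proof (rule ccontr)
  assume "\<not> (\<exists>x\<in>X. \<not> balanced q \<theta> x)"
  moreover have "edge 0 1 (\<theta> 1 - \<theta> 0 + 1) \<in> generate (G m m n) X"
    unfolding gen using n by (intro edge_in) auto
  ultimately have "balanced q \<theta> (edge 0 1 (\<theta> 1 - \<theta> 0 + 1))" using generate_balanced[OF dvd_refl dvd_refl q(2) X] by blast
  then have "q dvd 1" using n q(2) by (simp add: balanced_edge cong_iff_dvd_diff)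
  then show False using q(1) by (simp add: zdvd1_eq)
qed

lemma preserves_V: "x \<in> Gcarrier m p n \<Longrightarrow> preserves V x"
  using permutes_in_image[OF Gcarrier_permutes] by (simp add: preserves_def)

lemma generate_imp_colsum:
  assumes X: "X \<subseteq> Gcarrier m 1 n" and gen: "generate (G m 1 n) X = Gcarrier m 1 n"
    and q: "1 < q" "q dvd int m"
  shows "\<exists>x\<in>X. \<not> q dvd (\<Sum>k<n. int (snd x k))"
proof (rule ccontr)
  assume *: "\<not> (\<exists>x\<in>X. \<not> q dvd (\<Sum>k<n. int (snd x k)))"
  have "diag 0 1 \<in> generate (G m 1 n) X"
    unfolding gen using n1 by (intro diag_in) auto
  then have "q dvd (\<Sum>k<n. int (snd (diag 0 1) k))"
    using generate_colsum[OF one_dvd one_dvd q(2) subset_refl X] * X preserves_V by blast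
  then have "q dvd 1" using colsum_diag[OF q(2), of V 0 1] n1 by simp
  then show False using q(1) by (simp add: zdvd1_eq)
qed

lemma preserves_union_of_blocks:
  assumes "partition_on V P" "A \<subseteq> V" "\<And>B. B \<in> P \<Longrightarrow> B \<subseteq> A \<or> B \<inter> A = {}" "\<And>B. B \<in> P \<Longrightarrow> preserves B t"
  shows "preserves A t"
  unfolding preserves_def
proof (intro allI iffI)
  fix k assume "fst t k \<in> A"
  then obtain B where B: "B \<in> P" "fst t k \<in> B" using partition_on_block[OF assms(1)] assms(2) by blast
  then have "k \<in> B" using assms(4) by (simp add: preserves_def)
  then show "k \<in> A" using assms(3)[OF B(1)] B \<open>fst t k \<in> A\<close> by auto
next
  fix k assume "k \<in> A"
  then obtain B where B: "B \<in> P" "k \<in> B" using partition_on_block[OF assms(1)] assms(2) by blast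
  then have "fst t k \<in> B" using assms(4) by (simp add: preserves_def)
  then show "fst t k \<in> A" using assms(3)[OF B(1)] B \<open>k \<in> A\<close> by auto
qed

text \<open>Reflections inside the blocks never cross a cut that respects the blocks, so contraction
  makes them disappear.\<close>

lemma connects_absorb:
  assumes connects: "connects {} (T \<union> F)" and P: "partition_on V P" and F: "\<And>f B. f \<in> F \<Longrightarrow> B \<in> P \<Longrightarrow> preserves B f"
  shows "connects P T"
  unfolding connects_def
proof (intro allI impI)
  fix A assume A: "A \<subseteq> V \<and> A \<noteq> {} \<and> (\<forall>B\<in>P. B \<subseteq> A \<or> B \<inter> A = {}) \<and> (\<forall>t\<in>T. preserves A t)"
  have "preserves A f" if f: "f \<in> F" for f
    by (rule preserves_union_of_blocks[OF P]) (use A F[OF f] in auto)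
  then show "A = V" using connects[unfolded connects_def, THEN spec[of _ A]] A by auto
qed

text \<open>Converse of absorption: when \<open>X\<close> forces every set it preserves to respect
  the blocks, a cut of \<open>X\<close> is a cut of the contracted graph.\<close>

lemma connects_expand:
  assumes connects: "connects P T" "T \<subseteq> X"
    and X: "\<And>A. A \<subseteq> V \<Longrightarrow> (\<And>x. x \<in> X \<Longrightarrow> preserves A x) \<Longrightarrow> \<forall>B\<in>P. B \<subseteq> A \<or> B \<inter> A = {}"
  shows "connects {} X"
  unfolding connects_def
proof (intro allI impI)
  fix A assume A: "A \<subseteq> V \<and> A \<noteq> {} \<and> (\<forall>B\<in>{}. B \<subseteq> A \<or> B \<inter> A = {}) \<and> (\<forall>t\<in>X. preserves A t)"
  then have "\<forall>B\<in>P. B \<subseteq> A \<or> B \<inter> A = {}" using X[of A] by blast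
  then show "A = V" using connects(1)[unfolded connects_def, THEN spec[of _ A]] connects(2) A by auto
qed

lemma connects_Int_edges: "T \<subseteq> edges \<union> diags \<Longrightarrow> connects P T \<Longrightarrow> connects P (T \<inter> edges)"
proof -
  assume T: "T \<subseteq> edges \<union> diags" and connects: "connects P T"
  have "(\<forall>t\<in>T \<inter> edges. preserves A t) \<longleftrightarrow> (\<forall>t\<in>T. preserves A t)" for A using T preserves_diags by blast
  then show ?thesis using connects unfolding connects_def by simp
qed

lemma edges_diags_disjoint: "edges \<inter> diags = {}"
proof -
  have False if "edge i j c = diag k e" "i \<noteq> j" for i j c k e
  proof -
    have "Transposition.transpose i j = id" using that(1) by (simp add: edge_def diag_def elt_of_eq_iff)
    then show False using that(2) by (metis id_apply transpose_apply_first)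
  qed
  then have False if "x \<in> edges" "x \<in> diags" for x using that unfolding edges_def diags_def by blast
  then show ?thesis by blast
qed

section \<open>Invariants of products of reflections\<close>

lemma prod_elts_invariant:
  assumes "subgroup {x \<in> Gcarrier m p n. \<phi> x} (G m p n)" "set fs \<subseteq> Gcarrier m p n" "\<forall>f\<in>set fs. \<phi> f"
  shows "\<phi> (prod_elts fs)"
  using prod_elts_in_subgroup[OF assms(1), of fs] assms(2,3) by auto

lemma edges_diags_subset: "edges \<union> diags \<subseteq> Gcarrier m 1 n"
  using edges_subset[of 1] diags_subset by auto

lemma prod_elts_preserves: "set fs \<subseteq> edges \<union> diags \<Longrightarrow> (\<And>f. f \<in> set fs \<Longrightarrow> preserves A f) \<Longrightarrow> preserves A (prod_elts fs)"
  by (rule prod_elts_invariant[OF subgroup_preserves[of 1]]) (use edges_diags_subset in auto)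

lemma prod_elts_balanced: "set fs \<subseteq> edges \<union> diags \<Longrightarrow> q dvd int m \<Longrightarrow> (\<And>f. f \<in> set fs \<Longrightarrow> balanced q \<theta> f) \<Longrightarrow> balanced q \<theta> (prod_elts fs)"
  by (rule prod_elts_invariant[OF subgroup_balanced[of 1]]) (use edges_diags_subset in auto)

lemma prod_elts_colsum:
  assumes "set fs \<subseteq> edges \<union> diags" "q dvd int m" "A \<subseteq> V" "\<And>f. f \<in> set fs \<Longrightarrow> preserves A f"
    "\<And>f. f \<in> set fs \<Longrightarrow> q dvd (\<Sum>k\<in>A. int (snd f k))"
  shows "q dvd (\<Sum>k\<in>A. int (snd (prod_elts fs) k))"
proof -
  have "preserves A (prod_elts fs) \<and> q dvd (\<Sum>k\<in>A. int (snd (prod_elts fs) k))"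
    by (rule prod_elts_invariant[OF subgroup_colsum[OF one_dvd assms(2,3)]]) (use assms edges_diags_subset in auto)
  then show ?thesis ..
qed

lemma prod_elts_edges_colsum:
  assumes "set fs \<subseteq> edges" "q dvd int m" "A \<subseteq> V" "\<And>f. f \<in> set fs \<Longrightarrow> preserves A f" "prod_elts fs = elt_of u b"
  shows "q dvd (\<Sum>k\<in>A. b k)"
proof -
  have "q dvd (\<Sum>k\<in>A. int (snd (prod_elts fs) k))"
    by (rule prod_elts_colsum) (use assms colsum_edges in auto)
  then show ?thesis unfolding assms(5) colsum_elt_of[OF assms(2,3)] .
qed

text \<open>Start from singleton blocks. The factors preserve each component, hence so does their
  product, and no cycle of \<open>u\<close> leaves a component.\<close>

lemma components_of_factorization:
  assumes fs: "set fs \<subseteq> edges \<union> diags" and g: "prod_elts fs = elt_of u b" and u: "u permutes V"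
  obtains Q where "partition_on V Q" "\<forall>f\<in>set fs. \<forall>B\<in>Q. preserves B f"
    "\<forall>C\<in>cycles n u. \<exists>B\<in>Q. C \<subseteq> B" "n \<le> card Q + card (set fs \<inter> edges)"
    "n = card Q + card (set fs \<inter> edges) \<longrightarrow> (\<exists>\<theta>. \<forall>f\<in>set fs \<inter> edges. balanced (int m) \<theta> f)"
proof -
  let ?P = "(\<lambda>x. {x}) ` V"
  have card: "card ?P = n" by (subst card_image) auto
  obtain Q where Q: "partition_on V Q" "\<forall>t\<in>set fs \<inter> edges. \<forall>B\<in>Q. preserves B t"
     "card ?P \<le> card Q + card (set fs \<inter> edges)"
     "card ?P = card Q + card (set fs \<inter> edges) \<longrightarrow>
        (\<exists>\<theta>'. same_gain (int m) ?P (\<lambda>_. 0) \<theta>' \<and> (\<forall>t\<in>set fs \<inter> edges. balanced (int m) \<theta>' t))"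
    using components[OF _ Int_lower2 partition_on_singletons, of "set fs" "\<lambda>_. 0", OF finite_Int[OF disjI1[OF finite_set]]]
    by (elim exE conjE) (rule that)
  have preserves: "preserves B f" if "f \<in> set fs" "B \<in> Q" for f B
    using Q(2) that fs preserves_diags by blast
  have "\<exists>B\<in>Q. C \<subseteq> B" if C: "C \<in> cycles n u" for C
  proof -
    obtain x where "C = cycle_of u x" and xV: "x \<in> V" using C by (auto simp: cycles_def)
    then have x: "x \<in> C" "x \<in> V" by simp_all
    then obtain B where B: "B \<in> Q" "x \<in> B" using partition_on_block[OF Q(1)] by blast
    have "preserves B (elt_of u b)" unfolding g[symmetric] by (rule prod_elts_preserves[OF fs]) (use preserves B in auto)
    then show ?thesis using preserves_union_of_cycles[OF _ C] x B by blast
  qed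
  moreover have "\<exists>\<theta>. \<forall>f\<in>set fs \<inter> edges. balanced (int m) \<theta> f" if "n = card Q + card (set fs \<inter> edges)"
    using Q(4) that card by auto
  ultimately show thesis using that[OF Q(1)] preserves Q(3) card by simp
qed

text \<open>Common frame of the four cases. The list \<open>ts\<close> may repeat entries, so a
  priori \<open>T\<close> has at most \<open>k\<close> elements, and it is empty only if
  \<open>k = 0\<close>. Conversely, members of \<open>S\<close> have exactly \<open>k\<close>
  elements and can be listed without repetition.\<close>

lemma RGS_eqI:
  assumes ex: "\<exists>fs. set fs \<subseteq> R \<and> length fs = r \<and> prod_elts fs = g"
    and lower: "\<And>fs. set fs \<subseteq> R \<Longrightarrow> prod_elts fs = g \<Longrightarrow> r \<le> length fs"
    and r: "r + k = n"
    and fwd: "\<And>T fs. T \<subseteq> R \<Longrightarrow> finite T \<Longrightarrow> card T \<le> k \<Longrightarrow> (T = {} \<Longrightarrow> k = 0) \<Longrightarrow> set fs \<subseteq> R \<Longrightarrow>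
      length fs = r \<Longrightarrow> prod_elts fs = g \<Longrightarrow> generate (G m p n) (T \<union> set fs) = Gcarrier m p n \<Longrightarrow> T \<in> S"
    and bwd: "\<And>T. T \<in> S \<Longrightarrow> T \<subseteq> R \<and> finite T \<and> card T = k"
    and gen: "\<And>T fs. T \<in> S \<Longrightarrow> set fs \<subseteq> R \<Longrightarrow> length fs = r \<Longrightarrow> prod_elts fs = g \<Longrightarrow>
      generate (G m p n) (T \<union> set fs) = Gcarrier m p n"
  shows "RGS (G m p n) R n g = S"
proof -
  have rl: "refl_length (G m p n) R g = r"
    unfolding refl_length_def listprod_G
    by (rule Least_equality) (use ex lower in blast)+
  have nr: "n - r = k" using r by simp
  show ?thesis
  proof (intro equalityI subsetI)
    fix T assume "T \<in> RGS (G m p n) R n g"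
    then obtain ts fs where *: "T = set ts" "length ts = k" "set ts \<subseteq> R" "set fs \<subseteq> R" "length fs = r"
        "prod_elts fs = g" "generate (G m p n) (set ts \<union> set fs) = Gcarrier m p n"
      by (auto simp: RGS_def rl nr listprod_G)
    have "card T \<le> k" using * card_length by metis
    then show "T \<in> S" using * by (intro fwd[of T fs]) auto
  next
    fix T assume T: "T \<in> S"
    obtain ts where ts: "set ts = T" "distinct ts"
      using finite_distinct_list bwd[OF T] by metis
    then have "length ts = k" using bwd[OF T] distinct_card by metis
    moreover obtain fs where "set fs \<subseteq> R" "length fs = r" "prod_elts fs = g" using ex by blast
    ultimately show "T \<in> RGS (G m p n) R n g"
      unfolding RGS_def rl nr listprod_G using gen[OF T, of fs] bwd[OF T] ts by auto
  qed
qed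

section \<open>Colors and potentials on the cycles\<close>

lemma colsum_union_of_cycles:
  assumes u: "u permutes V" and A: "A \<subseteq> V" "\<And>C. C \<in> cycles n u \<Longrightarrow> C \<subseteq> A \<or> C \<inter> A = {}"
  shows "(\<Sum>k\<in>A. b k) = (\<Sum>C\<in>{C \<in> cycles n u. C \<subseteq> A}. \<Sum>k\<in>C. (b k :: int))"
proof (rule sum_partition)
  note P = partition_cycles[OF u]
  show "partition_on A {C \<in> cycles n u. C \<subseteq> A}"
  proof (rule partition_onI)
    show "\<Union> {C \<in> cycles n u. C \<subseteq> A} = A"
    proof (intro equalityI subsetI)
      fix x assume x: "x \<in> A"
      then obtain C where "C \<in> cycles n u" "x \<in> C" using partition_on_block[OF P, of x] A(1) by blast
      then show "x \<in> \<Union> {C \<in> cycles n u. C \<subseteq> A}" using A(2) x by blast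
    qed auto
    show "{} \<notin> {C \<in> cycles n u. C \<subseteq> A}" using partition_onD3[OF P] by simp
    show "disjnt p q" if "p \<in> {C \<in> cycles n u. C \<subseteq> A}" "q \<in> {C \<in> cycles n u. C \<subseteq> A}" "p \<noteq> q" for p q
      using partition_on_disjoint[OF P, of p q] that by (auto simp: disjnt_iff)
  qed
qed (use A finite_subset in blast)

lemma colsum_colored_cycles:
  assumes u: "u permutes V" and A: "A \<subseteq> V" "\<And>C. C \<in> cycles n u \<Longrightarrow> C \<subseteq> A \<or> C \<inter> A = {}"
    and D: "D \<subseteq> cycles n u" and zero: "\<And>C. C \<in> cycles n u - D \<Longrightarrow> int m dvd (\<Sum>k\<in>C. b k)"
  shows "[(\<Sum>k\<in>A. b k) = (\<Sum>C\<in>{C \<in> D. C \<subseteq> A}. \<Sum>k\<in>C. b k)] (mod int m)"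
proof -
  let ?K = "{C \<in> cycles n u. C \<subseteq> A}" and ?D = "{C \<in> D. C \<subseteq> A}"
  have fin: "finite ?K" using finite_partition[OF partition_cycles[OF u]] by simp
  have "(\<Sum>k\<in>A. b k) = (\<Sum>C\<in>?K. \<Sum>k\<in>C. b k)" by (rule colsum_union_of_cycles[OF u A])
  also have "\<dots> = (\<Sum>C\<in>?K - ?D. \<Sum>k\<in>C. b k) + (\<Sum>C\<in>?D. \<Sum>k\<in>C. b k)"
    by (rule sum.subset_diff[OF _ fin]) (use D in auto)
  finally have "(\<Sum>k\<in>A. b k) = (\<Sum>C\<in>?K - ?D. \<Sum>k\<in>C. b k) + (\<Sum>C\<in>?D. \<Sum>k\<in>C. b k)" .
  moreover have "int m dvd (\<Sum>C\<in>?K - ?D. \<Sum>k\<in>C. b k)" by (rule dvd_sum) (use zero in auto)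
  ultimately show ?thesis by (simp add: cong_iff_dvd_diff)
qed

text \<open>Potential differences telescope around a cycle, so a cycle whose color is nonzero modulo
  \<open>q\<close> excludes balance.\<close>

lemma balanced_cycle_colsum:
  assumes u: "u permutes V" and q: "q dvd int m" and balanced: "balanced q \<theta> (elt_of u b)" and C: "C \<in> cycles n u"
  shows "q dvd (\<Sum>k\<in>C. b k)"
proof -
  have CV: "C \<subseteq> V" using partition_onD1[OF partition_cycles[OF u]] C by auto
  have "u ` C \<subseteq> C" using C cycle_of_step by (auto simp: cycles_def)
  then have "bij_betw u C C"
    using CV permutes_inj_on[OF u] finite_subset[OF CV]
    by (simp add: bij_betw_def endo_inj_surj)
  then have s: "(\<Sum>k\<in>C. \<theta> (u k)) = (\<Sum>k\<in>C. \<theta> k)" by (rule sum.reindex_bij_betw)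
  have "[(\<Sum>k\<in>C. b k) = (\<Sum>k\<in>C. \<theta> (u k) - \<theta> k)] (mod q)"
    using balanced CV unfolding balanced_elt_of[OF q] by (intro cong_sum) auto
  then show ?thesis using s by (simp add: sum_subtractf cong_0_iff)
qed

text \<open>Along a cycle the colors prescribe the increments of any balancing potential, so two
  such potentials differ by a constant there. This makes the condition on \<open>T\<close>
  independent of the factorization.\<close>

lemma balanced_same_gain:
  assumes u: "u permutes V" and q: "q dvd int m"
    and balanced: "balanced q \<theta> (elt_of u b)" "balanced q \<theta>' (elt_of u b)"
  shows "same_gain q (cycles n u) \<theta> \<theta>'"
  unfolding same_gain_def
proof (intro ballI)
  fix C i j assume C: "C \<in> cycles n u" "i \<in> C" "j \<in> C"
  obtain x where x: "C = cycle_of u x" "x < n" using C by (auto simp: cycles_def)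
  have "C \<subseteq> {z. z < n \<and> [\<theta>' z - \<theta> z = \<theta>' x - \<theta> x] (mod q)}"
    unfolding x(1)
  proof (rule cycle_of_subset)
    fix z assume z: "z \<in> {z. z < n \<and> [\<theta>' z - \<theta> z = \<theta>' x - \<theta> x] (mod q)}"
    have 1: "[\<theta>' (u z) - \<theta>' z = b z] (mod q)" and 2: "[\<theta> (u z) - \<theta> z = b z] (mod q)"
      using balanced z unfolding balanced_elt_of[OF q] by (auto intro: cong_sym)
    have "[(\<theta>' (u z) - \<theta>' z) - (\<theta> (u z) - \<theta> z) + (\<theta>' z - \<theta> z) = b z - b z + (\<theta>' x - \<theta> x)] (mod q)"
      using z by (intro cong_add[OF cong_diff[OF 1 2]]) auto
    then show "u z \<in> {z. z < n \<and> [\<theta>' z - \<theta> z = \<theta>' x - \<theta> x] (mod q)}"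
      using z permutes_less[OF u] by (simp add: algebra_simps)
  qed (use x in simp)
  then have 1: "[\<theta>' j - \<theta> j = \<theta>' x - \<theta> x] (mod q)" and 2: "[\<theta>' i - \<theta> i = \<theta>' x - \<theta> x] (mod q)"
    using C by auto
  have "[(\<theta>' j - \<theta> j) - (\<theta>' i - \<theta> i) + (\<theta> j - \<theta> i) = (\<theta>' x - \<theta> x) - (\<theta>' x - \<theta> x) + (\<theta> j - \<theta> i)] (mod q)"
    by (rule cong_add[OF cong_diff[OF 1 2] cong_refl])
  then show "[\<theta>' j - \<theta>' i = \<theta> j - \<theta> i] (mod q)" by (simp add: algebra_simps)
qed

lemma balanced_of_same_gain:
  assumes P: "partition_on V P" and t: "\<And>B. B \<in> P \<Longrightarrow> preserves B t" "balanced q \<theta> t"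
    and same_gain: "same_gain q P \<theta> \<theta>'"
  shows "balanced q \<theta>' t"
  unfolding balanced_def
proof (intro allI impI)
  fix k assume k: "k < n"
  then obtain B where B: "B \<in> P" "k \<in> B" using partition_on_block[OF P] by blast
  then have "fst t k \<in> B" using t(1) by (simp add: preserves_def)
  then have "[\<theta>' (fst t k) - \<theta>' k = \<theta> (fst t k) - \<theta> k] (mod q)" using same_gain B by (auto simp: same_gain_def)
  then show "[int (snd t k) = \<theta>' (fst t k) - \<theta>' k] (mod q)"
    using t(2) k unfolding balanced_def by (metis cong_sym cong_trans)
qed


lemma Gmult_one: "x \<in> Gcarrier m 1 n \<Longrightarrow> Gmult m n x (elt_of id (\<lambda>_. 0)) = x"
  using monoid.r_one[OF group.is_monoid[OF group_G[OF one_dvd]], of x] by simp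

lemma cycle_nonzero_unique:
  assumes u: "u permutes V" and r: "\<And>C. C \<in> cycles n u \<Longrightarrow> r C \<in> C"
    and "C \<in> cycles n u" "C' \<in> cycles n u" "r C = r C'"
  shows "C = C'"
  using partition_on_disjoint[OF partition_cycles[OF u] assms(3,4), of "r C"] assms by metis

text \<open>Cycles outside \<open>D\<close> have color 0, so the diagonal remainder may be replaced
  by any \<open>e\<close> that has the right colors modulo \<open>m\<close> at the representatives
  of \<open>D\<close> and vanishes elsewhere.\<close>

lemma cycle_factorization_support:
  assumes u: "u permutes V" and D: "D \<subseteq> cycles n u"
    and zero: "\<And>C. C \<in> cycles n u - D \<Longrightarrow> int m dvd (\<Sum>k\<in>C. b k)"
  obtains fs r where "set fs \<subseteq> edges" "length fs + card (cycles n u) = n"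
    "\<forall>C\<in>D. r C \<in> C"
    "\<forall>e. (\<forall>C\<in>D. [e (r C) = (\<Sum>k\<in>C. b k)] (mod int m)) \<longrightarrow>
       (\<forall>k<n. k \<notin> r ` D \<longrightarrow> e k = 0) \<longrightarrow> elt_of u b = Gmult m n (prod_elts fs) (elt_of id e)"
proof -
  obtain fs r d where fs: "set fs \<subseteq> edges" "length fs + card (cycles n u) = n"
    "elt_of u b = Gmult m n (prod_elts fs) (elt_of id d)"
    "\<And>C. C \<in> cycles n u \<Longrightarrow> r C \<in> C" "\<And>C. C \<in> cycles n u \<Longrightarrow> d (r C) = (\<Sum>k\<in>C. b k)"
    "\<And>k. k < n \<Longrightarrow> k \<notin> r ` cycles n u \<Longrightarrow> d k = 0"
    using cycles_factorization[OF u, of b] by metis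
  show thesis
  proof (rule that[OF fs(1,2)]; intro ballI allI impI)
    show "r C \<in> C" if "C \<in> D" for C using fs(4) D that by blast
    fix e assume e: "\<forall>C\<in>D. [e (r C) = (\<Sum>k\<in>C. b k)] (mod int m)"
      "\<forall>k<n. k \<notin> r ` D \<longrightarrow> e k = 0"
    have "elt_of id d = elt_of id e"
    proof (rule elt_of_cong)
      fix k assume k: "k < n"
      consider "k \<notin> r ` cycles n u" | C where "C \<in> D" "k = r C" | C where "C \<in> cycles n u - D" "k = r C"
        by blast
      then show "[d k = e k] (mod int m)"
      proof cases
        case 1
        then show ?thesis using fs(6)[OF k 1] e(2) k D by (metis cong_refl image_mono subsetD)
      next
        case (2 C)
        then have "C \<in> cycles n u" using D by auto
        then show ?thesis using fs(5)[of C] e(1) 2 by (simp add: cong_sym)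
      next
        case (3 C)
        have "k \<notin> r ` D"
        proof
          assume "k \<in> r ` D"
          then obtain C' where "C' \<in> D" "r C = r C'" using 3 by auto
          then show False using cycle_nonzero_unique[OF u fs(4), of C C'] 3 D by auto
        qed
        then show ?thesis using fs(5)[of C] 3 zero[of C] e(2) k by (simp add: cong_0_iff)
      qed
    qed
    then show "elt_of u b = Gmult m n (prod_elts fs) (elt_of id e)" using fs(3) by simp
  qed
qed

lemma zero_colored_factorization:
  assumes u: "u permutes V" and zero: "\<And>C. C \<in> cycles n u \<Longrightarrow> int m dvd (\<Sum>k\<in>C. b k)"
  obtains fs where "set fs \<subseteq> edges" "length fs + card (cycles n u) = n" "prod_elts fs = elt_of u b"
proof -
  have z: "int m dvd (\<Sum>k\<in>C. b k)" if "C \<in> cycles n u - {}" for C using zero that by simp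
  obtain fs r where fs: "set fs \<subseteq> edges" "length fs + card (cycles n u) = n" "\<forall>C\<in>{}. r C \<in> C"
    "\<forall>e. (\<forall>C\<in>{}. [e (r C) = (\<Sum>k\<in>C. b k)] (mod int m)) \<longrightarrow>
       (\<forall>k<n. k \<notin> r ` {} \<longrightarrow> e k = 0) \<longrightarrow> elt_of u b = Gmult m n (prod_elts fs) (elt_of id e)"
    by (rule cycle_factorization_support[OF u empty_subsetI z])
  have "prod_elts fs \<in> Gcarrier m 1 n" using prod_elts_in fs(1) edges_subset[of 1] by auto
  then have "prod_elts fs = elt_of u b" using fs(4)[THEN spec[of _ "\<lambda>_. 0"]] Gmult_one by simp
  then show thesis using that fs by blast
qed

text \<open>The cycles refine the components, and \<open>n\<close> is at most the number of
  components plus the number of distinct edges. Equality therefore makes the components the cycles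
  themselves and the edges a forest, which can be balanced.\<close>

lemma factorization_length:
  assumes u: "u permutes V" and fs: "set fs \<subseteq> edges \<union> diags" "prod_elts fs = elt_of u b"
  shows "n \<le> card (cycles n u) + card (set fs \<inter> edges)"
    and "n = card (cycles n u) + card (set fs \<inter> edges) \<Longrightarrow>
      (\<forall>f\<in>set fs. \<forall>B\<in>cycles n u. preserves B f) \<and> (\<exists>\<theta>. \<forall>f\<in>set fs \<inter> edges. balanced (int m) \<theta> f)"
proof -
  note P = partition_cycles[OF u]
  obtain Q where Q: "partition_on V Q" "\<forall>f\<in>set fs. \<forall>B\<in>Q. preserves B f"
    "\<forall>C\<in>cycles n u. \<exists>B\<in>Q. C \<subseteq> B" "n \<le> card Q + card (set fs \<inter> edges)"
    "n = card Q + card (set fs \<inter> edges) \<longrightarrow> (\<exists>\<theta>. \<forall>f\<in>set fs \<inter> edges. balanced (int m) \<theta> f)"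
    by (rule components_of_factorization[OF fs u])
  note coarse = coarser_partition[OF P finite_partition[OF P] Q(1) bspec[OF Q(3)]]
  show "n \<le> card (cycles n u) + card (set fs \<inter> edges)" using Q(4) coarse(1) by linarith
  assume n: "n = card (cycles n u) + card (set fs \<inter> edges)"
  then have "Q = cycles n u" using Q(4) coarse by linarith
  then show "(\<forall>f\<in>set fs. \<forall>B\<in>cycles n u. preserves B f) \<and> (\<exists>\<theta>. \<forall>f\<in>set fs \<inter> edges. balanced (int m) \<theta> f)"
    using Q(2,5) n by blast
qed

lemma card_set_Int_le: "card (set fs \<inter> X) \<le> length fs"
  by (metis card_length card_mono finite_set inf_le1 order_trans)

lemma subset_of_card_Int: "length fs \<le> card (set fs \<inter> X) \<Longrightarrow> set fs \<subseteq> X"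
  by (metis card_length card_seteq finite_set inf_le1 inf_le2 order_trans)

lemma cycles_nonempty: "u permutes V \<Longrightarrow> 0 < card (cycles n u)"
  using partition_cycles partition_nonempty finite_partition card_gt_0_iff by blast

lemma preserves_prod_elts_cycles:
  assumes "set fs \<subseteq> edges \<union> diags" "prod_elts fs = elt_of u b" "\<And>x. x \<in> set fs \<Longrightarrow> preserves A x"
  shows "\<forall>B\<in>cycles n u. B \<subseteq> A \<or> B \<inter> A = {}"
proof -
  have "preserves A (elt_of u b)" unfolding assms(2)[symmetric] by (rule prod_elts_preserves[OF assms(1,3)])
  then show ?thesis using preserves_union_of_cycles by blast
qed

lemma gcd_gt_1: "\<not> coprime c (int m) \<Longrightarrow> 1 < gcd c (int m)"
proof -
  assume "\<not> coprime c (int m)"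
  moreover have "0 < gcd c (int m)" using m_pos by simp
  moreover have "gcd c (int m) \<noteq> 1" using \<open>\<not> coprime c (int m)\<close> by (simp add: coprime_iff_gcd_eq_1)
  ultimately show ?thesis by linarith
qed

lemma coprime_not_dvd: "coprime c (int m) \<Longrightarrow> 1 < q \<Longrightarrow> q dvd int m \<Longrightarrow> \<not> q dvd c"
  using coprime_common_divisor[of c "int m" q] by (auto simp: zdvd1_eq)

lemma m_gt_1: "1 < int m" using m2 by simp

lemma preserves_V_Refl: "x \<in> edges \<union> diags \<Longrightarrow> preserves V x"
  using edges_diags_subset preserves_V[of x 1] by auto

section \<open>The sets \<open>RGS\<close> in the four cases\<close>

definition unit_diags :: "elt set" where
  "unit_diags = {diag i c | i c. i < n \<and> coprime c (int m)}"

lemma unit_diags_subset: "unit_diags \<subseteq> diags"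
  using coprime_not_dvd[OF _ m_gt_1] by (fastforce simp: unit_diags_def diags_def)

lemma unit_diags_colsum:
  assumes "1 < q" "q dvd int m" "t \<in> unit_diags"
  shows "\<not> q dvd (\<Sum>k<n. int (snd t k))"
proof -
  obtain i c where t: "t = diag i c" "i < n" "coprime c (int m)" using assms(3) by (auto simp: unit_diags_def)
  then show ?thesis using colsum_diag[OF assms(2), of V i c] coprime_not_dvd[OF t(3) assms(1,2)] by simp
qed

text \<open>A reduced factorization consists of edges only and contributes no color, so
  \<open>T\<close> has to supply a diagonal. Its remaining members, one fewer than the cycles, are
  just enough to connect them.\<close>

lemma RGS_1_zero:
  assumes u: "u permutes V" and zero: "\<And>C. C \<in> cycles n u \<Longrightarrow> int m dvd (\<Sum>k\<in>C. b k)"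
  shows "RGS (G m 1 n) (edges \<union> diags) n (elt_of u b) = (\<lambda>(t, T). insert t T) ` (unit_diags \<times> spanning_trees (cycles n u))"
    (is "_ = ?S")
proof -
  let ?P = "cycles n u" and ?g = "elt_of u b"
  note P = partition_cycles[OF u]
  obtain fs0 where fs0: "set fs0 \<subseteq> edges" "length fs0 + card ?P = n" "prod_elts fs0 = ?g"
    by (rule zero_colored_factorization[OF u zero])
  show ?thesis
  proof (rule RGS_eqI[where r = "n - card ?P" and k = "card ?P"])
    show "\<exists>fs. set fs \<subseteq> edges \<union> diags \<and> length fs = n - card ?P \<and> prod_elts fs = ?g"
      using fs0 by (intro exI[of _ fs0]) auto
    show "n - card ?P + card ?P = n" using fs0(2) by simp
    show "n - card ?P \<le> length fs" if "set fs \<subseteq> edges \<union> diags" "prod_elts fs = ?g" for fs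
      using factorization_length(1)[OF u that] card_set_Int_le[of fs edges] by linarith
  next
    fix T fs
    assume T: "T \<subseteq> edges \<union> diags" "finite T" "card T \<le> card ?P" and fs: "set fs \<subseteq> edges \<union> diags"
      "length fs = n - card ?P" "prod_elts fs = ?g" and gen: "generate (G m 1 n) (T \<union> set fs) = Gcarrier m 1 n"
    have X: "T \<union> set fs \<subseteq> Gcarrier m 1 n" using T fs edges_diags_subset by auto
    have eq: "n = card ?P + card (set fs \<inter> edges)"
      using factorization_length(1)[OF u fs(1,3)] card_set_Int_le[of fs edges] fs(2) fs0(2) by linarith
    then have fsE: "set fs \<subseteq> edges" using fs(2) by (intro subset_of_card_Int) linarith
    have "connects ?P T"
      using connects_absorb[OF generate_imp_connects[OF one_dvd X gen] P] factorization_length(2)[OF u fs(1,3) eq] by blast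
    then have connects: "connects ?P (T \<inter> edges)" by (rule connects_Int_edges[OF T(1)])
    then have le: "card ?P \<le> Suc (card (T \<inter> edges))" using connects_card_le(1)[OF _ _ P] T(2) by simp
    have Esum: "q dvd (\<Sum>k<n. int (snd x k))" if "x \<in> edges" "q dvd int m" for x q
      using colsum_edges[OF that(1) _ that(2) subset_refl] edges_diags_subset preserves_V that(1) by blast
    obtain t where t: "t \<in> T" "t \<in> diags"
      using generate_imp_colsum[OF X gen m_gt_1 dvd_refl] Esum[OF _ dvd_refl] fsE T(1) by blast
    then have "t \<notin> edges" using edges_diags_disjoint by blast
    then have "card (insert t (T \<inter> edges)) = Suc (card (T \<inter> edges))" using T(2) by simp
    moreover have sub: "insert t (T \<inter> edges) \<subseteq> T" using t by auto
    ultimately have Teq: "insert t (T \<inter> edges) = T" using le T(2,3) by (intro card_seteq) auto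
    with T(2,3) le \<open>t \<notin> edges\<close> have "T \<inter> edges \<in> spanning_trees ?P"
      using \<open>card (insert t (T \<inter> edges)) = Suc (card (T \<inter> edges))\<close> connects by (simp add: spanning_trees_def)
    moreover have "t \<in> unit_diags"
    proof -
      obtain i c where tic: "t = diag i c" "i < n" using t by (auto simp: diags_def)
      \<comment> \<open>Otherwise the gcd of \<open>c\<close> and \<open>m\<close> would divide the
        total color of every generator: edges have total color 0 modulo \<open>m\<close>, and
        \<open>t\<close> is the only diagonal.\<close>
      have "coprime c (int m)"
      proof (rule ccontr)
        assume "\<not> coprime c (int m)"
        then have "1 < gcd c (int m)" by (rule gcd_gt_1)
        then obtain x where x: "x \<in> T \<union> set fs" "\<not> gcd c (int m) dvd (\<Sum>k<n. int (snd x k))"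
          using generate_imp_colsum[OF X gen] by (metis gcd_dvd2)
        then have "x \<notin> edges" using Esum[OF _ gcd_dvd2] by blast
        then have "x = t" using x(1) fsE Teq by blast
        then show False using x(2) colsum_diag[OF gcd_dvd2, of V i c c] tic by simp
      qed
      then show ?thesis using tic by (auto simp: unit_diags_def)
    qed
    ultimately show "T \<in> ?S" using Teq by (intro image_eqI[of _ _ "(t, T \<inter> edges)"]) auto
  next
    fix T assume "T \<in> ?S"
    then obtain t T' where T: "T = insert t T'" "t \<in> unit_diags" "T' \<in> spanning_trees ?P" by auto
    then have T': "T' \<subseteq> edges" "Suc (card T') = card ?P" "connects ?P T'" "finite T'"
      using finite_edges_subset by (auto simp: spanning_trees_def)
    have "t \<notin> T'" using T' T unit_diags_subset edges_diags_disjoint by blast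
    then show "T \<subseteq> edges \<union> diags \<and> finite T \<and> card T = card ?P" using T T' unit_diags_subset by auto
    fix fs assume fs: "set fs \<subseteq> edges \<union> diags" "length fs = n - card ?P" "prod_elts fs = ?g"
    show "generate (G m 1 n) (T \<union> set fs) = Gcarrier m 1 n"
    proof (rule generate_edges_diags_eq)
      show "T \<union> set fs \<subseteq> edges \<union> diags" using T T' unit_diags_subset fs by auto
      show "connects {} (T \<union> set fs)"
        by (rule connects_expand[OF T'(3)]) (use T preserves_prod_elts_cycles[OF fs(1,3)] in auto)
      show "\<exists>x\<in>T \<union> set fs. \<not> q dvd (\<Sum>k<n. int (snd x k))" if "1 < q" "q dvd int m" for q
        using unit_diags_colsum[OF that T(2)] T(1) by auto
    qed
  qed
qed

text \<open>Edges have total color 0, so the unit color of \<open>D\<close> forces a diagonal into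
  every factorization. That costs one factor more and leaves \<open>T\<close> only the size of a
  spanning tree.\<close>

lemma RGS_1_unit:
  assumes u: "u permutes V" and D: "D \<in> cycles n u" "coprime (\<Sum>k\<in>D. b k) (int m)"
    and zero: "\<And>C. C \<in> cycles n u - {D} \<Longrightarrow> int m dvd (\<Sum>k\<in>C. b k)"
  shows "RGS (G m 1 n) (edges \<union> diags) n (elt_of u b) = spanning_trees (cycles n u)"
proof -
  let ?P = "cycles n u" and ?g = "elt_of u b" and ?c = "\<Sum>k\<in>D. b k"
  note P = partition_cycles[OF u]
  have DV: "C \<subseteq> V" if "C \<in> ?P" for C using partition_onD1[OF P] that by auto
  have tot: "[(\<Sum>k<n. b k) = ?c] (mod int m)"
  proof -
    have "{C \<in> {D}. C \<subseteq> V} = {D}" using DV D(1) by auto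
    moreover have "[(\<Sum>k<n. b k) = (\<Sum>C\<in>{C \<in> {D}. C \<subseteq> V}. \<Sum>k\<in>C. b k)] (mod int m)"
      by (rule colsum_colored_cycles[OF u subset_refl _ _ zero]) (use DV D(1) in auto)
    ultimately show ?thesis by simp
  qed
  have DP: "{D} \<subseteq> ?P" using D(1) by simp
  obtain fs r where fs': "set fs \<subseteq> edges" "length fs + card ?P = n" "\<forall>C\<in>{D}. r C \<in> C"
    "\<forall>e. (\<forall>C\<in>{D}. [e (r C) = (\<Sum>k\<in>C. b k)] (mod int m)) \<longrightarrow>
       (\<forall>k<n. k \<notin> r ` {D} \<longrightarrow> e k = 0) \<longrightarrow> ?g = Gmult m n (prod_elts fs) (elt_of id e)"
    by (rule cycle_factorization_support[OF u DP zero])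
  have fs: "set fs \<subseteq> edges" "length fs + card ?P = n" "r D \<in> D"
    "\<And>e. [e (r D) = ?c] (mod int m) \<Longrightarrow> (\<And>k. k < n \<Longrightarrow> k \<noteq> r D \<Longrightarrow> e k = 0) \<Longrightarrow>
       ?g = Gmult m n (prod_elts fs) (elt_of id e)"
    using fs' by auto
  \<comment> \<open>A single diagonal at the representative of \<open>D\<close> carries the whole
    color that the edges leave over.\<close>
  define t where "t = diag (r D) ?c"
  have rn: "r D < n" using fs(3) DV[OF D(1)] by auto
  have t: "t \<in> diags" using rn coprime_not_dvd[OF D(2) m_gt_1] by (auto simp: diags_def t_def)
  have "?g = Gmult m n (prod_elts fs) t" unfolding t_def diag_def by (rule fs(4)) auto
  also have "t = prod_elts [t]" using Gmult_one[of t] t diags_subset by auto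
  also have "Gmult m n (prod_elts fs) (prod_elts [t]) = prod_elts (fs @ [t])"
    by (rule prod_elts_append[symmetric]) (use fs(1) t edges_diags_subset in auto)
  finally have fst: "prod_elts (fs @ [t]) = ?g" ..
  have has_diag: "card (set fs \<inter> edges) < length fs" if "set fs \<subseteq> edges \<union> diags" "prod_elts fs = ?g" for fs
  proof (rule ccontr)
    assume "\<not> card (set fs \<inter> edges) < length fs"
    then have E: "set fs \<subseteq> edges" by (intro subset_of_card_Int) simp
    have "int m dvd (\<Sum>k<n. b k)"
      by (rule prod_elts_edges_colsum[OF E dvd_refl subset_refl _ that(2)]) (use E preserves_V_Refl in auto)
    then show False using tot coprime_not_dvd[OF D(2) m_gt_1 dvd_refl] cong_dvd_iff by blast
  qed
  have k: "0 < card ?P" by (rule cycles_nonempty[OF u])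
  show ?thesis
  proof (rule RGS_eqI[where r = "n - (card ?P - 1)" and k = "card ?P - 1"])
    show "\<exists>fs. set fs \<subseteq> edges \<union> diags \<and> length fs = n - (card ?P - 1) \<and> prod_elts fs = ?g"
      using fs fst t k by (intro exI[of _ "fs @ [t]"]) auto
    show "n - (card ?P - 1) + (card ?P - 1) = n" using fs(2) by simp
    show "n - (card ?P - 1) \<le> length fs" if "set fs \<subseteq> edges \<union> diags" "prod_elts fs = ?g" for fs
      using factorization_length(1)[OF u that] has_diag[OF that] k by linarith
  next
    fix T fs
    assume T: "T \<subseteq> edges \<union> diags" "finite T" "card T \<le> card ?P - 1" and fs': "set fs \<subseteq> edges \<union> diags"
      "length fs = n - (card ?P - 1)" "prod_elts fs = ?g" and gen: "generate (G m 1 n) (T \<union> set fs) = Gcarrier m 1 n"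
    have X: "T \<union> set fs \<subseteq> Gcarrier m 1 n" using T fs' edges_diags_subset by auto
    have "card (set fs \<inter> edges) < length fs" by (rule has_diag[OF fs'(1,3)])
    then have eq: "n = card ?P + card (set fs \<inter> edges)"
      using factorization_length(1)[OF u fs'(1,3)] fs'(2) fs(2) k by linarith
    have "connects ?P T"
      using connects_absorb[OF generate_imp_connects[OF one_dvd X gen] P] factorization_length(2)[OF u fs'(1,3) eq] by blast
    then have connects: "connects ?P (T \<inter> edges)" by (rule connects_Int_edges[OF T(1)])
    then have le: "card ?P \<le> Suc (card (T \<inter> edges))" using connects_card_le(1)[OF _ _ P] T(2) by simp
    then have "T \<inter> edges = T" using T(2,3) by (intro card_seteq) auto
    then show "T \<in> spanning_trees ?P" using connects le T(3) k by (auto simp: spanning_trees_def)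
  next
    fix T assume "T \<in> spanning_trees ?P"
    then have T: "T \<subseteq> edges" "Suc (card T) = card ?P" "connects ?P T" "finite T"
      using finite_edges_subset by (auto simp: spanning_trees_def)
    then show "T \<subseteq> edges \<union> diags \<and> finite T \<and> card T = card ?P - 1" by auto
    fix fs assume fs': "set fs \<subseteq> edges \<union> diags" "length fs = n - (card ?P - 1)" "prod_elts fs = ?g"
    show "generate (G m 1 n) (T \<union> set fs) = Gcarrier m 1 n"
    proof (rule generate_edges_diags_eq)
      show "T \<union> set fs \<subseteq> edges \<union> diags" using T fs' by auto
      show "connects {} (T \<union> set fs)"
        by (rule connects_expand[OF T(3)]) (use preserves_prod_elts_cycles[OF fs'(1,3)] in auto)
      fix q assume q: "1 < q" "q dvd int m"
      \<comment> \<open>The color comes from the factorization: if \<open>q\<close> divided the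
        total color of each factor, it would divide that of \<open>g\<close>, which is a
        unit.\<close>
      show "\<exists>x\<in>T \<union> set fs. \<not> q dvd (\<Sum>k<n. int (snd x k))"
      proof (rule ccontr)
        assume "\<not> (\<exists>x\<in>T \<union> set fs. \<not> q dvd (\<Sum>k<n. int (snd x k)))"
        then have col: "q dvd (\<Sum>k<n. int (snd f k))" if "f \<in> set fs" for f using that by blast
        have "q dvd (\<Sum>k<n. int (snd (prod_elts fs) k))"
          by (rule prod_elts_colsum[OF fs'(1) q(2) subset_refl _ col]) (use fs'(1) preserves_V_Refl in auto)
        then have "q dvd (\<Sum>k<n. b k)" using colsum_elt_of[OF q(2) subset_refl] fs'(3) by simp
        then have "q dvd ?c" using cong_dvd_iff[OF cong_dvd_modulus[OF tot q(2)]] by simp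
        then show False using coprime_not_dvd[OF D(2) q] by simp
      qed
    qed
  qed
qed

text \<open>The potential is found by one reduced factorization but enters only through
  \<open>g\<close>: every potential that balances \<open>g\<close> has the same gains on the cycles.
  So one \<open>\<theta>\<close> serves all reduced factorizations.\<close>

lemma RGS_m_zero:
  assumes u: "u permutes V" and zero: "\<And>C. C \<in> cycles n u \<Longrightarrow> int m dvd (\<Sum>k\<in>C. b k)"
  obtains \<theta> where "RGS (G m m n) edges n (elt_of u b) = unicyclic_sets (cycles n u) \<theta>"
proof -
  let ?P = "cycles n u" and ?g = "elt_of u b"
  note P = partition_cycles[OF u]
  obtain fs0 where fs0: "set fs0 \<subseteq> edges" "length fs0 + card ?P = n" "prod_elts fs0 = ?g"
    by (rule zero_colored_factorization[OF u zero])
  have reduced: "(\<forall>f\<in>set fs. \<forall>B\<in>?P. preserves B f) \<and> (\<exists>\<theta>. (\<forall>f\<in>set fs. balanced (int m) \<theta> f) \<and> balanced (int m) \<theta> ?g)"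
    if fs: "set fs \<subseteq> edges" "length fs = n - card ?P" "prod_elts fs = ?g" for fs
  proof -
    have fs': "set fs \<subseteq> edges \<union> diags" and E: "set fs \<inter> edges = set fs" using fs(1) by auto
    have eq: "n = card ?P + card (set fs \<inter> edges)"
      using factorization_length(1)[OF u fs' fs(3)] card_set_Int_le[of fs edges] fs(2) fs0(2) by linarith
    from factorization_length(2)[OF u fs' fs(3) eq]
    obtain \<theta> where 1: "\<forall>f\<in>set fs. \<forall>B\<in>?P. preserves B f" "\<forall>f\<in>set fs. balanced (int m) \<theta> f" unfolding E by blast
    moreover have "balanced (int m) \<theta> (prod_elts fs)" by (rule prod_elts_balanced[OF fs']) (use 1 in auto)
    ultimately show ?thesis using fs(3) by auto
  qed
  obtain \<theta> where \<theta>: "balanced (int m) \<theta> ?g" using reduced[OF fs0(1) _ fs0(3)] fs0(2) by (metis add_diff_cancel_right')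
  have k: "0 < card ?P" by (rule cycles_nonempty[OF u])
  show thesis
  proof (rule that[of \<theta>], rule RGS_eqI[where r = "n - card ?P" and k = "card ?P"])
    show "\<exists>fs. set fs \<subseteq> edges \<and> length fs = n - card ?P \<and> prod_elts fs = ?g"
      using fs0 by (intro exI[of _ fs0]) auto
    show "n - card ?P + card ?P = n" using fs0(2) by simp
    show "n - card ?P \<le> length fs" if "set fs \<subseteq> edges" "prod_elts fs = ?g" for fs
      using factorization_length(1)[OF u _ that(2)] that(1) card_set_Int_le[of fs edges] by fastforce
  next
    fix T fs
    assume T: "T \<subseteq> edges" "finite T" "card T \<le> card ?P" "T = {} \<Longrightarrow> card ?P = 0" and fs: "set fs \<subseteq> edges"
      "length fs = n - card ?P" "prod_elts fs = ?g" and gen: "generate (G m m n) (T \<union> set fs) = Gcarrier m m n"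
    have X: "T \<union> set fs \<subseteq> Gcarrier m m n" using T fs edges_subset[of m] by auto
    \<comment> \<open>There is at least one cycle, so \<open>T\<close> contains an edge, and an edge
      has two distinct endpoints.\<close>
    have "T \<noteq> {}" using T(4) k by auto
    then have n: "2 \<le> n" using T(1) by (force elim: EdE)
    obtain \<theta>F where F: "\<forall>f\<in>set fs. \<forall>B\<in>?P. preserves B f" "\<forall>f\<in>set fs. balanced (int m) \<theta>F f" "balanced (int m) \<theta>F ?g"
      using reduced[OF fs] by blast
    have connects: "connects ?P T"
      using connects_absorb[OF generate_imp_connects[OF dvd_refl X gen] P] F(1) by blast
    have unbalanced: "unbalanced ?P \<theta> T"
      unfolding unbalanced_def
    proof (intro conjI allI impI connects)
      fix q \<theta>' assume q: "1 < q" "q dvd int m" "same_gain q ?P \<theta> \<theta>'"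
      \<comment> \<open>Passes from the potential \<open>\<theta>F\<close> of the present
        factorization to the fixed \<open>\<theta>\<close>: both balance \<open>g\<close>.\<close>
      have "same_gain (int m) ?P \<theta>F \<theta>" by (rule balanced_same_gain[OF u dvd_refl F(3) \<theta>])
      then have "same_gain q ?P \<theta>F \<theta>" using same_gain_dvd q(2) by blast
      then have "same_gain q ?P \<theta>F \<theta>'" using same_gain_trans q(3) by blast
      then have "balanced q \<theta>' f" if "f \<in> set fs" for f
        using balanced_of_same_gain[OF P _ balanced_dvd[OF _ q(2)]] F that by blast
      then show "\<exists>t\<in>T. \<not> balanced q \<theta>' t" using generate_imp_unbalanced[OF X gen n q(1,2), of \<theta>'] by blast
    qed
    then have "card T = card ?P" using unbalanced_card_le[OF T(2,1) P] T(3) by simp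
    then show "T \<in> unicyclic_sets ?P \<theta>" using T(1) unbalanced by (simp add: unicyclic_sets_def)
  next
    fix T assume "T \<in> unicyclic_sets ?P \<theta>"
    then have T: "T \<subseteq> edges" "card T = card ?P" "unbalanced ?P \<theta> T" "finite T"
      using finite_edges_subset by (auto simp: unicyclic_sets_def)
    then show "T \<subseteq> edges \<and> finite T \<and> card T = card ?P" by auto
    fix fs assume fs: "set fs \<subseteq> edges" "length fs = n - card ?P" "prod_elts fs = ?g"
    have fs': "set fs \<subseteq> edges \<union> diags" using fs by auto
    show "generate (G m m n) (T \<union> set fs) = Gcarrier m m n"
    proof (rule generate_edges_eq)
      show "T \<union> set fs \<subseteq> edges" using T fs by auto
      show "connects {} (T \<union> set fs)"
        by (rule connects_expand[of ?P T]) (use T(3) preserves_prod_elts_cycles[OF fs' fs(3)] in \<open>auto simp: unbalanced_def\<close>)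
      fix q \<theta>' assume q: "1 < q" "q dvd int m"
      show "\<exists>x\<in>T \<union> set fs. \<not> balanced q \<theta>' x"
      proof (rule ccontr)
        assume balanced: "\<not> (\<exists>x\<in>T \<union> set fs. \<not> balanced q \<theta>' x)"
        then have "balanced q \<theta>' ?g" using prod_elts_balanced[OF fs' q(2), of \<theta>'] fs(3) by auto
        then have "same_gain q ?P \<theta> \<theta>'" by (rule balanced_same_gain[OF u q(2) balanced_dvd[OF \<theta> q(2)]])
        then show False using T(3) q balanced unfolding unbalanced_def by blast
      qed
    qed
  qed
qed

text \<open>A set preserved by edge factors has color 0, so it contains both of \<open>D1\<close>
  and \<open>D2\<close> or neither. Moreover a unit color excludes balance modulo every
  \<open>q\<close>, so the factors cannot form a forest. This costs one edge more, and in return the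
  factorization provides all the imbalance that generation requires.\<close>

lemma RGS_m_unit:
  assumes u: "u permutes V" and D: "D1 \<in> cycles n u" "D2 \<in> cycles n u" "D1 \<noteq> D2"
    and color: "int m dvd (\<Sum>k\<in>D1. b k) + (\<Sum>k\<in>D2. b k)" "coprime (\<Sum>k\<in>D1. b k) (int m)"
    and zero: "\<And>C. C \<in> cycles n u - {D1, D2} \<Longrightarrow> int m dvd (\<Sum>k\<in>C. b k)"
  shows "RGS (G m m n) edges n (elt_of u b) = spanning_trees (merge (cycles n u) D1 D2)"
proof -
  let ?K = "cycles n u" and ?g = "elt_of u b" and ?c = "\<Sum>k\<in>D1. b k"
  let ?P = "merge ?K D1 D2"
  note K = partition_cycles[OF u]
  have P: "partition_on V ?P" by (rule partition_on_merge[OF K D])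
  have cP: "Suc (card ?P) = card ?K" by (rule card_merge[OF K finite_partition[OF K] D])
  have KV: "C \<subseteq> V" if "C \<in> ?K" for C using partition_onD1[OF K] that by auto
  have c2: "\<not> int m dvd (\<Sum>k\<in>D2. b k)" and c1: "\<not> int m dvd ?c"
    using color(1) coprime_not_dvd[OF color(2) m_gt_1 dvd_refl] by (auto simp: dvd_add_left_iff)
  have together: "\<forall>B\<in>?P. B \<subseteq> A \<or> B \<inter> A = {}"
    if fs: "set fs \<subseteq> edges" "prod_elts fs = ?g" and A: "A \<subseteq> V" "\<And>x. x \<in> set fs \<Longrightarrow> preserves A x" for fs A
  proof -
    have fs': "set fs \<subseteq> edges \<union> diags" using fs by auto
    have cyc: "\<forall>B\<in>?K. B \<subseteq> A \<or> B \<inter> A = {}" by (rule preserves_prod_elts_cycles[OF fs' fs(2) A(2)])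
    have "int m dvd (\<Sum>k\<in>A. b k)" by (rule prod_elts_edges_colsum[OF fs(1) dvd_refl A fs(2)])
    moreover have "[(\<Sum>k\<in>A. b k) = (\<Sum>C\<in>{C \<in> {D1, D2}. C \<subseteq> A}. \<Sum>k\<in>C. b k)] (mod int m)"
      by (rule colsum_colored_cycles[OF u A(1) _ _ zero]) (use cyc D in auto)
    ultimately have s: "int m dvd (\<Sum>C\<in>{C \<in> {D1, D2}. C \<subseteq> A}. \<Sum>k\<in>C. b k)" using cong_dvd_iff by blast
    have iff: "D1 \<subseteq> A \<longleftrightarrow> D2 \<subseteq> A"
    proof (rule ccontr)
      assume "\<not> (D1 \<subseteq> A \<longleftrightarrow> D2 \<subseteq> A)"
      then have "{C \<in> {D1, D2}. C \<subseteq> A} = {D1} \<or> {C \<in> {D1, D2}. C \<subseteq> A} = {D2}" by auto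
      then show False using s c1 c2 by auto
    qed
    have "D1 \<union> D2 \<subseteq> A \<or> (D1 \<union> D2) \<inter> A = {}" using iff cyc D by blast
    then show ?thesis using cyc by (simp add: merge_def)
  qed
  have not_balanced: "\<not> (\<forall>f\<in>set fs. balanced q \<theta> f)" if fs: "set fs \<subseteq> edges" "prod_elts fs = ?g" and q: "1 < q" "q dvd int m" for fs q \<theta>
  proof
    assume "\<forall>f\<in>set fs. balanced q \<theta> f"
    then have "balanced q \<theta> ?g" using prod_elts_balanced[of fs q \<theta>] fs q(2) by auto
    then have "q dvd ?c" by (rule balanced_cycle_colsum[OF u q(2) _ D(1)])
    then show False using coprime_not_dvd[OF color(2) q] by simp
  qed
  have len: "n + 1 \<le> card ?P + card (set fs) \<and> (n + 1 = card ?P + card (set fs) \<longrightarrow> (\<forall>f\<in>set fs. \<forall>B\<in>?P. preserves B f))"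
    if fs: "set fs \<subseteq> edges" "prod_elts fs = ?g" for fs
  proof -
    have fs': "set fs \<subseteq> edges \<union> diags" and E: "set fs \<inter> edges = set fs" using fs(1) by auto
    obtain Q where Q: "partition_on V Q" "\<forall>f\<in>set fs. \<forall>B\<in>Q. preserves B f"
      "\<forall>C\<in>?K. \<exists>B\<in>Q. C \<subseteq> B" "n \<le> card Q + card (set fs)"
      "n = card Q + card (set fs) \<longrightarrow> (\<exists>\<theta>. \<forall>f\<in>set fs. balanced (int m) \<theta> f)"
      by (rule components_of_factorization[OF fs' fs(2) u, unfolded E])
    have "\<exists>B\<in>Q. C \<subseteq> B" if C: "C \<in> ?P" for C
    proof -
      obtain x where x: "x \<in> C" using partition_onD3[OF P] C by (metis ex_in_conv)
      have "x \<in> V" using partition_onD1[OF P] C x by auto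
      then obtain B where B: "B \<in> Q" "x \<in> B" by (rule partition_on_block[OF Q(1)])
      have "B \<subseteq> V" using partition_onD1[OF Q(1)] B by auto
      then have "\<forall>B'\<in>?P. B' \<subseteq> B \<or> B' \<inter> B = {}" using together[OF fs] Q(2) B(1) by simp
      then have "C \<subseteq> B" using C x B(2) by auto
      with B(1) show ?thesis by blast
    qed
    note coarse = coarser_partition[OF P finite_partition[OF P] Q(1) this]
    \<comment> \<open>Equality would make the factors a forest, hence balanced modulo
      \<open>m\<close>.\<close>
    have "n \<noteq> card Q + card (set fs)" using Q(5) not_balanced[OF fs m_gt_1 dvd_refl] by blast
    then have n: "n + 1 \<le> card Q + card (set fs)" using Q(4) by linarith
    moreover have "\<forall>f\<in>set fs. \<forall>B\<in>?P. preserves B f" if "n + 1 = card ?P + card (set fs)"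
    proof -
      have "Q = ?P" using n that coarse by linarith
      then show ?thesis using Q(2) by blast
    qed
    ultimately show ?thesis using coarse(1) by auto
  qed
  have DK: "{D1, D2} \<subseteq> ?K" using D by simp
  obtain fs r where fs: "set fs \<subseteq> edges" "length fs + card ?K = n" "\<forall>C\<in>{D1, D2}. r C \<in> C"
    "\<forall>e. (\<forall>C\<in>{D1, D2}. [e (r C) = (\<Sum>k\<in>C. b k)] (mod int m)) \<longrightarrow>
       (\<forall>k<n. k \<notin> r ` {D1, D2} \<longrightarrow> e k = 0) \<longrightarrow> ?g = Gmult m n (prod_elts fs) (elt_of id e)"
    by (rule cycle_factorization_support[OF u DK zero])
  let ?x = "r D1" and ?y = "r D2"
  have in_D: "?x \<in> D1" "?y \<in> D2" using fs(3) by auto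
  have "?x \<noteq> ?y" using partition_on_disjoint[OF K D(1,2) in_D(1)] in_D(2) D(3) by auto
  then have xy: "?x < n" "?y < n" "?x \<noteq> ?y" using in_D KV D by auto
  let ?e = "\<lambda>k. if k = ?x then ?c else if k = ?y then - ?c else 0"
  \<comment> \<open>Two parallel edges between the representatives multiply to the diagonal matrix
    with colors \<open>?c\<close> and \<open>- ?c\<close>. As \<open>?K\<close> has one block more
    than \<open>?P\<close>, the total length becomes \<open>n + 1 - card ?P\<close>.\<close>
  define s where "s = [edge ?x ?y 0, edge ?x ?y ?c]"
  have s: "set s \<subseteq> edges" using xy by (auto simp: s_def intro: EdI)
  have "?g = Gmult m n (prod_elts fs) (elt_of id ?e)"
  proof (rule fs(4)[rule_format])
    have "[- ?c = (\<Sum>k\<in>D2. b k)] (mod int m)"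
      using color(1) by (metis cong_iff_dvd_diff dvd_minus_iff minus_add_distrib diff_conv_add_uminus)
    then show "[?e (r C) = (\<Sum>k\<in>C. b k)] (mod int m)" if "C \<in> {D1, D2}" for C using that xy by auto
  qed auto
  also have "elt_of id ?e = prod_elts s"
    using edge_edge_same[OF xy, of ?c] Gmult_one[of "edge ?x ?y ?c"] edge_in[of 1 ?x ?y ?c] xy by (simp add: s_def)
  also have "Gmult m n (prod_elts fs) (prod_elts s) = prod_elts (fs @ s)"
    by (rule prod_elts_append[symmetric]) (use fs(1) s edges_subset[of 1] in auto)
  finally have fss: "prod_elts (fs @ s) = ?g" ..
  have "0 < card ?P" using partition_nonempty[OF P] finite_partition[OF P] card_gt_0_iff by blast
  show ?thesis
  proof (rule RGS_eqI[where r = "n + 1 - card ?P" and k = "card ?P - 1"])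
    show "\<exists>fs. set fs \<subseteq> edges \<and> length fs = n + 1 - card ?P \<and> prod_elts fs = ?g"
      using fs(1,2) s fss cP by (intro exI[of _ "fs @ s"]) (auto simp: s_def)
    show "n + 1 - card ?P + (card ?P - 1) = n" using fs(2) cP \<open>0 < card ?P\<close> by simp
    show "n + 1 - card ?P \<le> length fs" if "set fs \<subseteq> edges" "prod_elts fs = ?g" for fs
      using len[OF that] card_length[of fs] by linarith
  next
    fix T fs'
    assume T: "T \<subseteq> edges" "finite T" "card T \<le> card ?P - 1" and fs': "set fs' \<subseteq> edges"
      "length fs' = n + 1 - card ?P" "prod_elts fs' = ?g" and gen: "generate (G m m n) (T \<union> set fs') = Gcarrier m m n"
    have X: "T \<union> set fs' \<subseteq> Gcarrier m m n" using T fs' edges_subset[of m] by auto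
    have "n + 1 = card ?P + card (set fs')" using len[OF fs'(1,3)] card_length[of fs'] fs'(2) fs(2) cP by linarith
    then have "connects ?P T"
      using connects_absorb[OF generate_imp_connects[OF dvd_refl X gen] P] len[OF fs'(1,3)] by blast
    moreover from this have "card ?P \<le> Suc (card T)" by (rule connects_card_le(1)[OF T(2,1) P])
    ultimately show "T \<in> spanning_trees ?P" using T(1,3) \<open>0 < card ?P\<close> by (simp add: spanning_trees_def)
  next
    fix T assume "T \<in> spanning_trees ?P"
    then have T: "T \<subseteq> edges" "Suc (card T) = card ?P" "connects ?P T" "finite T"
      using finite_edges_subset by (auto simp: spanning_trees_def)
    then show "T \<subseteq> edges \<and> finite T \<and> card T = card ?P - 1" by auto
    fix fs' assume fs': "set fs' \<subseteq> edges" "length fs' = n + 1 - card ?P" "prod_elts fs' = ?g"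
    show "generate (G m m n) (T \<union> set fs') = Gcarrier m m n"
    proof (rule generate_edges_eq)
      show "T \<union> set fs' \<subseteq> edges" using T fs' by auto
      show "connects {} (T \<union> set fs')"
        by (rule connects_expand[OF T(3)]) (use together[OF fs'(1,3)] in auto)
      show "\<exists>x\<in>T \<union> set fs'. \<not> balanced q \<theta> x" if "1 < q" "q dvd int m" for q \<theta>
        using not_balanced[OF fs'(1,3) that] by blast
    qed
  qed
qed

section \<open>Cardinalities in terms of the cycle lengths\<close>

lemma card_unit_diags: "card unit_diags = n * totient m"
proof -
  let ?R = "{c. c < m \<and> coprime (int c) (int m)}"
  have "bij_betw (\<lambda>(i, c). diag i (int c)) (V \<times> ?R) unit_diags"
  proof (rule bij_betw_imageI)
    show "inj_on (\<lambda>(i, c). diag i (int c)) (V \<times> ?R)"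
    proof (rule inj_onI)
      fix x y
      assume xy: "x \<in> V \<times> ?R" "y \<in> V \<times> ?R" "(\<lambda>(i, c). diag i (int c)) x = (\<lambda>(i, c). diag i (int c)) y"
      then obtain i c j d where x: "x = (i, c)" "y = (j, d)" by (meson surj_pair)
      then have *: "i \<in> V" "j \<in> V" "c < m" "d < m" "coprime (int c) (int m)" "diag i (int c) = diag j (int d)"
        using xy by auto
      then have eq: "\<forall>k<n. [(if k = i then int c else 0) = (if k = j then int d else 0)] (mod int m)"
        by (simp add: diag_def elt_of_eq_iff)
      have "i = j"
      proof (rule ccontr)
        assume "i \<noteq> j"
        then have "int m dvd int c" using eq * by (auto simp: cong_0_iff dest: spec[of _ i])
        then show False using coprime_not_dvd[OF *(5) m_gt_1] by simp
      qed
      with eq * show "x = y" using x nat_cong_less[of c d] by (auto dest: spec[of _ i])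
    qed
    show "(\<lambda>(i, c). diag i (int c)) ` (V \<times> ?R) = unit_diags"
    proof (intro equalityI subsetI)
      fix x assume "x \<in> unit_diags"
      then obtain i c where x: "x = diag i c" "i < n" "coprime c (int m)" by (auto simp: unit_diags_def)
      obtain c' where c': "c' < m" "[int c' = c] (mod int m)" by (rule residue)
      then have "x = diag i (int c')" "coprime (int c') (int m)"
        using x cong_imp_coprime[OF cong_sym[OF c'(2)]] by (auto intro: diag_cong cong_sym)
      then show "x \<in> (\<lambda>(i, c). diag i (int c)) ` (V \<times> ?R)" using x c' by auto
    qed (auto simp: unit_diags_def simp del: coprime_int_iff)
  qed
  then have "card unit_diags = card (V \<times> ?R)" by (rule bij_betw_same_card[symmetric])
  then show ?thesis by (simp only: card_cartesian_product card_coprime_residues card_lessThan)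
qed

text \<open>\<open>T\<close> and \<open>t\<close> are recovered from the union as its edges and its
  only other member.\<close>

lemma card_insert_unit_diags:
  "card ((\<lambda>(t, T). insert t T) ` (unit_diags \<times> spanning_trees P)) = n * totient m * card (spanning_trees P)"
proof -
  have "inj_on (\<lambda>(t, T). insert t T) (unit_diags \<times> spanning_trees P)"
  proof (rule inj_onI)
    fix x y
    assume xy: "x \<in> unit_diags \<times> spanning_trees P" "y \<in> unit_diags \<times> spanning_trees P" "(\<lambda>(t, T). insert t T) x = (\<lambda>(t, T). insert t T) y"
    then obtain t T t' T' where x: "x = (t, T)" "y = (t', T')" by (meson surj_pair)
    then have *: "t \<in> unit_diags" "T \<in> spanning_trees P" "t' \<in> unit_diags" "T' \<in> spanning_trees P" "insert t T = insert t' T'"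
      using xy by auto
    have nE: "t \<notin> edges" "t' \<notin> edges" using * unit_diags_subset edges_diags_disjoint by auto
    have TE: "T \<subseteq> edges" "T' \<subseteq> edges" using * by (auto simp: spanning_trees_def)
    have "t = t'" using * nE TE by blast
    moreover have "T = insert t T \<inter> edges" "T' = insert t' T' \<inter> edges" using nE TE by auto
    then have "T = T'" using *(5) by simp
    ultimately show "x = y" using x by simp
  qed
  then show ?thesis by (simp add: card_image card_cartesian_product card_unit_diags)
qed


lemma color_eq_0_iff: "color m a C = 0 \<longleftrightarrow> int m dvd (\<Sum>k\<in>C. int (a k))"
proof -
  have "color m a C = 0 \<longleftrightarrow> m dvd (\<Sum>k\<in>C. a k)" by (simp add: color_def dvd_eq_mod_eq_0)
  then show ?thesis by (simp flip: of_nat_sum)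
qed

lemma color_cong: "[int (color m a C) = (\<Sum>k\<in>C. int (a k))] (mod int m)"
  unfolding color_def by (simp add: cong_def zmod_int)

lemma Gcarrier_pair:
  assumes "(u, a) \<in> carrier (G m p n)"
  shows "u permutes V" "(u, a) = elt_of u (\<lambda>k. int (a k))"
  using assms Gcarrier_permutes Gcarrier_elt_of by fastforce+

lemma real_powi: "real n powi (int i - int j) = real n ^ i / real n ^ j"
  using n1 by (simp add: power_int_diff)

lemma card_spanning_trees_image:
  assumes P: "partition_on V (C ` {0..k})" and inj: "inj_on C {0..k}" and lam: "\<And>i. i \<le> k \<Longrightarrow> card (C i) = lam i"
  shows "real (card (spanning_trees (C ` {0..k}))) = real m ^ k * real n powi (int k - 1) * (\<Prod>i\<le>k. real (lam i))"
proof -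
  have "card (C ` {0..k}) = Suc k" using card_image[OF inj] by simp
  moreover have "(\<Prod>B\<in>C ` {0..k}. real (card B)) = (\<Prod>i\<in>{0..k}. real (lam i))"
    unfolding prod.reindex[OF inj] comp_def by (intro prod.cong) (auto simp: lam)
  then have "(\<Prod>B\<in>C ` {0..k}. real (card B)) = (\<Prod>i\<le>k. real (lam i))"
    unfolding atLeast0AtMost .
  ultimately have "real n * real (card (spanning_trees (C ` {0..k}))) = (real m * real n) ^ k * (\<Prod>i\<le>k. real (lam i))"
    using card_spanning_trees[OF P] by simp
  \<comment> \<open>\<open>powi\<close> covers the case \<open>k = 0\<close>, where the exponent is
    -1.\<close>
  moreover have w: "real n ^ k = real n * real n powi (int k - 1)" using real_powi[of k 1] n1 by simp
  ultimately have "real n * real (card (spanning_trees (C ` {0..k}))) =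
      real n * (real m ^ k * real n powi (int k - 1) * (\<Prod>i\<le>k. real (lam i)))"
    unfolding power_mult_distrib w by (simp only: ac_simps)
  moreover have "real n \<noteq> 0" using n1 by simp
  ultimately show ?thesis using mult_left_cancel by blast
qed

lemma real_m_powi: "0 < k \<Longrightarrow> real m powi (int k - 1) = real m ^ (k - 1)"
  by (simp add: power_int_def nat_diff_distrib)

lemma zero_colored_cycles:
  assumes u: "u permutes V" and C: "cycles n u = C ` {1..k}" "inj_on C {1..k}"
    and lam: "\<forall>i\<in>{1..k}. card (C i) = lam i" and color: "\<forall>i\<in>{1..k}. color m a (C i) = 0"
  shows "D \<in> cycles n u \<Longrightarrow> int m dvd (\<Sum>k\<in>D. int (a k))" and "card (cycles n u) = k" and "0 < k"
    and "(\<Prod>B\<in>cycles n u. real (card B)) = (\<Prod>i\<in>{1..k}. real (lam i))"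
    and "coeff (epoly (\<lambda>B. real (card B)) (cycles n u)) j = real (esym j k lam)"
proof -
  have "color m a D = 0" if "D \<in> cycles n u" for D using that C(1) color by auto
  then show "int m dvd (\<Sum>k\<in>D. int (a k))" if "D \<in> cycles n u" for D
    using that by (simp only: color_eq_0_iff)
  show card: "card (cycles n u) = k" using card_image[OF C(2)] C(1) by simp
  then show "0 < k" using cycles_nonempty[OF u] by simp
  show "(\<Prod>B\<in>cycles n u. real (card B)) = (\<Prod>i\<in>{1..k}. real (lam i))"
    unfolding C(1) prod.reindex[OF C(2)] comp_def by (intro prod.cong) (use lam in auto)
  have "epoly (\<lambda>B. real (card B)) (cycles n u) = epoly (\<lambda>i. real (lam i)) {1..k}"
    unfolding epoly_def C(1) prod.reindex[OF C(2)] comp_def by (intro prod.cong) (use lam in auto)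
  then show "coeff (epoly (\<lambda>B. real (card B)) (cycles n u)) j = real (esym j k lam)"
    by (simp add: coeff_epoly esym_def)
qed

end

theorem mainTheorem20:
  fixes m n :: nat
  assumes "m \<ge> 2" and "n \<ge> 1"
  shows
   "(\<forall>u a k lam C.
      (u, a) \<in> carrier (G m 1 n) \<and> cycles n u = C ` {0..k} \<and> inj_on C {0..k} \<and>
      (\<forall>i\<le>k. card (C i) = lam i) \<and> coprime (color m a (C 0)) m \<and>
      (\<forall>i\<in>{1..k}. color m a (C i) = 0)
      \<longrightarrow> real (card (RGS (G m 1 n) (Refl m 1 n) n (u, a)))
           = real m ^ k * real n powi (int k - 1) * (\<Prod>i\<le>k. real (lam i)))
  \<and> (\<forall>u a k lam C D1 D2.
      (u, a) \<in> carrier (G m m n) \<and> cycles n u = {D1, D2} \<union> C ` {1..k} \<and>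
      D1 \<noteq> D2 \<and> D1 \<notin> C ` {1..k} \<and> D2 \<notin> C ` {1..k} \<and> inj_on C {1..k} \<and>
      card D1 + card D2 = lam 0 \<and> (\<forall>i\<in>{1..k}. card (C i) = lam i) \<and>
      (color m a D1 + color m a D2) mod m = 0 \<and>
      gcd (gcd (color m a D1) (color m a D2)) m = 1 \<and>
      (\<forall>i\<in>{1..k}. color m a (C i) = 0)
      \<longrightarrow> real (card (RGS (G m m n) (Refl m m n) n (u, a)))
           = real m ^ k * real n powi (int k - 1) * (\<Prod>i\<le>k. real (lam i)))
  \<and> (\<forall>u a k lam C.
      (u, a) \<in> carrier (G m 1 n) \<and> cycles n u = C ` {1..k} \<and> inj_on C {1..k} \<and>
      (\<forall>i\<in>{1..k}. card (C i) = lam i) \<and> (\<forall>i\<in>{1..k}. color m a (C i) = 0)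
      \<longrightarrow> real (card (RGS (G m 1 n) (Refl m 1 n) n (u, a)))
           = real (totient m) * real m powi (int k - 1) * real n powi (int k - 1)
             * (\<Prod>i\<in>{1..k}. real (lam i)))
  \<and> (\<forall>u a k lam C.
      (u, a) \<in> carrier (G m m n) \<and> cycles n u = C ` {1..k} \<and> inj_on C {1..k} \<and>
      (\<forall>i\<in>{1..k}. card (C i) = lam i) \<and> (\<forall>i\<in>{1..k}. color m a (C i) = 0)
      \<longrightarrow> real (card (RGS (G m m n) (Refl m m n) n (u, a)))
           = real (totient m) * real m powi (int k - 1) / 2
             * (real n powi int k - real n powi (int k - 1)
                - (\<Sum>j\<in>{2..k}. fact (j - 2) * real n powi (int k - int j) * real (esym j k lam)))
             * (\<Prod>i\<in>{1..k}. real (lam i)))"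
proof -
  interpret colored_perms m n by unfold_locales (use assms in auto)
  show ?thesis
  proof (intro conjI allI impI; elim conjE)
    fix u a k and lam :: "nat \<Rightarrow> nat" and C
    assume *: "(u, a) \<in> carrier (G m 1 n)" "cycles n u = C ` {0..k}" "inj_on C {0..k}"
      "\<forall>i\<le>k. card (C i) = lam i" "coprime (color m a (C 0)) m" "\<forall>i\<in>{1..k}. color m a (C i) = 0"
    note ua = Gcarrier_pair[OF *(1)]
    have "RGS (G m 1 n) (Refl m 1 n) n (u, a) = spanning_trees (cycles n u)"
      unfolding Refl_1 ua(2)
    proof (rule RGS_1_unit[OF ua(1)])
      show "C 0 \<in> cycles n u" using *(2) by auto
      have "coprime (int (color m a (C 0))) (int m)" using *(5) by simp
      then show "coprime (\<Sum>k\<in>C 0. int (a k)) (int m)" by (rule cong_imp_coprime[OF color_cong])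
      fix D assume D: "D \<in> cycles n u - {C 0}"
      then have "D \<in> C ` {0..k}" using *(2) by simp
      then obtain i where "D = C i" "i \<in> {0..k}" by (rule imageE)
      with D have "color m a D = 0" using *(6) by (cases "i = 0") auto
      then show "int m dvd (\<Sum>k\<in>D. int (a k))" by (simp only: color_eq_0_iff)
    qed
    then show "real (card (RGS (G m 1 n) (Refl m 1 n) n (u, a))) =
        real m ^ k * real n powi (int k - 1) * (\<Prod>i\<le>k. real (lam i))"
      using card_spanning_trees_image[OF _ *(3)] partition_cycles[OF ua(1)] *(4) unfolding *(2) by simp
  next
    fix u a k and lam :: "nat \<Rightarrow> nat" and C D1 D2
    assume *: "(u, a) \<in> carrier (G m m n)" "cycles n u = {D1, D2} \<union> C ` {1..k}"
      "D1 \<noteq> D2" "D1 \<notin> C ` {1..k}" "D2 \<notin> C ` {1..k}" "inj_on C {1..k}"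
      "card D1 + card D2 = lam 0" "\<forall>i\<in>{1..k}. card (C i) = lam i"
      "(color m a D1 + color m a D2) mod m = 0" "gcd (gcd (color m a D1) (color m a D2)) m = 1"
      "\<forall>i\<in>{1..k}. color m a (C i) = 0"
    note ua = Gcarrier_pair[OF *(1)]
    note P = partition_cycles[OF ua(1)]
    have D: "D1 \<in> cycles n u" "D2 \<in> cycles n u" using *(2) by auto
    let ?P = "merge (cycles n u) D1 D2"
    have dvd: "m dvd color m a D1 + color m a D2" using *(9) by auto
    \<comment> \<open>The two colors cancel modulo \<open>m\<close>, so a common divisor of
      \<open>m\<close> and the first one also divides the second.\<close>
    have cop: "coprime (color m a D1) m"
    proof -
      let ?g = "gcd (color m a D1) m"
      have "?g dvd color m a D1 + color m a D2" using dvd dvd_trans gcd_dvd2 by blast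
      then have "?g dvd color m a D2" by (metis dvd_add_right_iff gcd_dvd1)
      then have "?g dvd gcd (gcd (color m a D1) (color m a D2)) m" by simp
      then show ?thesis unfolding *(10) by (simp add: coprime_iff_gcd_eq_1)
    qed
    have "RGS (G m m n) (Refl m m n) n (u, a) = spanning_trees ?P"
      unfolding Refl_m ua(2)
    proof (rule RGS_m_unit[OF ua(1) D *(3)])
      have "int m dvd int (color m a D1) + int (color m a D2)" using dvd by (simp flip: of_nat_add)
      then show "int m dvd (\<Sum>k\<in>D1. int (a k)) + (\<Sum>k\<in>D2. int (a k))"
        using cong_dvd_iff[OF cong_add[OF color_cong[of a D1] color_cong[of a D2]]] by simp
      have "coprime (int (color m a D1)) (int m)" using cop by simp
      then show "coprime (\<Sum>k\<in>D1. int (a k)) (int m)" by (rule cong_imp_coprime[OF color_cong])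
      fix D assume "D \<in> cycles n u - {D1, D2}"
      then have "color m a D = 0" using *(2,11) by auto
      then show "int m dvd (\<Sum>k\<in>D. int (a k))" by (simp only: color_eq_0_iff)
    qed
    \<comment> \<open>The merged block takes the index 0; its size is \<open>lam 0\<close>.\<close>
    moreover define C' where "C' = C(0 := D1 \<union> D2)"
    have sets: "cycles n u - {D1, D2} = C ` {1..k}" using *(2,4,5) by auto
    have img1: "C' ` {1..k} = C ` {1..k}" by (auto simp: C'_def)
    have ins: "{0..k} = insert 0 {1..k}" by auto
    have img: "?P = C' ` {0..k}" unfolding merge_def sets ins image_insert img1 by (simp add: C'_def)
    have inj: "inj_on C' {0..k}"
    proof -
      have "C' i = C i" if "i \<in> {1..k}" for i using that by (simp add: C'_def)
      then have "inj_on C' {1..k}" using *(6) inj_on_cong[of "{1..k}" C' C] by blast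
      moreover have "C' 0 \<notin> C' ` {1..k}" unfolding img1
        using merge_notin[OF P D *(3)] sets by (simp add: C'_def)
      moreover have "{1..k} - {0} = {1..k}" by auto
      ultimately show ?thesis unfolding ins inj_on_insert by simp
    qed
    have "card (C' i) = lam i" if "i \<le> k" for i
      using card_Un_blocks[OF P D *(3)] *(7,8) that by (cases "i = 0") (auto simp: C'_def simp flip: of_nat_add)
    ultimately show "real (card (RGS (G m m n) (Refl m m n) n (u, a))) =
        real m ^ k * real n powi (int k - 1) * (\<Prod>i\<le>k. real (lam i))"
      using card_spanning_trees_image[OF _ inj] partition_on_merge[OF P D *(3)] unfolding img by simp
  next
    fix u a k and lam :: "nat \<Rightarrow> nat" and C
    assume *: "(u, a) \<in> carrier (G m 1 n)" "cycles n u = C ` {1..k}" "inj_on C {1..k}"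
      "\<forall>i\<in>{1..k}. card (C i) = lam i" "\<forall>i\<in>{1..k}. color m a (C i) = 0"
    note ua = Gcarrier_pair[OF *(1)]
    note facts = zero_colored_cycles[OF ua(1) *(2-5)]
    note zero = facts(1) and card = facts(2) and k = facts(3) and prod = facts(4)
    have "RGS (G m 1 n) (Refl m 1 n) n (u, a) = (\<lambda>(t, T). insert t T) ` (unit_diags \<times> spanning_trees (cycles n u))"
      unfolding Refl_1 ua(2) by (rule RGS_1_zero[OF ua(1) zero])
    then have "real (card (RGS (G m 1 n) (Refl m 1 n) n (u, a))) =
        real (totient m) * (real n * real (card (spanning_trees (cycles n u))))"
      by (simp only: card_insert_unit_diags of_nat_mult ac_simps)
    also have "\<dots> = real (totient m) * ((real m * real n) ^ (k - 1) * (\<Prod>i\<in>{1..k}. real (lam i)))"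
      using card_spanning_trees[OF partition_cycles[OF ua(1)]] unfolding card prod by simp
    also have "\<dots> = real (totient m) * real m powi (int k - 1) * real n powi (int k - 1) * (\<Prod>i\<in>{1..k}. real (lam i))"
      using k real_m_powi[OF k] n1 by (simp add: power_mult_distrib power_int_def nat_diff_distrib)
    finally show "real (card (RGS (G m 1 n) (Refl m 1 n) n (u, a))) =
        real (totient m) * real m powi (int k - 1) * real n powi (int k - 1) * (\<Prod>i\<in>{1..k}. real (lam i))" .
  next
    fix u a k and lam :: "nat \<Rightarrow> nat" and C
    assume *: "(u, a) \<in> carrier (G m m n)" "cycles n u = C ` {1..k}" "inj_on C {1..k}"
      "\<forall>i\<in>{1..k}. card (C i) = lam i" "\<forall>i\<in>{1..k}. color m a (C i) = 0"
    note ua = Gcarrier_pair[OF *(1)]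
    note facts = zero_colored_cycles[OF ua(1) *(2-5)]
    note zero = facts(1) and card = facts(2) and k = facts(3) and prod = facts(4) and esym = facts(5)
    have "bracket k (real n) (epoly (\<lambda>B. real (card B)) (cycles n u)) =
        real n powi int k - real n powi (int k - 1)
        - (\<Sum>j\<in>{2..k}. fact (j - 2) * real n powi (int k - int j) * real (esym j k lam))"
    proof -
      \<comment> \<open>No exponent is negative, since \<open>j \<le> k\<close>; the instance
        \<open>j = 1\<close> relies on there being at least one cycle.\<close>
      have "real n powi (int k - int j) = real n ^ (k - j)" if "j \<le> k" for j
        using that by (simp add: power_int_def nat_diff_distrib)
      from this[of 1] this show ?thesis using k by (simp add: bracket_def esym)
    qed
    moreover obtain \<theta> where "RGS (G m m n) (Refl m m n) n (u, a) = unicyclic_sets (cycles n u) \<theta>"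
      unfolding Refl_m ua(2) by (rule RGS_m_zero[OF ua(1) zero])
    ultimately show "real (card (RGS (G m m n) (Refl m m n) n (u, a))) =
        real (totient m) * real m powi (int k - 1) / 2
          * (real n powi int k - real n powi (int k - 1)
             - (\<Sum>j\<in>{2..k}. fact (j - 2) * real n powi (int k - int j) * real (esym j k lam)))
          * (\<Prod>i\<in>{1..k}. real (lam i))"
      using card_unicyclic_sets[OF partition_cycles[OF ua(1)], of \<theta>] real_m_powi[OF k] unfolding card prod by simp
  qed
qed

end
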